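(* Let $Z$ be a Markov jump process on the finite state space $\mathcal{Z}$ with transition intensities $\mu_{jk}$, and let $R$ be a right-censoring time independent of $Z$. Fix $j,k\in\mathcal{Z}$ with $j\neq k$ and a time $t\ge 0$. Assume $\mu_{jk}(t)>0$ and $\mathbb{E}[N_{jk}(r)^4]<\infty$ for all $r\geq 0$. For each $n$ let $m=m_n$ be such that $t\in I_n=[t_{m-1},t_m)$. Assume that $p_j^{c}$ and $\mu_{jk}$ are $C^1$ and $C^2$, respectively, in a neighbourhood of $t$, and that $p_j^{c}(t)>0$. Let $\Delta_n:=t_m-t_{m-1}$ satisfy, as $n\to\infty$, $\Delta_n\downarrow 0$, $n\Delta_n\to\infty$ and $n\Delta_n^3\to 0$. Then, as $n\to\infty$, $$\sqrt{n\Delta_n}\,\bigl(\hat\mu_{jk}^{(m)}-\mu_{jk}(t)\bigr)\overset{d}{\longrightarrow}N\Bigl(0,\frac{\mu_{jk}(t)}{p_j^{c}(t)}\Bigr).$$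
   Context: Setting. $Z=(Z_t)_{t\ge0}$ is a jump process on a finite state space $\mathcal{Z}$, defined on a filtered probability space satisfying the usual conditions. $N_{jk}(t)=\#\{s\in(0,t]: Z_{s-}=j, Z_s=k\}$ for $j\ne k$, and $\mathbb{E}[N_{jk}(t)]<\infty$ for all $t\ge 0$ and all $j\neq k$. $Z$ is Markov with (measurable) transition intensities $\mu_{jk}$: with respect to the completed natural filtration $(\mathcal{F}_t)$ of $Z$, the process $N_{jk}(t)-\int_0^t 1_{(Z_{s-}=j)}\mu_{jk}(s)\,ds$ is a mean-zero martingale. $R\geq 0$ is a random variable (right-censoring time) with $Z$ and $R$ independent. The censored occupation probability is $p_j^{c}(t):=\mathbb{P}(Z_t=j,\ t\le R)$. Data and estimator. $(Z^i,R^i)$, $i=1,2,\dots$, are iid copies of $(Z,R)$, and $N^i_{jk}$ is the counting process of $Z^i$. For each $n$ a deterministic partition of the time axis into intervals $[t_{m-1},t_m)$ is given (the endpoints may depend on $n$, suppressed in the notation). The occurrence and exposure based on the first $n$ observations are $$O_{jk}(m)=\sum_{i=1}^n\int_{[t_{m-1},t_m)}dN^i_{jk}(s\wedge R^i),\qquad E_j(m)=\sum_{i=1}^n\int_{t_{m-1}}^{t_m}1_{(s<R^i)}1_{(Z^i_s=j)}\,ds,$$ i.e. $O_{jk}(m)$ counts jumps from $j$ to $k$ at times $s\in[t_{m-1},t_m)$ with $s\le R^i$. The occurrence/exposure rate is $\hat\mu_{jk}^{(m)}=O_{jk}(m)/E_j(m)$ (set to $0$, say, if $E_j(m)=0$).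 *)

theory Defs
  imports "HOL-Probability.Probability"
begin

text \<open>
  Time is the half-line \<open>{0..}\<close> inside \<^typ>\<open>real\<close>; values of processes, filtrations and
  intensities at negative times are never used.  The finite state space is a type of
  class \<^class>\<open>finite\<close>, with discrete topology and sigma-algebra.
\<close>

subsection \<open>Filtrations and martingales\<close>

definition usual_conditions :: "'w measure \<Rightarrow> (real \<Rightarrow> 'w measure) \<Rightarrow> bool" where
  "usual_conditions M G \<longleftrightarrow>
     prob_space M \<and> complete_measure M \<and>
     (\<forall>t\<ge>0. subalgebra M (G t)) \<and>
     (\<forall>s t. 0 \<le> s \<and> s \<le> t \<longrightarrow> sets (G s) \<subseteq> sets (G t)) \<and>
     null_sets M \<subseteq> sets (G 0) \<and>
     (\<forall>t\<ge>0. sets (G t) = (\<Inter>u\<in>{t<..}. sets (G u)))"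

definition completed_natural_filtration ::
    "'w measure \<Rightarrow> (real \<Rightarrow> 'w \<Rightarrow> 'z) \<Rightarrow> real \<Rightarrow> 'w measure" where
  "completed_natural_filtration M Z t =
     sigma (space M)
       ((\<Union>s\<in>{0..t}. {Z s -` A \<inter> space M | A. A \<in> UNIV}) \<union> null_sets M)"

definition martingale :: "'w measure \<Rightarrow> (real \<Rightarrow> 'w measure) \<Rightarrow> (real \<Rightarrow> 'w \<Rightarrow> real) \<Rightarrow> bool" where
  "martingale M F X \<longleftrightarrow>
     (\<forall>t\<ge>0. X t \<in> borel_measurable (F t)) \<and>
     (\<forall>t\<ge>0. integrable M (X t)) \<and>
     (\<forall>s t. 0 \<le> s \<and> s \<le> t \<longrightarrow> (AE \<omega> in M. real_cond_exp M (F s) (X t) \<omega> = X s \<omega>))"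

subsection \<open>Jump processes and their counting processes\<close>

text \<open>
  Right-continuity with left limits for the discrete topology: the path is piecewise constant
  with finitely many jumps on every bounded time interval.
\<close>

definition jump_path :: "(real \<Rightarrow> 'z) \<Rightarrow> bool" where
  "jump_path z \<longleftrightarrow>
     (\<forall>s\<ge>0. \<forall>\<^sub>F u in at_right s. z u = z s) \<and>
     (\<forall>s>0. \<exists>x. \<forall>\<^sub>F u in at_left s. z u = x)"

definition left_state :: "(real \<Rightarrow> 'z) \<Rightarrow> real \<Rightarrow> 'z" where
  "left_state z s = (THE x. \<forall>\<^sub>F u in at_left s. z u = x)"

definition jump_times :: "'z \<Rightarrow> 'z \<Rightarrow> (real \<Rightarrow> 'z) \<Rightarrow> real set" where
  "jump_times j k z = {s. 0 < s \<and> left_state z s = j \<and> z s = k}"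

definition jump_count :: "'z \<Rightarrow> 'z \<Rightarrow> (real \<Rightarrow> 'z) \<Rightarrow> real \<Rightarrow> nat" where
  "jump_count j k z t = card (jump_times j k z \<inter> {0<..t})"

definition path_space :: "(real \<Rightarrow> 'z) measure" where
  "path_space = PiM {0..} (\<lambda>_. count_space UNIV)"

definition path_of :: "(real \<Rightarrow> 'w \<Rightarrow> 'z) \<Rightarrow> 'w \<Rightarrow> real \<Rightarrow> 'z" where
  "path_of Z \<omega> = (\<lambda>s\<in>{0..}. Z s \<omega>)"

definition jump_process ::
    "'w measure \<Rightarrow> (real \<Rightarrow> 'w measure) \<Rightarrow> (real \<Rightarrow> 'w \<Rightarrow> 'z) \<Rightarrow> bool" where
  "jump_process M G Z \<longleftrightarrow>
     (\<forall>t\<ge>0. Z t \<in> measurable (G t) (count_space UNIV)) \<and>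
     (\<forall>\<omega>\<in>space M. jump_path (\<lambda>s. Z s \<omega>))"

subsection \<open>Markov property and transition intensities\<close>

definition markov_process :: "'w measure \<Rightarrow> (real \<Rightarrow> 'w \<Rightarrow> 'z) \<Rightarrow> bool" where
  "markov_process M Z \<longleftrightarrow>
     (\<forall>s t i. 0 \<le> s \<and> s \<le> t \<longrightarrow>
        (AE \<omega> in M.
           real_cond_exp M (completed_natural_filtration M Z s)
             (\<lambda>\<omega>. of_bool (Z t \<omega> = i)) \<omega> =
           real_cond_exp M (vimage_algebra (space M) (Z s) (count_space UNIV))
             (\<lambda>\<omega>. of_bool (Z t \<omega> = i)) \<omega>))"

text \<open>
  The explicit integrability clause excludes the convention that the Bochner integral of a
  non-integrable function is 0.
\<close>

definition transition_intensities ::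
    "'w measure \<Rightarrow> (real \<Rightarrow> 'w \<Rightarrow> 'z) \<Rightarrow> ('z \<Rightarrow> 'z \<Rightarrow> real \<Rightarrow> real) \<Rightarrow> bool" where
  "transition_intensities M Z \<mu> \<longleftrightarrow>
     (\<forall>j k. j \<noteq> k \<longrightarrow>
        \<mu> j k \<in> borel_measurable (restrict_space borel {0..}) \<and>
        (\<forall>s\<ge>0. 0 \<le> \<mu> j k s) \<and>
        (\<forall>t\<ge>0. AE \<omega> in M. set_integrable lborel {0..t}
            (\<lambda>s. of_bool (left_state (\<lambda>u. Z u \<omega>) s = j) * \<mu> j k s)) \<and>
        (let X = (\<lambda>t \<omega>. real (jump_count j k (\<lambda>u. Z u \<omega>) t) -
               (LINT s:{0..t}|lborel. of_bool (left_state (\<lambda>u. Z u \<omega>) s = j) * \<mu> j k s))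
         in martingale M (completed_natural_filtration M Z) X \<and>
            (\<forall>t\<ge>0. prob_space.expectation M (X t) = 0)))"

text \<open>
  Independence of two random elements of different types, which the library's
  \<open>indep_var\<close> does not admit.
\<close>

definition indep_elements ::
    "'w measure \<Rightarrow> 'a measure \<Rightarrow> ('w \<Rightarrow> 'a) \<Rightarrow> 'b measure \<Rightarrow> ('w \<Rightarrow> 'b) \<Rightarrow> bool" where
  "indep_elements M S X T Y \<longleftrightarrow>
     X \<in> measurable M S \<and> Y \<in> measurable M T \<and>
     prob_space.indep_set M {X -` A \<inter> space M | A. A \<in> sets S}
                            {Y -` B \<inter> space M | B. B \<in> sets T}"

subsection \<open>Censoring, occurrences and exposures\<close>

definition censored_occupation ::
    "'w measure \<Rightarrow> (real \<Rightarrow> 'w \<Rightarrow> 'z) \<Rightarrow> ('w \<Rightarrow> real) \<Rightarrow> 'z \<Rightarrow> real \<Rightarrow> real" where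
  "censored_occupation M Z R j t = measure M {\<omega> \<in> space M. Z t \<omega> = j \<and> t \<le> R \<omega>}"

definition iid_copies ::
    "'v measure \<Rightarrow> (nat \<Rightarrow> real \<Rightarrow> 'v \<Rightarrow> 'z) \<Rightarrow> (nat \<Rightarrow> 'v \<Rightarrow> real) \<Rightarrow>
     'w measure \<Rightarrow> (real \<Rightarrow> 'w \<Rightarrow> 'z) \<Rightarrow> ('w \<Rightarrow> real) \<Rightarrow> bool" where
  "iid_copies P Zs Rs M Z R \<longleftrightarrow>
     prob_space.indep_vars P (\<lambda>_. path_space \<Otimes>\<^sub>M borel)
       (\<lambda>i \<omega>. (path_of (Zs i) \<omega>, Rs i \<omega>)) {1..} \<and>
     (\<forall>i\<ge>1. distr P (path_space \<Otimes>\<^sub>M borel) (\<lambda>\<omega>. (path_of (Zs i) \<omega>, Rs i \<omega>)) =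
             distr M (path_space \<Otimes>\<^sub>M borel) (\<lambda>\<omega>. (path_of Z \<omega>, R \<omega>))) \<and>
     (\<forall>i\<ge>1. \<forall>\<omega>\<in>space P. jump_path (\<lambda>s. Zs i s \<omega>))"

definition occurrence ::
    "(nat \<Rightarrow> real \<Rightarrow> 'v \<Rightarrow> 'z) \<Rightarrow> (nat \<Rightarrow> 'v \<Rightarrow> real) \<Rightarrow> 'z \<Rightarrow> 'z \<Rightarrow>
     nat \<Rightarrow> real \<Rightarrow> real \<Rightarrow> 'v \<Rightarrow> nat" where
  "occurrence Zs Rs j k n a b \<omega> =
     (\<Sum>i=1..n. card (jump_times j k (\<lambda>s. Zs i s \<omega>) \<inter> {a..<b} \<inter> {..Rs i \<omega>}))"

definition exposure ::
    "(nat \<Rightarrow> real \<Rightarrow> 'v \<Rightarrow> 'z) \<Rightarrow> (nat \<Rightarrow> 'v \<Rightarrow> real) \<Rightarrow> 'z \<Rightarrow>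
     nat \<Rightarrow> real \<Rightarrow> real \<Rightarrow> 'v \<Rightarrow> real" where
  "exposure Zs Rs j n a b \<omega> =
     (\<Sum>i=1..n. LINT s:{a..b}|lborel. of_bool (s < Rs i \<omega>) * of_bool (Zs i s \<omega> = j))"

text \<open>The value is 0 when the exposure is 0, since \<open>x / 0 = 0\<close>.\<close>

definition oe_rate ::
    "(nat \<Rightarrow> real \<Rightarrow> 'v \<Rightarrow> 'z) \<Rightarrow> (nat \<Rightarrow> 'v \<Rightarrow> real) \<Rightarrow> 'z \<Rightarrow> 'z \<Rightarrow>
     nat \<Rightarrow> real \<Rightarrow> real \<Rightarrow> 'v \<Rightarrow> real" where
  "oe_rate Zs Rs j k n a b \<omega> =
     real (occurrence Zs Rs j k n a b \<omega>) / exposure Zs Rs j n a b \<omega>"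

definition time_partition :: "(nat \<Rightarrow> real) \<Rightarrow> bool" where
  "time_partition \<tau> \<longleftrightarrow> \<tau> 0 = 0 \<and> strict_mono \<tau> \<and> filterlim \<tau> at_top sequentially"

subsection \<open>Local smoothness\<close>

primrec Ck_on :: "nat \<Rightarrow> (real \<Rightarrow> real) \<Rightarrow> real set \<Rightarrow> bool" where
  "Ck_on 0 f U \<longleftrightarrow> continuous_on U f"
| "Ck_on (Suc r) f U \<longleftrightarrow>
     (\<exists>f'. (\<forall>x\<in>U. (f has_real_derivative f' x) (at x within U)) \<and> Ck_on r f' U)"

text \<open>
  Neighbourhoods are taken in the time axis \<open>{0..}\<close>: two-sided for \<open>t > 0\<close>,
  one-sided for \<open>t = 0\<close>.
\<close>

definition Ck_near :: "nat \<Rightarrow> (real \<Rightarrow> real) \<Rightarrow> real \<Rightarrow> bool" where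
  "Ck_near r f t \<longleftrightarrow> (\<exists>e>0. Ck_on r f ({0..} \<inter> ball t e))"

end

theory Submission
  imports Defs
begin

text \<open>
  Write \<open>O\<close> and \<open>E\<close> for the total occurrence and exposure of the first \<open>n\<close> observations in
  the interval \<open>[a, b)\<close> that contains \<open>t\<close>, \<open>\<Delta> = b - a\<close>, \<open>c\<close> for the intensity at \<open>t\<close> and \<open>p\<close>
  for the censored occupation probability at \<open>t\<close>.  As soon as \<open>E \<noteq> 0\<close>,
  the scaled error of the rate \<open>O / E\<close> is the quotient of
  \<open>S = (O - c E) / sqrt (n \<Delta>)\<close> and \<open>D = E / (n \<Delta>)\<close>.  Both are row sums of iid variables,
  and the theorem follows from \<open>S \<longlongrightarrow> N(0, c p)\<close> in law and \<open>D \<longlongrightarrow> p\<close> in mean square.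

  All estimates concern one observation, whose occurrence and exposure are now written \<open>O\<close> and \<open>E\<close>,
  with residual \<open>X = O - c E\<close>.
  The mean of \<open>X\<close> is of order \<open>\<Delta>\<^sup>2\<close>: the compensator of the jump count is the
  exposure weighted with the intensity, and the intensity differs from \<open>c\<close> by a multiple of \<open>\<Delta>\<close>
  (\<open>residual_mean\<close>).  Since \<open>n \<Delta>\<^sup>3 \<longlongrightarrow> 0\<close>, this bias disappears.  The
  martingale property also shows that two jumps in one interval have probability of order \<open>\<Delta>\<^sup>2\<close>,
  in the strong form of a bound on the second factorial moment (\<open>factorial_moment\<close>).  Up to such
  terms \<open>X\<^sup>2\<close> is \<open>O\<close>, so its mean is \<open>c p \<Delta>\<close> to first order (\<open>residual_variance\<close>), and the same
  bound verifies a Lindeberg condition (\<open>residual_lindeberg\<close>).  A second-order expansion of the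
  characteristic function of \<open>X\<close> then gives the limit law of \<open>S\<close> (\<open>row_char_tendsto\<close>), a
  form of Slutsky's theorem passes to the quotient (\<open>ratio_char_tendsto\<close>), and Levy's continuity
  theorem concludes.

  The independent censoring time is handled by Fubini's theorem: for a fixed censoring time the
  mean of the residual is bounded uniformly in that time, and the bound survives integration.

  The observations are only known to have the same law and to be independent as random elements
  of a product space over an uncountable time axis.  Jump counts and exposures are therefore
  represented by limits of functions of finitely many coordinates, which agree with
  them on piecewise constant paths.
\<close>

section \<open>Paths with finitely many jumps\<close>

text \<open>
  The point \<open>x\<close> may lie outside the interval, and then the path is constant there.
\<close>

definition one_switch :: "(real \<Rightarrow> 'z) \<Rightarrow> real \<Rightarrow> real \<Rightarrow> real \<Rightarrow> bool" where
  "one_switch z u v x \<longleftrightarrow>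
     (\<forall>s\<in>{u..v}. s < x \<longrightarrow> z s = z u) \<and> (\<forall>s\<in>{u..v}. x \<le> s \<longrightarrow> z s = z v)"

lemma one_switchD:
  assumes "one_switch z u v x" "u \<le> s" "s \<le> v"
  shows "z s = (if s < x then z u else z v)"
proof (cases "s < x")
  case True
  have "z s = z u" using assms True unfolding one_switch_def by (meson atLeastAtMost_iff)
  with True show ?thesis by presburger
next
  case False
  have "z s = z v" using assms False unfolding one_switch_def by (meson atLeastAtMost_iff linorder_not_le)
  with False show ?thesis by presburger
qed

text \<open>
  Each time \<open>x\<close> is the centre of a ball in which the path is constant before \<open>x\<close> and constant
  from \<open>x\<close> on.  The compact interval \<open>{0..T}\<close> is covered by these balls, and \<open>d\<close> is a Lebesgue
  number of the cover.
\<close>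

lemma jump_path_one_switch:
  fixes z :: "real \<Rightarrow> 'z"
  assumes z: "jump_path z"
  shows "\<exists>d>0. \<forall>u v. 0 \<le> u \<and> u \<le> v \<and> v \<le> T \<and> v - u < d \<longrightarrow> (\<exists>x. one_switch z u v x)"
proof -
  have "\<exists>e>0. \<exists>y. (\<forall>s. 0 \<le> s \<and> x - e < s \<and> s < x \<longrightarrow> z s = y) \<and>
                (\<forall>s. x \<le> s \<and> s < x + e \<longrightarrow> z s = z x)" if x: "0 \<le> x" for x
  proof -
    have "\<forall>\<^sub>F u in at_right x. z u = z x" using z x by (auto simp: jump_path_def)
    then obtain b where b: "b > x" "\<And>u. x < u \<Longrightarrow> u < b \<Longrightarrow> z u = z x"
      unfolding eventually_at_right_field by blast
    have "\<exists>a<x. \<exists>y. \<forall>s. 0 \<le> s \<and> a < s \<and> s < x \<longrightarrow> z s = y"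
    proof (cases "x = 0")
      case True
      then show ?thesis by (intro exI[of _ "-1"]) auto
    next
      case False
      with x have "0 < x" by simp
      with z obtain y where "\<forall>\<^sub>F u in at_left x. z u = y" by (auto simp: jump_path_def)
      then show ?thesis unfolding eventually_at_left_field by blast
    qed
    then obtain a y where a: "a < x" "\<forall>s. 0 \<le> s \<and> a < s \<and> s < x \<longrightarrow> z s = y" by blast
    show ?thesis
    proof (intro exI[of _ "min (x - a) (b - x)"] conjI exI[of _ y] allI impI)
      show "0 < min (x - a) (b - x)" using a b by auto
      show "z s = y" if "0 \<le> s \<and> x - min (x - a) (b - x) < s \<and> s < x" for s
      proof -
        have "a < s" using that by linarith
        with a(2) that show ?thesis by blast
      qed
      show "z s = z x" if s: "x \<le> s \<and> s < x + min (x - a) (b - x)" for s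
      proof (cases "s = x")
        case False
        with s have "x < s" "s < b" by linarith+
        with b(2) show ?thesis by blast
      qed simp
    qed
  qed
  then obtain e y where e: "\<And>x. 0 \<le> x \<Longrightarrow> 0 < e x"
      and l: "\<And>x s. 0 \<le> x \<Longrightarrow> 0 \<le> s \<Longrightarrow> x - e x < s \<Longrightarrow> s < x \<Longrightarrow> z s = y x"
      and r: "\<And>x s. 0 \<le> x \<Longrightarrow> x \<le> s \<Longrightarrow> s < x + e x \<Longrightarrow> z s = z x"
    by metis
  obtain d where d: "0 < d"
    "\<And>u. u \<in> {0..T} \<Longrightarrow> \<exists>B\<in>(\<lambda>x. ball x (e x)) ` {0..}. ball u d \<subseteq> B"
  proof (rule Heine_Borel_lemma)
    show "compact {0..T}" by simp
    show "{0..T} \<subseteq> \<Union> ((\<lambda>x. ball x (e x)) ` {0..})" using e by force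
    show "open G" if "G \<in> (\<lambda>x. ball x (e x)) ` {0..}" for G using that by auto
  qed blast
  show ?thesis
  proof (rule exI[of _ d], intro conjI allI impI)
    show "0 < d" by fact
    fix u v assume uv: "0 \<le> u \<and> u \<le> v \<and> v \<le> T \<and> v - u < d"
    with d(2)[of u] obtain x where x: "0 \<le> x" "ball u d \<subseteq> ball x (e x)" by auto
    have *: "x - e x < s \<and> s < x + e x" if "s \<in> {u..v}" for s
    proof -
      have "s \<in> ball u d" using that uv by (auto simp: dist_real_def)
      with x have "s \<in> ball x (e x)" by blast
      then show ?thesis by (auto simp: dist_real_def)
    qed
    have "z s = z u" if s: "s \<in> {u..v}" "s < x" for s
    proof -
      have "u \<in> {u..v}" using uv by auto
      have "z s = y x" using l[of x s] *[of s] s x uv by auto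
      moreover have "z u = y x" using l[of x u] *[OF \<open>u \<in> {u..v}\<close>] s x uv by auto
      ultimately show ?thesis by simp
    qed
    moreover have "z s = z v" if s: "s \<in> {u..v}" "x \<le> s" for s
    proof -
      have "v \<in> {u..v}" using uv by auto
      have "z s = z x" using r[of x s] *[of s] s x by auto
      moreover have "z v = z x" using r[of x v] *[OF \<open>v \<in> {u..v}\<close>] s x by auto
      ultimately show ?thesis by simp
    qed
    ultimately show "\<exists>x. one_switch z u v x" unfolding one_switch_def by blast
  qed
qed

lemma left_state_eqI:
  assumes "u < s" "\<And>y. u < y \<Longrightarrow> y < s \<Longrightarrow> z y = c"
  shows "left_state z s = c"
proof -
  have *: "\<forall>\<^sub>F y in at_left s. z y = c"
    unfolding eventually_at_left_field using assms by blast
  show ?thesis unfolding left_state_def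
  proof (rule the_equality, rule *)
    fix x assume "\<forall>\<^sub>F u in at_left s. z u = x"
    with * have "\<forall>\<^sub>F u in at_left s. x = c" by eventually_elim simp
    then show "x = c" by (simp add: eventually_const_iff trivial_limit_at_left_real)
  qed
qed

lemma one_switch_left_state:
  assumes "one_switch z u v x" "u < s" "s \<le> v"
  shows "left_state z s = (if s \<le> x then z u else z v)"
proof -
  have zy: "z y = (if y < x then z u else z v)" if "u < y" "y < s" for y
    using that assms by (intro one_switchD) auto
  show ?thesis
  proof (cases "s \<le> x")
    case True
    have "left_state z s = z u"
      by (rule left_state_eqI[OF assms(2)]) (use zy True in force)
    with True show ?thesis by simp
  next
    case False
    have "left_state z s = z v"
      by (rule left_state_eqI[of "max u x"]) (use zy False assms in force)+
    with False show ?thesis by simp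
  qed
qed

text \<open>
  On a short interval a jump can be read off from the states at the two end points.  This reduces
  jump counts to functions of countably many coordinates of the path.
\<close>

lemma one_switch_jump_times:
  assumes sw: "one_switch z u v x" and uv: "0 \<le> u" "u \<le> v" and jk: "j \<noteq> k"
  shows "jump_times j k z \<inter> {u<..v} = (if z u = j \<and> z v = k then {x} else {})"
proof -
  have x: "u < x \<and> x \<le> v" if "z u = j" "z v = k"
  proof -
    have "u \<in> {u..v}" "v \<in> {u..v}" "z u \<noteq> z v" using uv that jk by auto
    with sw have "\<not> x \<le> u" "\<not> v < x" unfolding one_switch_def by metis+
    then show ?thesis by simp
  qed
  have zs: "z s = (if s < x then z u else z v)" if "u < s" "s \<le> v" for s
    using that by (intro one_switchD[OF sw]) auto
  have "s \<in> jump_times j k z \<longleftrightarrow> s = x \<and> z u = j \<and> z v = k" if s: "u < s" "s \<le> v" for s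
  proof -
    have "s \<in> jump_times j k z \<longleftrightarrow>
        (if s \<le> x then z u else z v) = j \<and> (if s < x then z u else z v) = k"
      unfolding jump_times_def mem_Collect_eq one_switch_left_state[OF sw s] zs[OF s]
      using s uv by linarith
    also have "\<dots> \<longleftrightarrow> s = x \<and> z u = j \<and> z v = k"
      using jk by (cases s x rule: linorder_cases) auto
    finally show ?thesis .
  qed
  then have "jump_times j k z \<inter> {u<..v} = {s. u < s \<and> s \<le> v \<and> s = x \<and> z u = j \<and> z v = k}"
    by auto
  also have "\<dots> = (if z u = j \<and> z v = k then {x} else {})"
    using x by auto
  finally show ?thesis .
qed

lemma one_switch_left_state_diff:
  assumes "one_switch z u v x"
  shows "{s\<in>{u<..v}. left_state z s \<noteq> z s} \<subseteq> {x}"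
proof
  fix s assume "s \<in> {s\<in>{u<..v}. left_state z s \<noteq> z s}"
  then have s: "u < s" "s \<le> v" "left_state z s \<noteq> z s" by auto
  then have "(if s \<le> x then z u else z v) \<noteq> (if s < x then z u else z v)"
    using one_switch_left_state[OF assms s(1,2)] one_switchD[OF assms _ s(2)] by simp
  then show "s \<in> {x}" by (cases s x rule: linorder_cases) auto
qed

lemma uniform_cells:
  fixes T :: real
  assumes "0 \<le> T"
  shows "{0<..T} = (\<Union>p<Suc n. {real p * T / real (Suc n)<..real (Suc p) * T / real (Suc n)})"
proof -
  have "(\<Union>p<m. {real p * T / real (Suc n)<..real (Suc p) * T / real (Suc n)})
         = {0<..real m * T / real (Suc n)}" for m
  proof (induction m)
    case (Suc m)
    have "0 \<le> real m * T / real (Suc n)" using assms by simp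
    moreover have "real m * T / real (Suc n) \<le> real (Suc m) * T / real (Suc n)"
      using assms by (intro divide_right_mono mult_right_mono) auto
    ultimately show ?case
      by (subst lessThan_Suc) (simp only: UN_insert Suc.IH, auto)
  qed simp
  from this[of "Suc n"] show ?thesis by (simp del: of_nat_Suc)
qed

lemma uniform_cells_disjoint:
  fixes T :: real
  assumes "0 \<le> T"
  shows "disjoint_family_on (\<lambda>p. {real p * T / real n<..real (Suc p) * T / real n}) A"
proof -
  have *: "real (Suc p) * T / real n \<le> real q * T / real n" if "p < q" for p q
  proof -
    have "real (Suc p) \<le> real q" using that by linarith
    then show ?thesis using assms by (intro divide_right_mono mult_right_mono) auto
  qed
  show ?thesis unfolding disjoint_family_on_def
  proof (intro ballI impI)
    fix p q :: nat assume "p \<noteq> q"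
    then consider "p < q" | "q < p" by linarith
    then show "{real p * T / real n<..real (Suc p) * T / real n} \<inter>
               {real q * T / real n<..real (Suc q) * T / real n} = {}"
      by cases (use *[of p q] *[of q p] in auto)
  qed
qed

lemma eventually_one_switch_cells:
  assumes z: "jump_path z" and ab: "0 \<le> a" "a \<le> b"
  shows "\<forall>\<^sub>F n in sequentially. \<forall>p<n. \<exists>x.
           one_switch z (a + real p * (b - a) / real n) (a + real (Suc p) * (b - a) / real n) x"
proof -
  from jump_path_one_switch[OF z, of b] obtain d where d: "d > 0"
    "\<And>u v. 0 \<le> u \<Longrightarrow> u \<le> v \<Longrightarrow> v \<le> b \<Longrightarrow> v - u < d \<Longrightarrow> \<exists>x. one_switch z u v x" by metis
  have "(\<lambda>n. (b - a) / real n) \<longlonglongrightarrow> 0" by (rule lim_const_over_n)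
  then have "\<forall>\<^sub>F n in sequentially. (b - a) / real n < d" using d(1) by (rule order_tendstoD)
  with eventually_gt_at_top[of 0] show ?thesis
  proof eventually_elim
    case (elim n)
    show ?case
    proof (intro allI impI d(2))
      fix p assume p: "p < n"
      show "0 \<le> a + real p * (b - a) / real n" using ab by simp
      show "a + real p * (b - a) / real n \<le> a + real (Suc p) * (b - a) / real n"
        using ab by (intro add_left_mono divide_right_mono mult_right_mono) auto
      have "real (Suc p) * (b - a) / real n \<le> real n * (b - a) / real n"
        using ab p by (intro divide_right_mono mult_right_mono) auto
      then show "a + real (Suc p) * (b - a) / real n \<le> b" using p by simp
      show "a + real (Suc p) * (b - a) / real n - (a + real p * (b - a) / real n) < d"
        using elim(2) by (simp add: distrib_right add_divide_distrib diff_divide_distrib)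
    qed
  qed
qed

text \<open>
  A bounded interval splits into finitely many cells with one switch each.
\<close>

lemma jump_path_finite:
  assumes z: "jump_path z" and jk: "j \<noteq> k"
  shows "finite (jump_times j k z \<inter> {..T})"
    and "finite {s\<in>{0<..T}. left_state z s \<noteq> z s}"
proof -
  have "finite (jump_times j k z \<inter> {0<..T}) \<and> finite {s\<in>{0<..T}. left_state z s \<noteq> z s}" if T: "0 \<le> T"
  proof -
    from eventually_one_switch_cells[OF z order_refl T, unfolded eventually_sequentially add_0 diff_0_right]
    obtain n where n: "\<forall>m\<ge>n. \<forall>p<m. \<exists>x. one_switch z (real p * T / real m) (real (Suc p) * T / real m) x"
      by (rule exE)
    define u where "u p = real p * T / real (Suc n)" for p
    from n[THEN spec, of "Suc n"] have "\<forall>p<Suc n. \<exists>x. one_switch z (u p) (u (Suc p)) x"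
      unfolding u_def by (rule mp) simp
    then obtain x where x: "\<And>p. p < Suc n \<Longrightarrow> one_switch z (u p) (u (Suc p)) (x p)"
      by metis
    have mono: "u p \<le> u (Suc p)" and u0: "0 \<le> u p" for p
      unfolding u_def using T by (auto intro!: divide_right_mono mult_right_mono)
    have cells: "\<exists>p<Suc n. s \<in> {u p<..u (Suc p)}" if "s \<in> {0<..T}" for s
      using that uniform_cells[OF T, of n, folded u_def] by blast
    have "s \<in> x ` {..<Suc n}" if s: "s \<in> jump_times j k z" "s \<in> {0<..T}" for s
    proof -
      obtain p where p: "p < Suc n" "s \<in> {u p<..u (Suc p)}" using cells s by blast
      then have "s \<in> jump_times j k z \<inter> {u p<..u (Suc p)}" using s by blast
      then have "s = x p" using one_switch_jump_times[OF x[OF p(1)] u0 mono jk] by (metis empty_iff singletonD)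
      with p show ?thesis by blast
    qed
    moreover have "s \<in> x ` {..<Suc n}" if s: "left_state z s \<noteq> z s" "s \<in> {0<..T}" for s
    proof -
      obtain p where p: "p < Suc n" "s \<in> {u p<..u (Suc p)}" using cells s by blast
      then have "s = x p" using one_switch_left_state_diff[OF x[OF p(1)]] s by blast
      with p show ?thesis by blast
    qed
    ultimately have "jump_times j k z \<inter> {0<..T} \<subseteq> x ` {..<Suc n}"
      "{s\<in>{0<..T}. left_state z s \<noteq> z s} \<subseteq> x ` {..<Suc n}"
      by blast+
    then show ?thesis by (meson finite_imageI finite_lessThan finite_subset)
  qed
  moreover have "jump_times j k z \<inter> {..T} = jump_times j k z \<inter> {0<..T}" by (auto simp: jump_times_def)
  moreover have "{0<..T} = {}" if "\<not> 0 \<le> T" using that by auto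
  ultimately show "finite (jump_times j k z \<inter> {..T})" "finite {s\<in>{0<..T}. left_state z s \<noteq> z s}"
    by (cases "0 \<le> T"; simp)+
qed

text \<open>
  Censoring is tested at the left end point of a cell, so that a jump at the censoring time itself
  is counted.
\<close>

definition grid_count :: "'z \<Rightarrow> 'z \<Rightarrow> real \<Rightarrow> nat \<Rightarrow> (real \<Rightarrow> 'z) \<times> real \<Rightarrow> real" where
  "grid_count j k T n = (\<lambda>(z, r). \<Sum>p<n. of_bool (z (real p * T / real n) = j \<and>
      z (real (Suc p) * T / real n) = k \<and> real p * T / real n < r))"

text \<open>
  The test at left end points could let through a jump that follows the censoring time within the same
  cell; right-continuity excludes this on fine grids.
\<close>

lemma no_jump_right:
  assumes z: "jump_path z" and r: "0 \<le> r" and jk: "j \<noteq> k"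
  shows "\<exists>e>0. \<forall>s. r < s \<and> s < r + e \<longrightarrow> s \<notin> jump_times j k z"
proof -
  have "\<forall>\<^sub>F u in at_right r. z u = z r" using z r by (auto simp: jump_path_def)
  then obtain b where b: "b > r" "\<And>u. r < u \<Longrightarrow> u < b \<Longrightarrow> z u = z r"
    unfolding eventually_at_right_field by blast
  show ?thesis
  proof (intro exI[of _ "b - r"] conjI allI impI notI)
    show "0 < b - r" using b by simp
    fix s assume s: "r < s \<and> s < r + (b - r)" "s \<in> jump_times j k z"
    have "left_state z s = z r" using s b by (intro left_state_eqI[of r]) auto
    moreover have "z s = z r" using s b by auto
    ultimately show False using s jk by (auto simp: jump_times_def)
  qed
qed

lemma grid_count_eventually:
  assumes z: "jump_path z" and T: "0 \<le> T" and jk: "j \<noteq> k"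
  shows "\<forall>\<^sub>F n in sequentially. grid_count j k T n (z, r) = real (card (jump_times j k z \<inter> {0<..T} \<inter> {..r}))"
proof (cases "0 \<le> r")
  case False
  then have "{0<..T} \<inter> {..r} = {}" by auto
  then have "jump_times j k z \<inter> {0<..T} \<inter> {..r} = {}" by auto
  moreover have "\<not> real p * T / real n < r" for p n
  proof -
    have "0 \<le> real p * T / real n" using T by simp
    then show ?thesis using False by linarith
  qed
  ultimately show ?thesis by (simp only: grid_count_def) simp
next
  case True
  from no_jump_right[OF z True jk] obtain e where e: "e > 0"
    "\<And>s. r < s \<Longrightarrow> s < r + e \<Longrightarrow> s \<notin> jump_times j k z" by blast
  have "(\<lambda>n. T / real n) \<longlonglongrightarrow> 0" by (rule lim_const_over_n)
  then have "\<forall>\<^sub>F n in sequentially. T / real n < e" using e(1) by (rule order_tendstoD)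
  with eventually_one_switch_cells[OF z order_refl T, unfolded add_0 diff_0_right] eventually_gt_at_top[of 0] show ?thesis
  proof eventually_elim
    case (elim n)
    define u where "u p = real p * T / real n" for p
    from elim obtain x where x: "\<And>p. p < n \<Longrightarrow> one_switch z (u p) (u (Suc p)) (x p)"
      unfolding u_def by metis
    have mono: "u p \<le> u (Suc p)" and u0: "0 \<le> u p" for p
      using T unfolding u_def by (auto intro!: divide_right_mono mult_right_mono)
    have step: "u (Suc p) = u p + T / real n" for p using elim by (simp add: u_def field_simps)
    have cells: "{0<..T} = (\<Union>p<n. {u p<..u (Suc p)})"
      using uniform_cells[OF T, of "n - 1"] elim by (simp add: u_def)
    let ?J = "\<lambda>p. jump_times j k z \<inter> {u p<..u (Suc p)} \<inter> {..r}"
    have J: "?J p = (if z (u p) = j \<and> z (u (Suc p)) = k \<and> u p < r then {x p} else {})" if p: "p < n" for p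
    proof (cases "z (u p) = j \<and> z (u (Suc p)) = k")
      case True
      then have xp: "jump_times j k z \<inter> {u p<..u (Suc p)} = {x p}"
        using one_switch_jump_times[OF x[OF p] u0 mono jk] by auto
      then have b: "u p < x p" "x p \<le> u (Suc p)" "x p \<in> jump_times j k z" by auto
      have "u p < r \<longleftrightarrow> x p \<le> r"
      proof
        assume "u p < r"
        then have "x p < r + e" using b step[of p] elim by linarith
        then show "x p \<le> r" using e(2)[of "x p"] b by (meson leI)
      qed (use b in linarith)
      then show ?thesis using xp True by auto
    next
      case False
      then show ?thesis using one_switch_jump_times[OF x[OF p] u0 mono jk] by auto
    qed
    have "jump_times j k z \<inter> {0<..T} \<inter> {..r} = (\<Union>p<n. ?J p)" unfolding cells by auto
    also have "card \<dots> = (\<Sum>p<n. card (?J p))"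
    proof (rule card_UN_disjoint')
      show "disjoint_family_on ?J {..<n}"
        using uniform_cells_disjoint[OF T, of n "{..<n}"] unfolding u_def disjoint_family_on_def by blast
      show "finite (?J p)" if "p \<in> {..<n}" for p
        using J[of p] that by (simp split: if_splits)
    qed simp
    also have "real \<dots> = grid_count j k T n (z, r)"
      unfolding grid_count_def u_def[symmetric] of_nat_sum prod.case
      by (intro sum.cong refl) (simp add: J)
    finally show ?case by simp
  qed
qed

text \<open>
  Occurrences are counted on half-open intervals \<open>[a, b)\<close>, grids and counting processes on
  intervals \<open>(0, T]\<close>.  Finitely many jumps before \<open>b\<close> stay away from \<open>b\<close>, which links the two.
\<close>

lemma jumps_before_limit:
  assumes z: "jump_path z" and jk: "j \<noteq> k"
  shows "\<forall>\<^sub>F n in sequentially. jump_times j k z \<inter> {0<..max 0 (b - 1 / real (Suc n))} = jump_times j k z \<inter> {..<b}"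
proof -
  have fin: "finite (jump_times j k z \<inter> {..b})" by (rule jump_path_finite[OF z jk])
  have "\<forall>\<^sub>F n in sequentially. \<forall>s\<in>jump_times j k z \<inter> {..b}. s < b \<longrightarrow> s \<le> b - 1 / real (Suc n)"
  proof (intro eventually_ball_finite ballI fin)
    fix s
    show "\<forall>\<^sub>F n in sequentially. s < b \<longrightarrow> s \<le> b - 1 / real (Suc n)"
    proof (cases "s < b")
      case True
      have "(\<lambda>n. 1 / real (Suc n)) \<longlonglongrightarrow> 0" using LIMSEQ_inverse_real_of_nat by (simp add: inverse_eq_divide)
      then have "\<forall>\<^sub>F n in sequentially. 1 / real (Suc n) < b - s" by (rule order_tendstoD) (use True in simp)
      then show ?thesis by eventually_elim linarith
    qed simp
  qed
  then show ?thesis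
  proof eventually_elim
    case (elim n)
    have "0 < 1 / real (Suc n)" by simp
    then have "x < b" if "0 < x" "x \<le> max 0 (b - 1 / real (Suc n))" for x using that by linarith
    then show ?case using elim by (fastforce simp: jump_times_def)
  qed
qed

section \<open>Exposures as limits of Riemann sums\<close>

text \<open>
  Right end points \<open>v\<close> with the test \<open>v \<le> r\<close> are chosen because the expectation of this sum
  is then a Riemann sum of the censored occupation probability.
\<close>

definition grid_exposure :: "'z \<Rightarrow> real \<Rightarrow> real \<Rightarrow> nat \<Rightarrow> (real \<Rightarrow> 'z) \<times> real \<Rightarrow> real" where
  "grid_exposure j a b n = (\<lambda>(z, r). \<Sum>p<n. (b - a) / real n *
      of_bool (z (a + real (Suc p) * (b - a) / real n) = j \<and> a + real (Suc p) * (b - a) / real n \<le> r))"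

text \<open>
  The right end point of the cell of \<open>s\<close> tends to \<open>s\<close> from strictly above.  There the
  path has the value \<open>z s\<close>, and the test \<open>v \<le> r\<close> turns into \<open>s < r\<close>, so the step
  functions behind the Riemann sums converge everywhere on \<open>[a, b)\<close>.
\<close>

lemma grid_exposure_tendsto:
  fixes z :: "real \<Rightarrow> 'z"
  assumes z: "jump_path z" and ab: "0 \<le> a" "a < b"
  shows "set_integrable lborel {a..b} (\<lambda>s. of_bool (s < r) * of_bool (z s = j) :: real)" (is ?int)
    and "(\<lambda>n. grid_exposure j a b n (z, r)) \<longlonglongrightarrow>
           (LINT s:{a..b}|lborel. of_bool (s < r) * of_bool (z s = j))" (is ?lim)
proof -
  define v where "v n p = a + real p * (b - a) / real n" for n p
  define c where "c n p = (of_bool (z (v n (Suc p)) = j \<and> v n (Suc p) \<le> r) :: real)" for n p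
  define f where "f n s = (\<Sum>p<n. indicator {v n p..<v n (Suc p)} s * c n p)" for n s
  define f' where "f' s = (of_bool (s < r) * of_bool (z s = j) :: real)" for s
  have vmono: "v n p \<le> v n q" if "p \<le> q" for n p q
    unfolding v_def using ab that by (intro add_left_mono divide_right_mono mult_right_mono) auto
  have cell: "f n s = c n p" if "p < n" "s \<in> {v n p..<v n (Suc p)}" for n p s
  proof -
    define g where "g q = indicator {v n q..<v n (Suc q)} s * c n q" for q
    have "g q = 0" if "q \<noteq> p" for q
    proof -
      have "s \<notin> {v n q..<v n (Suc q)}"
        using vmono[of "Suc q" p n] vmono[of "Suc p" q n] that \<open>s \<in> _\<close> by (cases q p rule: linorder_cases) auto
      then show ?thesis by (simp add: g_def)
    qed
    then have "f n s = (\<Sum>q\<in>{p}. g q)"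
      unfolding f_def g_def[symmetric] using that by (intro sum.mono_neutral_right) auto
    then have "f n s = g p" by simp
    then show ?thesis using that by (simp add: g_def)
  qed
  have f0: "f n s = 0" if "s \<notin> {a..<b}" for n s
    unfolding f_def
  proof (intro sum.neutral ballI)
    fix p assume p: "p \<in> {..<n}"
    have "v n 0 = a" "v n n = b" using p by (auto simp: v_def)
    then have "s \<notin> {v n p..<v n (Suc p)}"
      using vmono[of 0 p n] vmono[of "Suc p" n n] that p by auto
    then show "indicator {v n p..<v n (Suc p)} s * c n p = 0" by simp
  qed
  have ex: "\<exists>p<n. s \<in> {v n p..<v n (Suc p)}" if s: "s \<in> {a..<b}" and n: "n > 0" for n s
  proof -
    define y where "y = (s - a) * real n / (b - a)"
    define p where "p = nat \<lfloor>y\<rfloor>"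
    have y: "0 \<le> y" "y < real n" using s n ab by (auto simp: y_def field_simps)
    then have p: "real p \<le> y" "y < real (Suc p)" unfolding p_def by linarith+
    then have "p < n" using y by linarith
    moreover have "s = a + y * (b - a) / real n" using n ab by (simp add: y_def)
    moreover have "real p * (b - a) / real n \<le> y * (b - a) / real n"
      using p ab by (intro divide_right_mono mult_right_mono) auto
    moreover have "y * (b - a) / real n < real (Suc p) * (b - a) / real n"
      using p ab n by (intro divide_strict_right_mono mult_strict_right_mono) auto
    ultimately show ?thesis unfolding v_def by auto
  qed
  have lim: "(\<lambda>n. f n s) \<longlonglongrightarrow> indicator {a..<b} s * f' s" for s
  proof (cases "s \<in> {a..<b}")
    case False
    then show ?thesis by (simp add: f0)
  next
    case True
    have "\<forall>\<^sub>F u in at_right s. z u = z s" using z True ab by (auto simp: jump_path_def)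
    then obtain e where e: "e > s" "\<And>u. s < u \<Longrightarrow> u < e \<Longrightarrow> z u = z s"
      unfolding eventually_at_right_field by blast
    define d where "d = (if s < r then min (e - s) (r - s) else e - s)"
    have d: "d > 0" using e by (auto simp: d_def)
    have "(\<lambda>n. (b - a) / real n) \<longlonglongrightarrow> 0" by (rule lim_const_over_n)
    then have "\<forall>\<^sub>F n in sequentially. (b - a) / real n < d" using d by (rule order_tendstoD)
    with eventually_gt_at_top[of 0] have "\<forall>\<^sub>F n in sequentially. f n s = f' s"
    proof eventually_elim
      case (elim n)
      then obtain p where p: "p < n" "s \<in> {v n p..<v n (Suc p)}" using ex[OF True] by auto
      have "v n (Suc p) = v n p + (b - a) / real n" by (simp add: v_def distrib_right add_divide_distrib)
      with p elim have w: "s < v n (Suc p)" "v n (Suc p) < s + d" by auto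
      then have "z (v n (Suc p)) = z s" using e by (auto simp: d_def split: if_splits)
      moreover have "v n (Suc p) \<le> r \<longleftrightarrow> s < r" using w by (auto simp: d_def split: if_splits)
      ultimately show ?case using cell[OF p] by (auto simp: c_def f'_def)
    qed
    then show ?thesis using True by (simp add: tendsto_eventually)
  qed
  have fm[measurable]: "f n \<in> borel_measurable lborel" for n unfolding f_def by measurable
  have m: "(\<lambda>s. indicator {a..<b} s * f' s) \<in> borel_measurable lborel"
    by (rule borel_measurable_LIMSEQ_real[OF lim]) simp
  have bd: "norm (f n s) \<le> indicator {a..b} s" for n s
  proof (cases "s \<in> {a..<b} \<and> n > 0")
    case True
    with ex obtain p where "p < n" "s \<in> {v n p..<v n (Suc p)}" by blast
    with True show ?thesis by (simp add: cell) (simp add: c_def)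
  next
    case False
    then have "f n s = 0" using f0[of s n] by (cases "n = 0") (auto simp: f_def)
    then show ?thesis by simp
  qed
  have ii: "integrable lborel (indicator {a..b} :: real \<Rightarrow> real)"
    by (rule integrable_real_indicator) (auto simp: emeasure_lborel_Icc_eq)
  have aelim: "AE s in lborel. (\<lambda>n. f n s) \<longlonglongrightarrow> indicator {a..<b} s * f' s"
    using lim by simp
  have aebd: "AE s in lborel. norm (f n s) \<le> indicator {a..b} s" for n
    using bd by simp
  have D: "integrable lborel (\<lambda>s. indicator {a..<b} s * f' s)"
    by (rule integrable_dominated_convergence[OF m fm ii aelim aebd])
  have D2: "(\<lambda>n. LINT s|lborel. f n s) \<longlonglongrightarrow> (LINT s|lborel. indicator {a..<b} s * f' s)"
    by (rule integral_dominated_convergence[OF m fm ii aelim aebd])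
  have ae: "AE s in lborel. indicator {a..<b} s * f' s = indicator {a..b} s * f' s"
    using AE_lborel_singleton[of b] by eventually_elim (auto simp: indicator_def)
  have m2: "(\<lambda>s. indicator {a..b} s * f' s) \<in> borel_measurable lborel"
  proof -
    have "(\<lambda>s. indicator {a..b} s * f' s) = (\<lambda>s. indicator {a..<b} s * f' s + indicator {b} s * f' b)"
      using ab by (auto simp: indicator_def fun_eq_iff)
    then show ?thesis using m by simp
  qed
  show ?int unfolding set_integrable_def
    using integrable_cong_AE[OF m m2 ae] D by (simp add: f'_def[symmetric])
  have "(LINT s|lborel. f n s) = grid_exposure j a b n (z, r)" for n
  proof -
    have i: "integrable lborel (indicator {x..<y} :: real \<Rightarrow> real)" for x y
    proof (rule integrable_real_indicator)
      have "bounded {x..<y}" by (rule bounded_subset[OF bounded_closed_interval[of x y]]) auto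
      then show "emeasure lborel {x..<y} < \<infinity>" by (rule emeasure_bounded_finite)
    qed simp
    have "(LINT s|lborel. f n s) = (\<Sum>p<n. LINT s|lborel. indicator {v n p..<v n (Suc p)} s * c n p)"
      unfolding f_def using i by (subst Bochner_Integration.integral_sum) auto
    also have "\<dots> = (\<Sum>p<n. (b - a) / real n * c n p)"
    proof (intro sum.cong refl)
      fix p
      have "v n (Suc p) - v n p = (b - a) / real n" by (simp add: v_def distrib_right add_divide_distrib)
      then show "(LINT s|lborel. indicator {v n p..<v n (Suc p)} s * c n p) = (b - a) / real n * c n p"
        using vmono[of p "Suc p" n] by simp
    qed
    finally show ?thesis unfolding grid_exposure_def c_def v_def by simp
  qed
  moreover have "(LINT s|lborel. indicator {a..<b} s * f' s) = (LINT s:{a..b}|lborel. f' s)"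
    unfolding set_lebesgue_integral_def using integral_cong_AE[OF m m2 ae] by simp
  ultimately show ?lim using D2 by (simp add: f'_def)
qed

lemma jump_path_borel:
  assumes z: "jump_path z"
  shows "{s \<in> {0..}. z s = j} \<in> sets borel"
proof -
  have "{s \<in> {0..<real (Suc n)}. z s = j} \<in> sets borel" for n
  proof -
    have "(\<lambda>s. indicator {0..real (Suc n)} s * (of_bool (s < real (Suc n)) * of_bool (z s = j)) :: real) \<in> borel_measurable borel"
      using borel_measurable_integrable[OF grid_exposure_tendsto(1)[OF z, of 0 "real (Suc n)" "real (Suc n)" j, unfolded set_integrable_def]]
      by simp
    from measurable_sets[OF this, of "{1}"] have
      "(\<lambda>s. indicator {0..real (Suc n)} s * (of_bool (s < real (Suc n)) * of_bool (z s = j)) :: real) -` {1} \<in> sets borel"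
      by simp
    also have "(\<lambda>s. indicator {0..real (Suc n)} s * (of_bool (s < real (Suc n)) * of_bool (z s = j)) :: real) -` {1}
       = {s \<in> {0..<real (Suc n)}. z s = j}"
      by (auto simp: indicator_def of_bool_def split: if_splits)
    finally show ?thesis .
  qed
  then have "(\<Union>n. {s \<in> {0..<real (Suc n)}. z s = j}) \<in> sets borel" by blast
  also have "(\<Union>n. {s \<in> {0..<real (Suc n)}. z s = j}) = {s \<in> {0..}. z s = j}"
  proof -
    have "\<exists>n. s < real (Suc n)" for s
      using reals_Archimedean2[of s] by (metis less_trans of_nat_less_iff lessI)
    then show ?thesis by auto
  qed
  finally show ?thesis .
qed

section \<open>Measurable functionals of a path and a censoring time\<close>

text \<open>
  On an uncountable product the functions \<open>jump_count\<close> and \<open>exposure\<close> need not be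
  measurable.  The following functionals are limits of functions of finitely many coordinates,
  hence measurable, and have the right values on paths with finitely many jumps.  They carry the
  independence and the common law of the data over to occurrences and exposures.
\<close>

definition count_functional :: "'z \<Rightarrow> 'z \<Rightarrow> real \<Rightarrow> (real \<Rightarrow> 'z) \<times> real \<Rightarrow> real" where
  "count_functional j k T w = lim (\<lambda>n. grid_count j k T n w)"

definition occ_functional :: "'z \<Rightarrow> 'z \<Rightarrow> real \<Rightarrow> real \<Rightarrow> (real \<Rightarrow> 'z) \<times> real \<Rightarrow> real" where
  "occ_functional j k a b w = lim (\<lambda>n. count_functional j k (max 0 (b - 1 / real (Suc n))) w
                              - count_functional j k (max 0 (a - 1 / real (Suc n))) w)"

definition exposure_functional :: "'z \<Rightarrow> real \<Rightarrow> real \<Rightarrow> (real \<Rightarrow> 'z) \<times> real \<Rightarrow> real" where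
  "exposure_functional j a b w = lim (\<lambda>n. grid_exposure j a b n w)"

lemma measurable_path_eval:
  assumes "0 \<le> s"
  shows "(\<lambda>w. fst w s) \<in> measurable (path_space \<Otimes>\<^sub>M borel) (count_space UNIV)"
  unfolding path_space_def
  using measurable_compose[OF measurable_fst measurable_component_singleton] assms by auto

lemma grid_count_measurable:
  assumes "0 \<le> T"
  shows "grid_count j k T n \<in> borel_measurable (path_space \<Otimes>\<^sub>M borel)"
  unfolding grid_count_def case_prod_beta
proof (intro borel_measurable_sum)
  fix p
  have [measurable]: "(\<lambda>w :: (real \<Rightarrow> 'a) \<times> real. fst w (real p * T / real n)) \<in> measurable (path_space \<Otimes>\<^sub>M borel) (count_space UNIV)"
    "(\<lambda>w :: (real \<Rightarrow> 'a) \<times> real. fst w (real (Suc p) * T / real n)) \<in> measurable (path_space \<Otimes>\<^sub>M borel) (count_space UNIV)"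
    using assms by (intro measurable_path_eval; simp)+
  show "(\<lambda>w :: (real \<Rightarrow> 'a) \<times> real. of_bool (fst w (real p * T / real n) = j \<and> fst w (real (Suc p) * T / real n) = k
          \<and> real p * T / real n < snd w) :: real) \<in> borel_measurable (path_space \<Otimes>\<^sub>M borel)"
    by measurable
qed

lemma grid_exposure_measurable:
  assumes "0 \<le> a" "a \<le> b"
  shows "grid_exposure j a b n \<in> borel_measurable (path_space \<Otimes>\<^sub>M borel)"
  unfolding grid_exposure_def case_prod_beta
proof (intro borel_measurable_sum)
  fix p
  have [measurable]: "(\<lambda>w :: (real \<Rightarrow> 'a) \<times> real. fst w (a + real (Suc p) * (b - a) / real n)) \<in> measurable (path_space \<Otimes>\<^sub>M borel) (count_space UNIV)"
    using assms by (intro measurable_path_eval) simp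
  show "(\<lambda>w :: (real \<Rightarrow> 'a) \<times> real. (b - a) / real n * of_bool (fst w (a + real (Suc p) * (b - a) / real n) = j \<and>
          a + real (Suc p) * (b - a) / real n \<le> snd w) :: real) \<in> borel_measurable (path_space \<Otimes>\<^sub>M borel)"
    by measurable
qed

lemma count_functional_measurable [measurable]:
  "0 \<le> T \<Longrightarrow> count_functional j k T \<in> borel_measurable (path_space \<Otimes>\<^sub>M borel)"
  unfolding count_functional_def by (intro borel_measurable_lim_metric grid_count_measurable)

lemma occ_functional_measurable [measurable]:
  "occ_functional j k a b \<in> borel_measurable (path_space \<Otimes>\<^sub>M borel)"
  unfolding occ_functional_def
  by (intro borel_measurable_lim_metric borel_measurable_diff count_functional_measurable) auto

lemma exposure_functional_measurable [measurable]:
  "0 \<le> a \<Longrightarrow> a \<le> b \<Longrightarrow> exposure_functional j a b \<in> borel_measurable (path_space \<Otimes>\<^sub>M borel)"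
  unfolding exposure_functional_def by (intro borel_measurable_lim_metric grid_exposure_measurable)

lemma grid_count_path_of:
  assumes "0 \<le> T"
  shows "grid_count j k T n (path_of Z \<omega>, r) = grid_count j k T n (\<lambda>s. Z s \<omega>, r)"
  using assms by (simp add: grid_count_def path_of_def)

lemma grid_exposure_path_of:
  assumes "0 \<le> a" "a \<le> b"
  shows "grid_exposure j a b n (path_of Z \<omega>, r) = grid_exposure j a b n (\<lambda>s. Z s \<omega>, r)"
  using assms by (simp add: grid_exposure_def path_of_def)

lemma count_functional_path_of:
  assumes "jump_path (\<lambda>s. Z s \<omega>)" "0 \<le> T" "j \<noteq> k"
  shows "count_functional j k T (path_of Z \<omega>, r) = real (card (jump_times j k (\<lambda>s. Z s \<omega>) \<inter> {0<..T} \<inter> {..r}))"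
  unfolding count_functional_def
  using grid_count_eventually[OF assms, of r]
  by (intro limI tendsto_eventually) (simp add: grid_count_path_of[OF assms(2)])

text \<open>
  The limits in the definition are attained: for large \<open>n\<close> both counts are the counts of
  jumps strictly before \<open>b\<close> and strictly before \<open>a\<close>.
\<close>

lemma occ_functional_path_of:
  assumes z: "jump_path (\<lambda>s. Z s \<omega>)" and ab: "0 \<le> a" "a \<le> b" and jk: "j \<noteq> k"
  shows "occ_functional j k a b (path_of Z \<omega>, r) = real (card (jump_times j k (\<lambda>s. Z s \<omega>) \<inter> {a..<b} \<inter> {..r}))"
  unfolding occ_functional_def
proof (intro limI tendsto_eventually)
  let ?J = "jump_times j k (\<lambda>s. Z s \<omega>)"
  show "\<forall>\<^sub>F n in sequentially. count_functional j k (max 0 (b - 1 / real (Suc n))) (path_of Z \<omega>, r)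
      - count_functional j k (max 0 (a - 1 / real (Suc n))) (path_of Z \<omega>, r) = real (card (?J \<inter> {a..<b} \<inter> {..r}))"
    using jumps_before_limit[OF z jk, of a] jumps_before_limit[OF z jk, of b]
  proof eventually_elim
    case (elim n)
    have "finite (?J \<inter> {..b})" by (rule jump_path_finite[OF z jk])
    then have fin: "finite (?J \<inter> {..<b} \<inter> {..r})" by (rule finite_subset[rotated]) auto
    have "?J \<inter> {a..<b} \<inter> {..r} = (?J \<inter> {..<b} \<inter> {..r}) - (?J \<inter> {..<a} \<inter> {..r})"
      using ab by auto
    also have "card \<dots> = card (?J \<inter> {..<b} \<inter> {..r}) - card (?J \<inter> {..<a} \<inter> {..r})"
      using ab by (intro card_Diff_subset finite_subset[OF _ fin]) auto
    moreover have "card (?J \<inter> {..<a} \<inter> {..r}) \<le> card (?J \<inter> {..<b} \<inter> {..r})"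
      using ab by (intro card_mono fin) auto
    ultimately have "real (card (?J \<inter> {a..<b} \<inter> {..r})) = real (card (?J \<inter> {..<b} \<inter> {..r})) - real (card (?J \<inter> {..<a} \<inter> {..r}))"
      by (simp add: of_nat_diff)
    then show ?case
      by (simp add: count_functional_path_of[where Z = Z and \<omega> = \<omega>, OF z _ jk] elim del: of_nat_Suc)
  qed
qed

lemma exposure_functional_path_of:
  assumes "jump_path (\<lambda>s. Z s \<omega>)" "0 \<le> a" "a < b"
  shows "exposure_functional j a b (path_of Z \<omega>, r) = (LINT s:{a..b}|lborel. of_bool (s < r) * of_bool (Z s \<omega> = j))"
  unfolding exposure_functional_def
  using grid_exposure_tendsto(2)[OF assms, of j r] assms
  by (intro limI) (simp add: grid_exposure_path_of)

section \<open>Jump counts with a locally bounded intensity\<close>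

lemma set_integral_bounded_by:
  fixes h :: "real \<Rightarrow> real"
  assumes uv: "u \<le> v" and h: "set_integrable lborel {u..v} h"
    and b: "\<And>s. s \<in> {u..v} \<Longrightarrow> \<bar>h s\<bar> \<le> D"
  shows "\<bar>LINT s:{u..v}|lborel. h s\<bar> \<le> D * (v - u)"
proof -
  have i: "integrable lborel (indicator {u..v} :: real \<Rightarrow> real)"
    by (rule integrable_real_indicator) (auto simp: emeasure_lborel_Icc_eq)
  have "\<bar>LINT s:{u..v}|lborel. h s\<bar> \<le> (LINT s|lborel. \<bar>indicator {u..v} s *\<^sub>R h s\<bar>)"
    unfolding set_lebesgue_integral_def using integral_norm_bound[of lborel "\<lambda>s. indicator {u..v} s *\<^sub>R h s"] by simp
  also have "\<dots> \<le> (LINT s|lborel. indicator {u..v} s * D)"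
  proof (rule integral_mono)
    show "integrable lborel (\<lambda>s. \<bar>indicator {u..v} s *\<^sub>R h s\<bar>)"
      using h unfolding set_integrable_def by (rule integrable_abs)
    show "integrable lborel (\<lambda>s. indicator {u..v} s * D)" using i by simp
  qed (use b in \<open>auto simp: indicator_def\<close>)
  also have "\<dots> = D * (v - u)" using uv by simp
  finally show ?thesis .
qed

definition compensator :: "'z \<Rightarrow> (real \<Rightarrow> real) \<Rightarrow> (real \<Rightarrow> 'w \<Rightarrow> 'z) \<Rightarrow> real \<Rightarrow> 'w \<Rightarrow> real" where
  "compensator j \<nu> Z r \<omega> = (LINT s:{0..r}|lborel. of_bool (left_state (\<lambda>u. Z u \<omega>) s = j) * \<nu> s)"

text \<open>
  One transition of a jump process, with its compensated count as a martingale.  The bound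
  \<open>C\<close> for the intensity near \<open>t\<close> controls the moments of the count over short intervals.
\<close>

locale local_intensity = prob_space M for M :: "'w measure" +
  fixes Z :: "real \<Rightarrow> 'w \<Rightarrow> 'z" and \<nu> :: "real \<Rightarrow> real" and j k :: 'z and t e C :: real
  assumes Z_measurable: "\<And>s. 0 \<le> s \<Longrightarrow> Z s \<in> measurable M (count_space UNIV)"
    and Z_path: "\<And>\<omega>. \<omega> \<in> space M \<Longrightarrow> jump_path (\<lambda>s. Z s \<omega>)"
    and jk: "j \<noteq> k"
    and \<nu>_measurable: "\<nu> \<in> borel_measurable (restrict_space borel {0..})"
    and \<nu>_nonneg: "\<And>s. 0 \<le> s \<Longrightarrow> 0 \<le> \<nu> s"
    and \<nu>_bound: "\<And>s. 0 \<le> s \<Longrightarrow> \<bar>s - t\<bar> < e \<Longrightarrow> \<nu> s \<le> C"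
    and compensator_integrable: "\<And>r. 0 \<le> r \<Longrightarrow> AE \<omega> in M. set_integrable lborel {0..r}
            (\<lambda>s. of_bool (left_state (\<lambda>u. Z u \<omega>) s = j) * \<nu> s)"
    and mart: "martingale M (completed_natural_filtration M Z)
       (\<lambda>r \<omega>. real (jump_count j k (\<lambda>u. Z u \<omega>) r) - compensator j \<nu> Z r \<omega>)"
    and mart_mean: "\<And>r. 0 \<le> r \<Longrightarrow>
       expectation (\<lambda>\<omega>. real (jump_count j k (\<lambda>u. Z u \<omega>) r) - compensator j \<nu> Z r \<omega>) = 0"
    and square_integrable: "\<And>r. 0 \<le> r \<Longrightarrow> integrable M (\<lambda>\<omega>. (real (jump_count j k (\<lambda>u. Z u \<omega>) r))\<^sup>2)"
begin

abbreviation "F \<equiv> completed_natural_filtration M Z"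
abbreviation "A \<equiv> compensator j \<nu> Z"
definition N :: "real \<Rightarrow> 'w \<Rightarrow> real" where "N r \<omega> = real (jump_count j k (\<lambda>u. Z u \<omega>) r)"

abbreviation near :: "real \<Rightarrow> bool" where "near s \<equiv> 0 \<le> s \<and> \<bar>s - t\<bar> < e"

lemma generators_in_sets:
  "(\<Union>s\<in>{0..r}. {Z s -` A \<inter> space M | A. A \<in> UNIV}) \<union> null_sets M \<subseteq> sets M"
  using measurable_sets[OF Z_measurable] by (auto simp: null_sets_def)

lemma subalgebra_F: "subalgebra M (F r)"
proof -
  let ?G = "(\<Union>s\<in>{0..r}. {Z s -` A \<inter> space M | A. A \<in> UNIV}) \<union> null_sets M"
  have "?G \<subseteq> Pow (space M)" using generators_in_sets sets.sets_into_space by blast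
  then have "space (F r) = space M" "sets (F r) = sigma_sets (space M) ?G"
    unfolding completed_natural_filtration_def by (auto simp: space_measure_of_conv sets_measure_of)
  moreover have "sigma_sets (space M) ?G \<subseteq> sets M"
    by (rule sets.sigma_sets_subset[OF generators_in_sets])
  ultimately show ?thesis unfolding subalgebra_def by simp
qed

lemma Z_measurable_F:
  assumes "0 \<le> s" "s \<le> r"
  shows "Z s \<in> measurable (F r) (count_space UNIV)"
proof (rule measurableI)
  let ?G = "(\<Union>s\<in>{0..r}. {Z s -` A \<inter> space M | A. A \<in> UNIV}) \<union> null_sets M"
  have G: "?G \<subseteq> Pow (space M)" using generators_in_sets sets.sets_into_space by blast
  fix B
  have sp: "space (F r) = space M" using subalgebra_F by (simp add: subalgebra_def)
  have "Z s -` B \<inter> space M \<in> ?G" using assms by fastforce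
  then have "Z s -` B \<inter> space M \<in> sigma_sets (space M) ?G" by (rule sigma_sets.Basic)
  then show "Z s -` B \<inter> space (F r) \<in> sets (F r)"
    using G unfolding sp unfolding completed_natural_filtration_def by (simp add: sets_measure_of)
qed simp

lemma N_measurable_F:
  assumes "0 \<le> u" "u \<le> r"
  shows "N u \<in> borel_measurable (F r)"
proof (rule borel_measurable_LIMSEQ_real)
  have sp: "space (F r) = space M" using subalgebra_F by (simp add: subalgebra_def)
  show "(\<lambda>n. grid_count j k u n (\<lambda>s. Z s \<omega>, u + 1)) \<longlonglongrightarrow> N u \<omega>" if "\<omega> \<in> space (F r)" for \<omega>
  proof -
    have "{0<..u} \<inter> {..u + 1} = {0<..u}" by auto
    then have "jump_times j k (\<lambda>s. Z s \<omega>) \<inter> {0<..u} \<inter> {..u + 1} = jump_times j k (\<lambda>s. Z s \<omega>) \<inter> {0<..u}" by blast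
    then show ?thesis
      using grid_count_eventually[OF Z_path[of \<omega>] assms(1) jk, of "u + 1"] that sp
      unfolding N_def jump_count_def by (intro tendsto_eventually) simp
  qed
  fix n
  show "(\<lambda>\<omega>. grid_count j k u n (\<lambda>s. Z s \<omega>, u + 1)) \<in> borel_measurable (F r)"
    unfolding grid_count_def prod.case
  proof (intro borel_measurable_sum)
    fix p assume p: "p \<in> {..<n}"
    have "real (Suc p) * u / real n \<le> u"
    proof -
      have "real (Suc p) * u \<le> real n * u" using p assms by (intro mult_right_mono) auto
      then show ?thesis using p by (simp add: field_simps)
    qed
    moreover have "real p * u / real n \<le> real (Suc p) * u / real n"
      using assms by (intro divide_right_mono mult_right_mono) auto
    ultimately have [measurable]: "Z (real p * u / real n) \<in> measurable (F r) (count_space UNIV)"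
      "Z (real (Suc p) * u / real n) \<in> measurable (F r) (count_space UNIV)"
      using assms by (intro Z_measurable_F; simp)+
    show "(\<lambda>\<omega>. of_bool (Z (real p * u / real n) \<omega> = j \<and> Z (real (Suc p) * u / real n) \<omega> = k
        \<and> real p * u / real n < u + 1)) \<in> borel_measurable (F r)"
      by measurable
  qed
qed

lemma N_measurable [measurable]: "0 \<le> r \<Longrightarrow> N r \<in> borel_measurable M"
  using measurable_from_subalg[OF subalgebra_F N_measurable_F] by blast

lemma N_square_integrable: "0 \<le> r \<Longrightarrow> integrable M (\<lambda>\<omega>. (N r \<omega>)\<^sup>2)"
  using square_integrable unfolding N_def .

lemma N_integrable: "0 \<le> r \<Longrightarrow> integrable M (N r)"
  by (rule square_integrable_imp_integrable[OF N_measurable N_square_integrable])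

lemma N_nonneg: "0 \<le> N r \<omega>" by (simp add: N_def)

lemma N_diff:
  assumes "\<omega> \<in> space M" "u \<le> v"
  shows "N v \<omega> - N u \<omega> = real (card (jump_times j k (\<lambda>s. Z s \<omega>) \<inter> {u<..v}))"
proof -
  let ?J = "jump_times j k (\<lambda>s. Z s \<omega>)"
  have f: "finite (?J \<inter> {..v})" by (rule jump_path_finite[OF Z_path[OF assms(1)] jk])
  have "?J \<inter> {0<..v} = (?J \<inter> {0<..u}) \<union> (?J \<inter> {u<..v})"
    using assms by (auto simp: jump_times_def)
  also have "card \<dots> = card (?J \<inter> {0<..u}) + card (?J \<inter> {u<..v})"
    using assms(2) by (intro card_Un_disjoint finite_subset[OF _ f]) auto
  finally show ?thesis unfolding N_def jump_count_def by simp
qed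

lemma N_mono: "\<omega> \<in> space M \<Longrightarrow> u \<le> v \<Longrightarrow> N u \<omega> \<le> N v \<omega>"
  using N_diff[of \<omega> u v] by linarith

lemma mart_integrable: "0 \<le> r \<Longrightarrow> integrable M (\<lambda>\<omega>. N r \<omega> - A r \<omega>)"
  and mart_measurable: "0 \<le> r \<Longrightarrow> (\<lambda>\<omega>. N r \<omega> - A r \<omega>) \<in> borel_measurable (F r)"
  and mart_cond: "0 \<le> u \<Longrightarrow> u \<le> r \<Longrightarrow>
     AE \<omega> in M. real_cond_exp M (F u) (\<lambda>\<omega>. N r \<omega> - A r \<omega>) \<omega> = N u \<omega> - A u \<omega>"
proof -
  note m = mart[unfolded martingale_def N_def[symmetric]]
  show "0 \<le> r \<Longrightarrow> integrable M (\<lambda>\<omega>. N r \<omega> - A r \<omega>)"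
    using m[THEN conjunct2, THEN conjunct1, THEN spec, of r] by (rule mp)
  show "0 \<le> r \<Longrightarrow> (\<lambda>\<omega>. N r \<omega> - A r \<omega>) \<in> borel_measurable (F r)"
    using m[THEN conjunct1, THEN spec, of r] by (rule mp)
  show "0 \<le> u \<Longrightarrow> u \<le> r \<Longrightarrow> AE \<omega> in M. real_cond_exp M (F u) (\<lambda>\<omega>. N r \<omega> - A r \<omega>) \<omega> = N u \<omega> - A u \<omega>"
    by (rule m[THEN conjunct2, THEN conjunct2, THEN spec, THEN spec, of u r, THEN mp]) (rule conjI)
qed

lemma A_integrable:
  assumes "0 \<le> r"
  shows "integrable M (A r)"
proof -
  have "integrable M (\<lambda>\<omega>. N r \<omega> - (N r \<omega> - A r \<omega>))"
    by (rule Bochner_Integration.integrable_diff[OF N_integrable[OF assms] mart_integrable[OF assms]])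
  moreover have "(\<lambda>\<omega>. N r \<omega> - (N r \<omega> - A r \<omega>)) = A r" by (simp add: fun_eq_iff)
  ultimately show ?thesis by metis
qed

lemma expectation_N:
  assumes "0 \<le> r"
  shows "expectation (N r) = expectation (A r)"
proof -
  have "expectation (\<lambda>\<omega>. N r \<omega> - A r \<omega>) = 0"
    using mart_mean[OF assms] unfolding N_def .
  then show ?thesis
    using Bochner_Integration.integral_diff[OF N_integrable[OF assms] A_integrable[OF assms]] by simp
qed

text \<open>
  Left limits and values of a path differ at finitely many times only, so that the compensator
  may be computed from the values.
\<close>

lemma compensator_diff:
  assumes "0 \<le> u" "u \<le> v"
  shows "AE \<omega> in M. set_integrable lborel {u..v} (\<lambda>s. of_bool (Z s \<omega> = j) * \<nu> s) \<and>
           A v \<omega> - A u \<omega> = (LINT s:{u..v}|lborel. of_bool (Z s \<omega> = j) * \<nu> s)"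
  using compensator_integrable[OF order_trans[OF assms]] AE_space
proof eventually_elim
  case (elim \<omega>)
  let ?f = "\<lambda>s. of_bool (left_state (\<lambda>u. Z u \<omega>) s = j) * \<nu> s"
  let ?g = "\<lambda>s. of_bool (Z s \<omega> = j) * \<nu> s"
  note z = Z_path[OF elim(2)]
  have int: "set_integrable lborel {0..v} ?f" using elim assms by simp
  have i1: "set_integrable lborel {0..u} ?f" "set_integrable lborel {u<..v} ?f"
    using assms by (auto intro!: set_integrable_subset[OF int])
  have "{0..v} = {0..u} \<union> {u<..v}" using assms by auto
  then have "A v \<omega> = A u \<omega> + (LINT s:{u<..v}|lborel. ?f s)"
    unfolding compensator_def using i1 by (simp, intro set_integral_Un) auto
  have gm: "(\<lambda>s. indicator {u..v} s *\<^sub>R ?g s) \<in> borel_measurable lborel"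
  proof -
    have 1: "(\<lambda>s. indicator {0..} s *\<^sub>R \<nu> s) \<in> borel_measurable borel"
      using \<nu>_measurable by (subst (asm) borel_measurable_restrict_space_iff) auto
    have 2: "{s \<in> {0..}. Z s \<omega> = j} \<in> sets borel" using jump_path_borel[OF z] .
    have "(\<lambda>s. indicator {u..v} s * indicator {s \<in> {0..}. Z s \<omega> = j} s * (indicator {0..} s *\<^sub>R \<nu> s)) \<in> borel_measurable borel"
      using 1 2 by (intro borel_measurable_times borel_measurable_indicator) auto
    also have "(\<lambda>s. indicator {u..v} s * indicator {s \<in> {0..}. Z s \<omega> = j} s * (indicator {0..} s *\<^sub>R \<nu> s))
       = (\<lambda>s. indicator {u..v} s *\<^sub>R ?g s)"
      using assms by (auto simp: indicator_def of_bool_def fun_eq_iff)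
    finally show ?thesis by simp
  qed
  have fm: "(\<lambda>s. indicator {u<..v} s *\<^sub>R ?f s) \<in> borel_measurable lborel"
    using i1(2) unfolding set_integrable_def by (rule borel_measurable_integrable)
  have fin: "finite ({s\<in>{0<..v}. left_state (\<lambda>u. Z u \<omega>) s \<noteq> Z s \<omega>} \<union> {u})"
    using jump_path_finite(2)[OF z jk] by simp
  then have "AE s in lborel. s \<notin> {s\<in>{0<..v}. left_state (\<lambda>u. Z u \<omega>) s \<noteq> Z s \<omega>} \<union> {u}"
    by (intro AE_not_in countable_imp_null_set_lborel countable_finite)
  then have ae: "AE s in lborel. indicator {u<..v} s *\<^sub>R ?f s = indicator {u..v} s *\<^sub>R ?g s"
    by eventually_elim (use assms in \<open>auto simp: indicator_def\<close>)
  show ?case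
    using integrable_cong_AE[OF fm gm ae] integral_cong_AE[OF fm gm ae] i1(2) \<open>A v \<omega> = _\<close>
    unfolding set_integrable_def set_lebesgue_integral_def by simp
qed

lemma A_increment_bound:
  assumes uv: "u \<le> v" and near: "near u" "near v"
  shows "AE \<omega> in M. 0 \<le> A v \<omega> - A u \<omega> \<and> A v \<omega> - A u \<omega> \<le> C * (v - u)"
proof -
  have "0 \<le> u" using near by simp
  from compensator_diff[OF this uv] show ?thesis
  proof eventually_elim
    case (elim \<omega>)
    have "0 \<le> (LINT s:{u..v}|lborel. of_bool (Z s \<omega> = j) * \<nu> s)"
      unfolding set_lebesgue_integral_def
      by (intro Bochner_Integration.integral_nonneg) (use near \<nu>_nonneg in \<open>auto simp: indicator_def\<close>)
    moreover have "\<bar>LINT s:{u..v}|lborel. of_bool (Z s \<omega> = j) * \<nu> s\<bar> \<le> C * (v - u)"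
    proof (rule set_integral_bounded_by[OF uv])
      fix s assume "s \<in> {u..v}"
      then have "near s" using near by auto
      then show "\<bar>of_bool (Z s \<omega> = j) * \<nu> s\<bar> \<le> C"
        using \<nu>_bound[of s] \<nu>_nonneg[of s] by auto
    qed (use elim in simp)
    ultimately show ?case using elim by auto
  qed
qed

text \<open>
  The martingale property replaces the increment of the count by that of its compensator, which is at
  most \<open>C (v - u)\<close>.  A weight that is known at time \<open>u\<close> can be pulled through the conditional
  expectation.  Only increments of the compensator are used: these are bounded near \<open>t\<close>, whereas
  the compensator itself may be unbounded.
\<close>

lemma expectation_weighted_increment:
  assumes Y: "Y \<in> borel_measurable (F u)" "\<And>\<omega>. \<omega> \<in> space M \<Longrightarrow> 0 \<le> Y \<omega>" "integrable M (\<lambda>\<omega>. (Y \<omega>)\<^sup>2)"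
    and uv: "u \<le> v" and near: "near u" "near v"
  shows "integrable M (\<lambda>\<omega>. Y \<omega> * (N v \<omega> - N u \<omega>))"
    and "expectation (\<lambda>\<omega>. Y \<omega> * (N v \<omega> - N u \<omega>)) \<le> C * (v - u) * expectation Y"
proof -
  interpret S: finite_measure_subalgebra M "F u" by unfold_locales (rule subalgebra_F)
  have YM [measurable]: "Y \<in> borel_measurable M" by (rule measurable_from_subalg[OF subalgebra_F Y(1)])
  have Yi: "integrable M Y" by (rule square_integrable_imp_integrable[OF YM Y(3)])
  have u0: "0 \<le> u" "0 \<le> v" using near by auto
  have [measurable]: "A u \<in> borel_measurable M" "A v \<in> borel_measurable M"
    using A_integrable[of u] A_integrable[of v] u0 by auto
  have [measurable]: "N u \<in> borel_measurable M" "N v \<in> borel_measurable M" using u0 by auto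
  show iN: "integrable M (\<lambda>\<omega>. Y \<omega> * (N v \<omega> - N u \<omega>))"
  proof (rule Bochner_Integration.integrable_bound)
    show "integrable M (\<lambda>\<omega>. (Y \<omega>)\<^sup>2 + (N v \<omega>)\<^sup>2)"
      using Y(3) N_square_integrable u0 by simp
    show "AE \<omega> in M. norm (Y \<omega> * (N v \<omega> - N u \<omega>)) \<le> norm ((Y \<omega>)\<^sup>2 + (N v \<omega>)\<^sup>2)"
    proof (rule AE_I2)
      fix \<omega> assume w: "\<omega> \<in> space M"
      have "\<bar>N v \<omega> - N u \<omega>\<bar> \<le> N v \<omega>" using N_mono[OF w uv] N_nonneg[of u \<omega>] by simp
      then have "\<bar>Y \<omega> * (N v \<omega> - N u \<omega>)\<bar> \<le> \<bar>Y \<omega>\<bar> * N v \<omega>"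
        by (simp add: abs_mult mult_left_mono)
      also have "\<dots> \<le> (Y \<omega>)\<^sup>2 + (N v \<omega>)\<^sup>2"
      proof -
        have "2 * Y \<omega> * N v \<omega> \<le> (Y \<omega>)\<^sup>2 + (N v \<omega>)\<^sup>2" by (rule sum_squares_bound)
        moreover have "0 \<le> Y \<omega> * N v \<omega>" using Y(2)[OF w] N_nonneg by (rule mult_nonneg_nonneg)
        ultimately have "Y \<omega> * N v \<omega> \<le> (Y \<omega>)\<^sup>2 + (N v \<omega>)\<^sup>2" by linarith
        then show ?thesis using Y(2)[OF w] by simp
      qed
      finally show "norm (Y \<omega> * (N v \<omega> - N u \<omega>)) \<le> norm ((Y \<omega>)\<^sup>2 + (N v \<omega>)\<^sup>2)" by simp
    qed
  qed measurable
  have iA: "integrable M (\<lambda>\<omega>. Y \<omega> * (A v \<omega> - A u \<omega>))"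
  proof (rule Bochner_Integration.integrable_bound)
    show "integrable M (\<lambda>\<omega>. C * (v - u) * Y \<omega>)" using Yi by simp
    show "AE \<omega> in M. norm (Y \<omega> * (A v \<omega> - A u \<omega>)) \<le> norm (C * (v - u) * Y \<omega>)"
      using A_increment_bound[OF uv near]
    proof eventually_elim
      case (elim \<omega>)
      then have "\<bar>A v \<omega> - A u \<omega>\<bar> \<le> \<bar>C * (v - u)\<bar>" by linarith
      then have "\<bar>Y \<omega>\<bar> * \<bar>A v \<omega> - A u \<omega>\<bar> \<le> \<bar>Y \<omega>\<bar> * \<bar>C * (v - u)\<bar>" by (rule mult_left_mono) simp
      then show ?case by (simp add: abs_mult mult_ac)
    qed
  qed measurable
  define X where "X r \<omega> = N r \<omega> - A r \<omega>" for r \<omega>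
  have Xi: "integrable M (X u)" "integrable M (X v)" using mart_integrable u0 unfolding X_def by auto
  have i: "integrable M (\<lambda>\<omega>. Y \<omega> * (X v \<omega> - X u \<omega>))"
  proof -
    have "(\<lambda>\<omega>. Y \<omega> * (X v \<omega> - X u \<omega>)) = (\<lambda>\<omega>. Y \<omega> * (N v \<omega> - N u \<omega>) - Y \<omega> * (A v \<omega> - A u \<omega>))"
      by (simp add: X_def algebra_simps fun_eq_iff)
    then show ?thesis using iN iA by simp
  qed
  have "AE \<omega> in M. real_cond_exp M (F u) (\<lambda>\<omega>. X v \<omega> - X u \<omega>) \<omega> = 0"
    using S.real_cond_exp_diff[OF Xi(2,1)] mart_cond[OF u0(1) uv, folded X_def]
      S.real_cond_exp_F_meas[OF Xi(1) mart_measurable[OF u0(1), folded X_def]]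
    by eventually_elim simp
  then have z: "AE \<omega> in M. Y \<omega> * real_cond_exp M (F u) (\<lambda>\<omega>. X v \<omega> - X u \<omega>) \<omega> = 0"
    by eventually_elim simp
  have "expectation (\<lambda>\<omega>. Y \<omega> * (X v \<omega> - X u \<omega>)) =
      expectation (\<lambda>\<omega>. Y \<omega> * real_cond_exp M (F u) (\<lambda>\<omega>. X v \<omega> - X u \<omega>) \<omega>)"
    using S.real_cond_exp_intg(2)[OF i Y(1)] Xi by simp
  also have "\<dots> = 0" using z by (simp add: integral_eq_zero_AE)
  finally have "expectation (\<lambda>\<omega>. Y \<omega> * (N v \<omega> - N u \<omega>)) = expectation (\<lambda>\<omega>. Y \<omega> * (A v \<omega> - A u \<omega>))"
    using Bochner_Integration.integral_diff[OF iN iA] by (simp add: X_def algebra_simps)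
  also have "\<dots> \<le> expectation (\<lambda>\<omega>. C * (v - u) * Y \<omega>)"
  proof (rule integral_mono_AE[OF iA])
    show "AE \<omega> in M. Y \<omega> * (A v \<omega> - A u \<omega>) \<le> C * (v - u) * Y \<omega>"
      using A_increment_bound[OF uv near] AE_space
    proof eventually_elim
      case (elim \<omega>)
      then have "Y \<omega> * (A v \<omega> - A u \<omega>) \<le> Y \<omega> * (C * (v - u))"
        using Y(2)[of \<omega>] by (intro mult_left_mono) auto
      then show ?case by (simp add: mult_ac)
    qed
  qed (use Yi in simp)
  finally show "expectation (\<lambda>\<omega>. Y \<omega> * (N v \<omega> - N u \<omega>)) \<le> C * (v - u) * expectation Y" by simp
qed

lemma expectation_increment:
  assumes uv: "u \<le> v" and near: "near u" "near v"
  shows "expectation (\<lambda>\<omega>. N v \<omega> - N u \<omega>) \<le> C * (v - u)"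
  using expectation_weighted_increment(2)[of "\<lambda>_. 1", OF _ _ _ uv near] by (simp add: prob_space)

end

section \<open>Rare events: double jumps and jumps at fixed times\<close>

lemma (in prob_space) abs_expectation_le:
  fixes X :: "'a \<Rightarrow> real"
  assumes "AE \<omega> in M. \<bar>X \<omega>\<bar> \<le> K" "0 \<le> K"
  shows "\<bar>expectation X\<bar> \<le> K"
proof (cases "integrable M X")
  case True
  have "\<bar>expectation X\<bar> \<le> expectation (\<lambda>\<omega>. \<bar>X \<omega>\<bar>)"
    using integral_norm_bound[of M X] by simp
  also have "\<dots> \<le> expectation (\<lambda>_. K)"
    using True assms(1) by (intro integral_mono_AE) auto
  finally show ?thesis by (simp add: prob_space)
next
  case False
  then show ?thesis using assms(2) by (simp add: not_integrable_integral_eq)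
qed

context local_intensity
begin

lemma N_increment_square_integrable:
  assumes "0 \<le> u" "u \<le> v"
  shows "integrable M (\<lambda>\<omega>. (N v \<omega> - N u \<omega>)\<^sup>2)"
proof (rule Bochner_Integration.integrable_bound[OF N_square_integrable])
  show "0 \<le> v" using assms by simp
  show "(\<lambda>\<omega>. (N v \<omega> - N u \<omega>)\<^sup>2) \<in> borel_measurable M" using assms by simp
  show "AE \<omega> in M. norm ((N v \<omega> - N u \<omega>)\<^sup>2) \<le> norm ((N v \<omega>)\<^sup>2)"
  proof (rule AE_I2)
    fix \<omega> assume "\<omega> \<in> space M"
    then show "norm ((N v \<omega> - N u \<omega>)\<^sup>2) \<le> norm ((N v \<omega>)\<^sup>2)"
      using N_mono[of \<omega> u v] N_nonneg[of u \<omega>] assms(2) by (simp add: power_mono)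
  qed
qed

lemma C_nonneg: "near u \<Longrightarrow> 0 \<le> C"
  using \<nu>_bound[of u] \<nu>_nonneg[of u] by linarith

text \<open>
  Let \<open>J\<close> be the count over the interval, \<open>D\<^sub>p\<close> the count in cell \<open>p\<close> of a grid and \<open>g\<^sub>p\<close> the
  count before that cell.  Telescoping gives \<open>J\<^sup>2 - \<Sum> D\<^sub>p\<^sup>2 = 2 \<Sum> g\<^sub>p D\<^sub>p\<close>.  On the right each
  expectation is bounded by the intensity bound applied twice, once to the cell and once to
  what precedes it.  On fine grids \<open>D\<^sub>p\<close> is 0 or 1, and the left side becomes \<open>J\<^sup>2 - J\<close>.
\<close>

lemma factorial_moment:
  assumes ab: "a \<le> b" and near: "near a" "near b"
  shows "expectation (\<lambda>\<omega>. (N b \<omega> - N a \<omega>)\<^sup>2 - (N b \<omega> - N a \<omega>)) \<le> 2 * C\<^sup>2 * (b - a)\<^sup>2"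
proof -
  define v where "v n p = a + real p * (b - a) / real n" for n p
  define g where "g n p \<omega> = N (v n p) \<omega> - N a \<omega>" for n p \<omega>
  define D where "D n p \<omega> = N (v n (Suc p)) \<omega> - N (v n p) \<omega>" for n p \<omega>
  define J where "J \<omega> = N b \<omega> - N a \<omega>" for \<omega>
  have a0: "0 \<le> a" "0 \<le> b" using near by auto
  have vmono: "v n p \<le> v n q" if "p \<le> q" for n p q
    unfolding v_def using ab that by (intro add_left_mono divide_right_mono mult_right_mono) auto
  have v0: "v n 0 = a" for n by (simp add: v_def)
  have vn: "v n n = b" if "n > 0" for n using that by (simp add: v_def)
  have va: "a \<le> v n p" for n p using vmono[of 0 p n] v0 by simp
  have vb: "v n p \<le> b" if "p \<le> n" "n > 0" for n p using vmono[of p n n] vn that by simp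
  have vnear: "near (v n p)" if "p \<le> n" "n > 0" for n p
    using va[of n p] vb[OF that] near by auto
  have step: "v n (Suc p) - v n p = (b - a) / real n" for n p
    by (simp add: v_def distrib_right add_divide_distrib)
  have g_nonneg: "0 \<le> g n p \<omega>" and D_nonneg: "0 \<le> D n p \<omega>" if "\<omega> \<in> space M" for n p \<omega>
    using N_mono[OF that va[of n p]] N_mono[OF that vmono[of p "Suc p" n]] by (auto simp: g_def D_def)
  have gi: "g n p \<in> borel_measurable (F (v n p))" "integrable M (\<lambda>\<omega>. (g n p \<omega>)\<^sup>2)" for n p
    unfolding g_def using a0 va[of n p]
    by (auto intro!: borel_measurable_diff N_measurable_F N_increment_square_integrable)
  define Q where "Q n \<omega> = (\<Sum>p<n. 2 * (g n p \<omega> * D n p \<omega>))" for n \<omega>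
  have Q: "Q n \<omega> = (J \<omega>)\<^sup>2 - (\<Sum>p<n. (D n p \<omega>)\<^sup>2)" if n: "n > 0" for n \<omega>
  proof -
    have "(\<Sum>p<n. (g n (Suc p) \<omega>)\<^sup>2 - (g n p \<omega>)\<^sup>2) = (g n n \<omega>)\<^sup>2 - (g n 0 \<omega>)\<^sup>2"
      by (rule sum_lessThan_telescope)
    also have "\<dots> = (J \<omega>)\<^sup>2" by (simp add: g_def J_def v0 vn[OF n])
    also have "(\<Sum>p<n. (g n (Suc p) \<omega>)\<^sup>2 - (g n p \<omega>)\<^sup>2) = (\<Sum>p<n. 2 * (g n p \<omega> * D n p \<omega>) + (D n p \<omega>)\<^sup>2)"
      by (intro sum.cong refl) (simp add: g_def D_def power2_eq_square algebra_simps)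
    finally show ?thesis by (simp add: Q_def sum.distrib)
  qed
  have iD: "integrable M (\<lambda>\<omega>. g n p \<omega> * D n p \<omega>)"
    and eD: "expectation (\<lambda>\<omega>. g n p \<omega> * D n p \<omega>) \<le> C * ((b - a) / real n) * (C * (b - a))"
    if p: "p < n" for n p
  proof -
    have nr: "near (v n p)" "near (v n (Suc p))" using p by (auto intro!: vnear simp del: of_nat_Suc)
    show "integrable M (\<lambda>\<omega>. g n p \<omega> * D n p \<omega>)"
      unfolding D_def using expectation_weighted_increment(1)[OF gi(1) g_nonneg gi(2) vmono nr] by simp
    have "expectation (\<lambda>\<omega>. g n p \<omega> * D n p \<omega>) \<le> C * (v n (Suc p) - v n p) * expectation (g n p)"
      unfolding D_def using expectation_weighted_increment(2)[OF gi(1) g_nonneg gi(2) vmono nr] by simp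
    also have "\<dots> \<le> C * (v n (Suc p) - v n p) * (C * (b - a))"
    proof (rule mult_left_mono)
      have "expectation (g n p) \<le> C * (v n p - a)"
        using expectation_increment[OF va near(1) nr(1)] unfolding g_def .
      also have "\<dots> \<le> C * (b - a)" using vb[of p n] p C_nonneg[OF near(1)] by (intro mult_left_mono) auto
      finally show "expectation (g n p) \<le> C * (b - a)" .
      show "0 \<le> C * (v n (Suc p) - v n p)" using C_nonneg[OF near(1)] step[of n p] ab by simp
    qed
    finally show "expectation (\<lambda>\<omega>. g n p \<omega> * D n p \<omega>) \<le> C * ((b - a) / real n) * (C * (b - a))"
      by (simp only: step)
  qed
  have EQ: "expectation (Q n) \<le> 2 * C\<^sup>2 * (b - a)\<^sup>2" if n: "n > 0" for n
  proof -
    have "expectation (Q n) = (\<Sum>p<n. 2 * expectation (\<lambda>\<omega>. g n p \<omega> * D n p \<omega>))"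
      unfolding Q_def using iD by (subst Bochner_Integration.integral_sum) auto
    also have "\<dots> \<le> (\<Sum>p<n. 2 * (C * ((b - a) / real n) * (C * (b - a))))"
      using eD by (intro sum_mono mult_left_mono) auto
    also have "\<dots> = 2 * C\<^sup>2 * (b - a)\<^sup>2" using n by (simp add: power2_eq_square)
    finally show ?thesis .
  qed
  have Jm [measurable]: "J \<in> borel_measurable M" unfolding J_def using a0 by simp
  have Ji: "integrable M (\<lambda>\<omega>. (J \<omega>)\<^sup>2)"
    unfolding J_def using N_increment_square_integrable[OF a0(1) ab] .
  have lim: "(\<lambda>n. Q (Suc n) \<omega>) \<longlonglongrightarrow> (J \<omega>)\<^sup>2 - J \<omega>" if w: "\<omega> \<in> space M" for \<omega>
  proof -
    have "\<forall>\<^sub>F n in sequentially. Q n \<omega> = (J \<omega>)\<^sup>2 - J \<omega>"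
      using eventually_one_switch_cells[OF Z_path[OF w] a0(1) ab, folded v_def] eventually_gt_at_top[of 0]
    proof eventually_elim
      case (elim n)
      have "(D n p \<omega>)\<^sup>2 = D n p \<omega>" if p: "p < n" for p
      proof -
        from elim p obtain x where x: "one_switch (\<lambda>s. Z s \<omega>) (v n p) (v n (Suc p)) x" by blast
        have "0 \<le> v n p" using va[of n p] a0 by simp
        from one_switch_jump_times[OF x this vmono jk]
        show ?thesis unfolding D_def N_diff[OF w vmono, of p "Suc p" n, OF le_SucI, OF order_refl] by auto
      qed
      then have "(\<Sum>p<n. (D n p \<omega>)\<^sup>2) = (\<Sum>p<n. D n p \<omega>)" by simp
      also have "\<dots> = N (v n n) \<omega> - N (v n 0) \<omega>" unfolding D_def by (rule sum_lessThan_telescope)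
      also have "\<dots> = J \<omega>" using elim by (simp add: J_def v0 vn)
      finally show ?case using Q elim by simp
    qed
    then have "\<forall>\<^sub>F n in sequentially. Q (Suc n) \<omega> = (J \<omega>)\<^sup>2 - J \<omega>"
      by (rule eventually_sequentially_Suc[THEN iffD2])
    then show ?thesis by (rule tendsto_eventually)
  qed
  have "(\<lambda>n. expectation (Q (Suc n))) \<longlonglongrightarrow> expectation (\<lambda>\<omega>. (J \<omega>)\<^sup>2 - J \<omega>)"
  proof (rule integral_dominated_convergence[OF _ _ Ji])
    show "(\<lambda>\<omega>. (J \<omega>)\<^sup>2 - J \<omega>) \<in> borel_measurable M" by measurable
    show "Q (Suc n) \<in> borel_measurable M" for n
      unfolding Q_def
      by (rule borel_measurable_sum, rule borel_measurable_integrable, rule integrable_mult_right, rule iD) simp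
    show "AE \<omega> in M. (\<lambda>n. Q (Suc n) \<omega>) \<longlonglongrightarrow> (J \<omega>)\<^sup>2 - J \<omega>" using lim by (intro AE_I2) auto
    show "AE \<omega> in M. norm (Q (Suc n) \<omega>) \<le> (J \<omega>)\<^sup>2" for n
    proof (rule AE_I2)
      fix \<omega> assume w: "\<omega> \<in> space M"
      have "0 \<le> Q (Suc n) \<omega>" unfolding Q_def using g_nonneg[OF w] D_nonneg[OF w] by (intro sum_nonneg) auto
      moreover have "Q (Suc n) \<omega> \<le> (J \<omega>)\<^sup>2" 
      proof -
        have "0 \<le> (\<Sum>p<Suc n. (D (Suc n) p \<omega>)\<^sup>2)" by (intro sum_nonneg) simp
        then show ?thesis using Q[of "Suc n" \<omega>] by linarith
      qed
      ultimately show "norm (Q (Suc n) \<omega>) \<le> (J \<omega>)\<^sup>2" by simp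
    qed
  qed
  then show ?thesis unfolding J_def
    by (rule LIMSEQ_le_const2) (use EQ in auto)
qed

text \<open>
  A jump at \<open>a\<close> is counted in every interval \<open>(u, a]\<close>, whose expected count is at most
  \<open>C (a - u)\<close>.
\<close>

lemma no_fixed_jump:
  assumes "near a"
  shows "AE \<omega> in M. a \<notin> jump_times j k (\<lambda>s. Z s \<omega>)"
proof (cases "0 < a")
  case False
  then show ?thesis by (simp add: jump_times_def)
next
  case True
  define u where "u n = max 0 (a - 1 / real (Suc n))" for n
  define f where "f n \<omega> = N a \<omega> - N (u n) \<omega>" for n \<omega>
  \<comment> \<open>The counts over \<open>(u n, a]\<close> decrease to the indicator of a jump at \<open>a\<close>.\<close>
  define h where "h \<omega> = (of_bool (a \<in> jump_times j k (\<lambda>s. Z s \<omega>)) :: real)" for \<omega>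
  have u0: "0 \<le> u n" "u n \<le> a" for n using True by (auto simp: u_def)
  have ulim: "u \<longlonglongrightarrow> a"
  proof -
    have "u \<longlonglongrightarrow> max 0 (a - 0)"
      unfolding u_def using LIMSEQ_inverse_real_of_nat by (intro tendsto_intros) (simp add: inverse_eq_divide)
    then show ?thesis using True by simp
  qed
  have lim: "(\<lambda>n. f n \<omega>) \<longlonglongrightarrow> h \<omega>" if w: "\<omega> \<in> space M" for \<omega>
  proof -
    let ?J = "jump_times j k (\<lambda>s. Z s \<omega>)"
    have "\<forall>\<^sub>F n in sequentially. f n \<omega> = h \<omega>"
      using jumps_before_limit[OF Z_path[OF w] jk, of a]
    proof eventually_elim
      case (elim n)
      have "?J \<inter> {u n<..a} = (if a \<in> ?J then {a} else {})"
      proof -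
        have 1: "x = a" if x: "x \<in> ?J" "u n < x" "x \<le> a" for x
        proof (rule ccontr)
          assume "x \<noteq> a"
          with x have "x \<in> ?J \<inter> {..<a}" by auto
          then have "x \<in> {0<..u n}" using elim unfolding u_def[symmetric] by blast
          with x show False by simp
        qed
        have 2: "u n < a" using \<open>0 < a\<close> by (simp add: u_def)
        have "?J \<inter> {u n<..a} = ?J \<inter> {a}"
        proof (intro equalityI subsetI)
          fix x assume "x \<in> ?J \<inter> {u n<..a}"
          then show "x \<in> ?J \<inter> {a}" using 1[of x] by simp
        next
          fix x assume "x \<in> ?J \<inter> {a}"
          then show "x \<in> ?J \<inter> {u n<..a}" using 2 by auto
        qed
        then show ?thesis by auto
      qed
      then show ?case unfolding f_def h_def N_diff[OF w u0(2)] by simp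
    qed
    then show ?thesis by (rule tendsto_eventually)
  qed
  have fm: "f n \<in> borel_measurable M" for n unfolding f_def using u0 True by simp
  have hm: "h \<in> borel_measurable M" by (rule borel_measurable_LIMSEQ_real[OF lim fm])
  have "(\<lambda>n. expectation (f n)) \<longlonglongrightarrow> expectation h"
  proof (rule integral_dominated_convergence[OF hm fm N_integrable])
    show "0 \<le> a" using True by simp
    show "AE \<omega> in M. (\<lambda>n. f n \<omega>) \<longlonglongrightarrow> h \<omega>" using lim by (intro AE_I2) auto
    show "AE \<omega> in M. norm (f n \<omega>) \<le> N a \<omega>" for n
      using N_mono[OF _ u0(2)] N_nonneg by (intro AE_I2) (auto simp: f_def)
  qed
  moreover have "expectation h \<ge> 0" unfolding h_def by (intro Bochner_Integration.integral_nonneg) auto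
  moreover have "\<forall>\<^sub>F n in sequentially. expectation (f n) \<le> C * (a - u n)"
  proof -
    have "(\<lambda>n. \<bar>u n - t\<bar>) \<longlonglongrightarrow> \<bar>a - t\<bar>" using ulim by (intro tendsto_intros)
    then have "\<forall>\<^sub>F n in sequentially. \<bar>u n - t\<bar> < e" by (rule order_tendstoD) (use assms in simp)
    then show ?thesis
      by eventually_elim (use expectation_increment[OF u0(2) _ assms] u0 in \<open>simp add: f_def[abs_def]\<close>)
  qed
  moreover have "(\<lambda>n. C * (a - u n)) \<longlonglongrightarrow> C * (a - a)" using ulim by (intro tendsto_intros)
  ultimately have "expectation h \<le> 0" using tendsto_le[OF sequentially_bot] by fastforce
  then have "expectation h = 0" using \<open>expectation h \<ge> 0\<close> by simp
  moreover have "integrable M h"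
    by (rule integrable_const_bound[of _ 1]) (use hm in \<open>auto simp: h_def\<close>)
  ultimately have "AE \<omega> in M. h \<omega> = 0"
    by (subst (asm) integral_nonneg_eq_0_iff_AE) (auto simp: h_def)
  then show ?thesis by eventually_elim (simp add: h_def split: if_splits)
qed

lemma path_measurable: "path_of Z \<in> measurable M path_space"
  unfolding path_space_def path_of_def
  by (intro measurable_restrict) (auto intro: Z_measurable)

end

section \<open>Censoring at a fixed and at an independent time\<close>

context local_intensity
begin

abbreviation jumps :: "'w \<Rightarrow> real set" where "jumps \<omega> \<equiv> jump_times j k (\<lambda>s. Z s \<omega>)"

lemma path_pair_measurable:
  "(\<lambda>\<omega>. (path_of Z \<omega>, r)) \<in> measurable M (path_space \<Otimes>\<^sub>M borel)"
  using path_measurable by simp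

lemma occ_functional_eq:
  assumes "\<omega> \<in> space M" "0 \<le> a" "a \<le> b"
  shows "occ_functional j k a b (path_of Z \<omega>, r) = real (card (jumps \<omega> \<inter> {a..<b} \<inter> {..r}))"
  by (rule occ_functional_path_of[where Z = Z and \<omega> = \<omega>]) (use assms Z_path jk in auto)

lemma exposure_functional_eq:
  assumes "\<omega> \<in> space M" "0 \<le> a" "a < b"
  shows "exposure_functional j a b (path_of Z \<omega>, r) = (LINT s:{a..b}|lborel. of_bool (s < r) * of_bool (Z s \<omega> = j))"
  by (rule exposure_functional_path_of[where Z = Z and \<omega> = \<omega>]) (use assms Z_path in auto)

lemma exposure_functional_bounds:
  assumes "\<omega> \<in> space M" "0 \<le> a" "a < b"
  shows "0 \<le> exposure_functional j a b (path_of Z \<omega>, r)" "exposure_functional j a b (path_of Z \<omega>, r) \<le> b - a"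
proof -
  have "\<bar>LINT s:{a..b}|lborel. of_bool (s < r) * of_bool (Z s \<omega> = j) :: real\<bar> \<le> 1 * (b - a)"
    using assms by (intro set_integral_bounded_by grid_exposure_tendsto(1)[OF Z_path]) auto
  then show "exposure_functional j a b (path_of Z \<omega>, r) \<le> b - a" using exposure_functional_eq[OF assms] by simp
  show "0 \<le> exposure_functional j a b (path_of Z \<omega>, r)" unfolding exposure_functional_eq[OF assms] set_lebesgue_integral_def
    by (intro Bochner_Integration.integral_nonneg) (auto simp: indicator_def)
qed

text \<open>
  Occurrences are counted on \<open>[a, b)\<close> and increments on \<open>(a, b]\<close>; only a jump at \<open>a\<close> could
  spoil the inequality.  The null set does not depend on the censoring time \<open>r\<close>.
\<close>

lemma occ_functional_le_increment:
  assumes ab: "a < b" and near: "near a" "near b"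
  shows "AE \<omega> in M. \<forall>r. occ_functional j k a b (path_of Z \<omega>, r) \<le> N b \<omega> - N a \<omega>"
  using no_fixed_jump[OF near(1)] AE_space
proof eventually_elim
  case (elim \<omega>)
  have "real (card (jumps \<omega> \<inter> {a..<b} \<inter> {..r})) \<le> real (card (jumps \<omega> \<inter> {a<..b}))" for r
  proof -
    have "finite (jumps \<omega> \<inter> {..b})" by (rule jump_path_finite[OF Z_path[OF elim(2)] jk])
    then have "finite (jumps \<omega> \<inter> {a<..b})" by (rule finite_subset[rotated]) auto
    moreover have "jumps \<omega> \<inter> {a..<b} \<inter> {..r} \<subseteq> jumps \<omega> \<inter> {a<..b}"
    proof
      fix x assume "x \<in> jumps \<omega> \<inter> {a..<b} \<inter> {..r}"
      moreover from this elim have "x \<noteq> a" by auto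
      ultimately show "x \<in> jumps \<omega> \<inter> {a<..b}" by auto
    qed
    ultimately show ?thesis by (intro of_nat_mono card_mono)
  qed
  then show ?case using occ_functional_eq[OF elim(2)] N_diff[OF elim(2)] near ab by auto
qed

text \<open>
  With censoring at a fixed time \<open>r\<close> the occurrence is the increment of the count up to \<open>min b r\<close>.
  Its mean is that of the compensator, the exposure weighted with the intensity, and
  replacing the intensity by \<open>c\<close> changes this by at most \<open>D\<close> per unit of time.
\<close>

lemma mean_bound_fixed_horizon:
  assumes ab: "a < b" and near: "near a" "near b"
    and D: "\<And>s. s \<in> {a..b} \<Longrightarrow> \<bar>\<nu> s - c\<bar> \<le> D"
  shows "\<bar>expectation (\<lambda>\<omega>. occ_functional j k a b (path_of Z \<omega>, r) - c * exposure_functional j a b (path_of Z \<omega>, r))\<bar> \<le> D * (b - a)"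
proof -
  have a0: "0 \<le> a" "a \<le> b" using near ab by auto
  have D0: "0 \<le> D" using D[of a] ab by auto
  show ?thesis
  proof (cases "a < r")
    case False
    have "AE \<omega> in M. occ_functional j k a b (path_of Z \<omega>, r) - c * exposure_functional j a b (path_of Z \<omega>, r) = 0"
      using no_fixed_jump[OF near(1)] AE_space
    proof eventually_elim
      case (elim \<omega>)
      have "{a..<b} \<inter> {..r} \<subseteq> {a}" using False by auto
      then have "jumps \<omega> \<inter> {a..<b} \<inter> {..r} = {}" using elim by blast
      moreover have "(LINT s:{a..b}|lborel. of_bool (s < r) * of_bool (Z s \<omega> = j) :: real) = (LINT s:{a..b}|lborel. 0)"
        using False by (intro set_lebesgue_integral_cong) auto
      ultimately show ?case
        by (simp add: occ_functional_eq[OF elim(2) a0] exposure_functional_eq[OF elim(2) a0(1) ab])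
    qed
    then have "expectation (\<lambda>\<omega>. occ_functional j k a b (path_of Z \<omega>, r) - c * exposure_functional j a b (path_of Z \<omega>, r)) = 0"
      by (rule integral_eq_zero_AE)
    then show ?thesis using D0 ab by simp
  next
    case True
    \<comment> \<open>The effective end of observation; a jump at \<open>b\<close> or at \<open>a\<close> has probability 0.\<close>
    define w where "w = min b r"
    have w: "a < w" "w \<le> b" using True ab by (auto simp: w_def)
    have nw: "near w" using near w by auto
    define E where "E \<omega> = exposure_functional j a b (path_of Z \<omega>, r)" for \<omega>
    define Oc where "Oc \<omega> = occ_functional j k a b (path_of Z \<omega>, r)" for \<omega>
    have m [measurable]: "E \<in> borel_measurable M" "Oc \<in> borel_measurable M"
      unfolding E_def Oc_def using a0
      by (auto intro!: measurable_compose[OF path_pair_measurable] occ_functional_measurable exposure_functional_measurable)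
    have Eb: "0 \<le> E \<omega>" "E \<omega> \<le> b - a" if "\<omega> \<in> space M" for \<omega>
      unfolding E_def using exposure_functional_bounds[OF that a0(1) ab] .
    have Ei: "integrable M E"
      by (rule integrable_const_bound[of _ "b - a"]) (use Eb in auto)
    have Ocw: "AE \<omega> in M. Oc \<omega> = N w \<omega> - N a \<omega>"
      using no_fixed_jump[OF near(1)] no_fixed_jump[OF near(2)] AE_space
    proof eventually_elim
      case (elim \<omega>)
      have "jumps \<omega> \<inter> {a..<b} \<inter> {..r} = jumps \<omega> \<inter> {a<..w}"
      proof (intro equalityI subsetI)
        fix x assume x: "x \<in> jumps \<omega> \<inter> {a..<b} \<inter> {..r}"
        with elim have "x \<noteq> a" by auto
        with x show "x \<in> jumps \<omega> \<inter> {a<..w}" by (auto simp: w_def)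
      next
        fix x assume x: "x \<in> jumps \<omega> \<inter> {a<..w}"
        with elim have "x \<noteq> b" by auto
        with x show "x \<in> jumps \<omega> \<inter> {a..<b} \<inter> {..r}" by (auto simp: w_def)
      qed
      then show ?case using w by (simp add: Oc_def occ_functional_eq[OF elim(3) a0] N_diff[OF elim(3)])
    qed
    have Ni: "integrable M (N w)" "integrable M (N a)" using nw near by (auto intro: N_integrable)
    have Ai: "integrable M (A w)" "integrable M (A a)" using nw near by (auto intro: A_integrable)
    have Oci: "integrable M Oc" "expectation Oc = expectation (\<lambda>\<omega>. N w \<omega> - N a \<omega>)"
      using integrable_cong_AE[OF m(2) _ Ocw] integral_cong_AE[OF m(2) _ Ocw] Ni by auto
    have "expectation (\<lambda>\<omega>. Oc \<omega> - c * E \<omega>) = expectation (N w) - expectation (N a) - c * expectation E"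
      using Oci Ei Ni by simp
    also have "\<dots> = expectation (\<lambda>\<omega>. A w \<omega> - A a \<omega> - c * E \<omega>)"
      using Ai Ei nw near expectation_N by simp
    also have "\<bar>\<dots>\<bar> \<le> D * (b - a)"
    proof (rule abs_expectation_le)
      show "0 \<le> D * (b - a)" using D0 ab by simp
      show "AE \<omega> in M. \<bar>A w \<omega> - A a \<omega> - c * E \<omega>\<bar> \<le> D * (b - a)"
        using compensator_diff[OF a0(1) less_imp_le[OF w(1)]] AE_space
      proof eventually_elim
        case (elim \<omega>)
        let ?I = "\<lambda>s. of_bool (Z s \<omega> = j) :: real"
        note z = Z_path[OF elim(2)]
        have i: "set_integrable lborel {a..w} (\<lambda>s. of_bool (s < w) * ?I s)"
          by (rule grid_exposure_tendsto(1)[OF z a0(1) w(1)])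
        have ib: "set_integrable lborel {a..b} (\<lambda>s. of_bool (s < r) * ?I s)"
          by (rule grid_exposure_tendsto(1)[OF z a0(1) ab])
        have Iw: "set_integrable lborel {a..w} ?I"
        proof -
          have "(\<lambda>s. indicator {a..w} s *\<^sub>R ?I s) =
              (\<lambda>s. indicator {a..w} s *\<^sub>R (of_bool (s < w) * ?I s) + indicator {w} s * ?I w)"
            using w by (auto simp: indicator_def fun_eq_iff order_le_less)
          then show ?thesis using i unfolding set_integrable_def by simp
        qed
        have "E \<omega> = (LINT s:{a..w}|lborel. ?I s)"
          unfolding E_def exposure_functional_eq[OF elim(2) a0(1) ab] set_lebesgue_integral_def
        proof (rule integral_cong_AE)
          show "AE s in lborel. indicator {a..b} s *\<^sub>R (of_bool (s < r) * ?I s) = indicator {a..w} s *\<^sub>R ?I s"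
            using AE_lborel_singleton[of r] by eventually_elim (auto simp: indicator_def w_def)
        qed (use ib Iw in \<open>auto simp: set_integrable_def\<close>)
        then have "A w \<omega> - A a \<omega> - c * E \<omega> = (LINT s:{a..w}|lborel. ?I s * \<nu> s) - (LINT s:{a..w}|lborel. c * ?I s)"
          using elim by simp
        also have "\<dots> = (LINT s:{a..w}|lborel. ?I s * \<nu> s - c * ?I s)"
          using elim Iw by (intro set_integral_diff(2)[symmetric]) auto
        also have "\<bar>\<dots>\<bar> \<le> D * (w - a)"
        proof (rule set_integral_bounded_by)
          show "set_integrable lborel {a..w} (\<lambda>s. ?I s * \<nu> s - c * ?I s)"
            using elim Iw by (intro set_integral_diff(1)) auto
          show "\<bar>?I s * \<nu> s - c * ?I s\<bar> \<le> D" if "s \<in> {a..w}" for s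
            using D[of s] that w D0 by auto
        qed (use w in simp)
        also have "\<dots> \<le> D * (b - a)" using w D0 by (intro mult_left_mono) auto
        finally show ?case .
      qed
    qed
    finally show ?thesis unfolding Oc_def E_def .
  qed
qed

end

lemma (in prob_space) distr_indep_elements:
  assumes "indep_elements M S X T Y"
  shows "distr M (S \<Otimes>\<^sub>M T) (\<lambda>\<omega>. (X \<omega>, Y \<omega>)) = distr M S X \<Otimes>\<^sub>M distr M T Y"
proof -
  have [measurable]: "X \<in> measurable M S" "Y \<in> measurable M T"
    and ind: "indep_set {X -` A \<inter> space M | A. A \<in> sets S} {Y -` B \<inter> space M | B. B \<in> sets T}"
    using assms by (auto simp: indep_elements_def)
  interpret X: prob_space "distr M S X" by (rule prob_space_distr) simp
  interpret Y: prob_space "distr M T Y" by (rule prob_space_distr) simp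
  show ?thesis
  proof (rule pair_measure_eqI[symmetric])
    show "sigma_finite_measure (distr M S X)" "sigma_finite_measure (distr M T Y)" by unfold_locales
    show "sets (distr M S X \<Otimes>\<^sub>M distr M T Y) = sets (distr M (S \<Otimes>\<^sub>M T) (\<lambda>\<omega>. (X \<omega>, Y \<omega>)))"
      by (simp cong: sets_pair_measure_cong)
    fix A B assume AB: "A \<in> sets (distr M S X)" "B \<in> sets (distr M T Y)"
    then have [measurable]: "A \<in> sets S" "B \<in> sets T" by auto
    have "prob ((X -` A \<inter> space M) \<inter> (Y -` B \<inter> space M)) = prob (X -` A \<inter> space M) * prob (Y -` B \<inter> space M)"
      by (rule indep_setD[OF ind]) auto
    moreover have "(\<lambda>\<omega>. (X \<omega>, Y \<omega>)) -` (A \<times> B) \<inter> space M = (X -` A \<inter> space M) \<inter> (Y -` B \<inter> space M)" by auto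
    ultimately show "emeasure (distr M S X) A * emeasure (distr M T Y) B
        = emeasure (distr M (S \<Otimes>\<^sub>M T) (\<lambda>\<omega>. (X \<omega>, Y \<omega>))) (A \<times> B)"
      by (simp add: emeasure_distr emeasure_eq_measure ennreal_mult[symmetric])
  qed
qed

text \<open>
  Fubini's theorem: average the bound for fixed \<open>y\<close> over the law of \<open>Y\<close>.
\<close>

lemma (in prob_space) abs_expectation_indep_le:
  fixes f :: "'b \<times> 'c \<Rightarrow> real"
  assumes ind: "indep_elements M S X T Y"
    and f [measurable]: "f \<in> borel_measurable (S \<Otimes>\<^sub>M T)"
    and i: "integrable M (\<lambda>\<omega>. f (X \<omega>, Y \<omega>))"
    and K: "\<And>y. \<bar>expectation (\<lambda>\<omega>. f (X \<omega>, y))\<bar> \<le> K"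
  shows "\<bar>expectation (\<lambda>\<omega>. f (X \<omega>, Y \<omega>))\<bar> \<le> K"
proof -
  have [measurable]: "X \<in> measurable M S" "Y \<in> measurable M T"
    using ind by (auto simp: indep_elements_def)
  interpret X: prob_space "distr M S X" by (rule prob_space_distr) simp
  interpret Y: prob_space "distr M T Y" by (rule prob_space_distr) simp
  interpret XY: pair_sigma_finite "distr M S X" "distr M T Y" by unfold_locales
  have fm: "f \<in> borel_measurable (distr M S X \<Otimes>\<^sub>M distr M T Y)"
    using f by (simp cong: measurable_cong_sets sets_pair_measure_cong)
  have fi: "integrable (distr M S X \<Otimes>\<^sub>M distr M T Y) f"
    unfolding distr_indep_elements[OF ind, symmetric] using i by (simp add: integrable_distr_eq)
  have "expectation (\<lambda>\<omega>. f (X \<omega>, Y \<omega>)) = integral\<^sup>L (distr M (S \<Otimes>\<^sub>M T) (\<lambda>\<omega>. (X \<omega>, Y \<omega>))) f"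
    by (simp add: integral_distr)
  also have "\<dots> = (LINT y|distr M T Y. LINT x|distr M S X. f (x, y))"
    unfolding distr_indep_elements[OF ind] using XY.integral_snd[of "\<lambda>x y. f (x, y)"] fi by simp
  also have "\<bar>\<dots>\<bar> \<le> K"
  proof (rule Y.abs_expectation_le)
    show "0 \<le> K" using order_trans[OF abs_ge_zero K] .
    show "AE y in distr M T Y. \<bar>LINT x|distr M S X. f (x, y)\<bar> \<le> K"
    proof (rule AE_I2)
      fix y assume "y \<in> space (distr M T Y)"
      then have [measurable]: "(\<lambda>x. f (x, y)) \<in> borel_measurable S" by simp
      show "\<bar>LINT x|distr M S X. f (x, y)\<bar> \<le> K" using K[of y] by (simp add: integral_distr)
    qed
  qed
  finally show ?thesis .
qed

section \<open>Moments of one censored observation\<close>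

lemma nat_factorial_nonneg: "0 \<le> (real n)\<^sup>2 - real n"
  by (cases n) (auto simp: power2_eq_square algebra_simps)

locale censored_local_intensity = local_intensity M Z \<nu> j k t e C
  for M :: "'w measure" and Z :: "real \<Rightarrow> 'w \<Rightarrow> 'z" and \<nu> j k t e C +
  fixes R :: "'w \<Rightarrow> real"
  assumes indep: "indep_elements M path_space (path_of Z) borel R"
begin

definition occ :: "real \<Rightarrow> real \<Rightarrow> 'w \<Rightarrow> real" where
  "occ a b \<omega> = occ_functional j k a b (path_of Z \<omega>, R \<omega>)"

definition expo :: "real \<Rightarrow> real \<Rightarrow> 'w \<Rightarrow> real" where
  "expo a b \<omega> = exposure_functional j a b (path_of Z \<omega>, R \<omega>)"

lemma R_measurable [measurable]: "R \<in> borel_measurable M"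
  using indep by (simp add: indep_elements_def)

lemma data_measurable [measurable]:
  "(\<lambda>\<omega>. (path_of Z \<omega>, R \<omega>)) \<in> measurable M (path_space \<Otimes>\<^sub>M borel)"
  using path_measurable by simp

lemma occ_measurable [measurable]: "occ a b \<in> borel_measurable M"
  unfolding occ_def by (rule measurable_compose[OF data_measurable occ_functional_measurable])

lemma expo_measurable [measurable]: "0 \<le> a \<Longrightarrow> a \<le> b \<Longrightarrow> expo a b \<in> borel_measurable M"
  unfolding expo_def by (rule measurable_compose[OF data_measurable exposure_functional_measurable])

context
  fixes a b :: real
  assumes ab: "a < b" and near_ab: "near a" "near b"
begin

lemma a_nonneg: "0 \<le> a" "a \<le> b"
  using ab near_ab by auto

lemma occ_Nats: "\<omega> \<in> space M \<Longrightarrow> \<exists>n. occ a b \<omega> = real n"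
  unfolding occ_def using occ_functional_eq[of \<omega> a b] a_nonneg by blast

lemma expo_bounds:
  assumes "\<omega> \<in> space M"
  shows "0 \<le> expo a b \<omega>" "expo a b \<omega> \<le> b - a"
  unfolding expo_def using exposure_functional_bounds[OF assms a_nonneg(1) ab] by auto

lemma expo_integrable: "integrable M (expo a b)"
  by (rule integrable_const_bound[of _ "b - a"]) (use expo_bounds a_nonneg in auto)

text \<open>
  On the natural numbers \<open>x\<^sup>2 - x\<close> is nonnegative and monotone, so the censored count inherits
  the bound on the factorial moment of the uncensored one.
\<close>

lemma occ_increment:
  "AE \<omega> in M. 0 \<le> occ a b \<omega> \<and> occ a b \<omega> \<le> N b \<omega> - N a \<omega> \<and> 0 \<le> (occ a b \<omega>)\<^sup>2 - occ a b \<omega> \<and>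
     (occ a b \<omega>)\<^sup>2 - occ a b \<omega> \<le> (N b \<omega> - N a \<omega>)\<^sup>2 - (N b \<omega> - N a \<omega>)"
  using occ_functional_le_increment[OF ab near_ab] AE_space
proof eventually_elim
  case (elim \<omega>)
  obtain n where n: "occ a b \<omega> = real n" using occ_Nats[OF elim(2)] by blast
  obtain q where q: "N b \<omega> - N a \<omega> = real q" using N_diff[OF elim(2) a_nonneg(2)] by blast
  have "real n \<le> real q" using elim(1)[rule_format, of "R \<omega>"] n q by (simp add: occ_def)
  then have nq: "n \<le> q" by simp
  have "(real n)\<^sup>2 - real n \<le> (real q)\<^sup>2 - real q"
  proof (cases n)
    case 0
    then show ?thesis using nat_factorial_nonneg[of q] by simp
  next
    case (Suc l)
    then have "1 \<le> real n" by simp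
    then have "real n * (real n - 1) \<le> real q * (real q - 1)"
      using nq by (intro mult_mono) auto
    then show ?thesis by (simp add: power2_eq_square algebra_simps)
  qed
  then show ?case using n q nq nat_factorial_nonneg[of n] by simp
qed

lemma occ_square_integrable: "integrable M (\<lambda>\<omega>. (occ a b \<omega>)\<^sup>2)"
proof (rule Bochner_Integration.integrable_bound[OF N_increment_square_integrable[OF a_nonneg]])
  show "AE \<omega> in M. norm ((occ a b \<omega>)\<^sup>2) \<le> norm ((N b \<omega> - N a \<omega>)\<^sup>2)"
    using occ_increment by eventually_elim (simp add: power_mono)
qed measurable

lemma occ_integrable: "integrable M (occ a b)"
  by (rule square_integrable_imp_integrable[OF occ_measurable occ_square_integrable])

lemma expectation_occ_le: "expectation (occ a b) \<le> C * (b - a)"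
proof -
  have "expectation (occ a b) \<le> expectation (\<lambda>\<omega>. N b \<omega> - N a \<omega>)"
  proof (rule integral_mono_AE[OF occ_integrable])
    show "integrable M (\<lambda>\<omega>. N b \<omega> - N a \<omega>)" using near_ab by (simp add: N_integrable)
    show "AE \<omega> in M. occ a b \<omega> \<le> N b \<omega> - N a \<omega>" using occ_increment by eventually_elim simp
  qed
  also have "\<dots> \<le> C * (b - a)" by (rule expectation_increment[OF a_nonneg(2) near_ab])
  finally show ?thesis .
qed

lemma occ_factorial_moment:
  "expectation (\<lambda>\<omega>. (occ a b \<omega>)\<^sup>2 - occ a b \<omega>) \<le> 2 * C\<^sup>2 * (b - a)\<^sup>2"
proof -
  have "expectation (\<lambda>\<omega>. (occ a b \<omega>)\<^sup>2 - occ a b \<omega>)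
      \<le> expectation (\<lambda>\<omega>. (N b \<omega> - N a \<omega>)\<^sup>2 - (N b \<omega> - N a \<omega>))"
  proof (rule integral_mono_AE)
    show "integrable M (\<lambda>\<omega>. (occ a b \<omega>)\<^sup>2 - occ a b \<omega>)"
      by (rule Bochner_Integration.integrable_diff[OF occ_square_integrable occ_integrable])
    show "integrable M (\<lambda>\<omega>. (N b \<omega> - N a \<omega>)\<^sup>2 - (N b \<omega> - N a \<omega>))"
      using near_ab N_increment_square_integrable[OF a_nonneg]
      by (intro Bochner_Integration.integrable_diff N_integrable) auto
    show "AE \<omega> in M. (occ a b \<omega>)\<^sup>2 - occ a b \<omega> \<le> (N b \<omega> - N a \<omega>)\<^sup>2 - (N b \<omega> - N a \<omega>)"
      using occ_increment by eventually_elim simp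
  qed
  also have "\<dots> \<le> 2 * C\<^sup>2 * (b - a)\<^sup>2" by (rule factorial_moment[OF a_nonneg(2) near_ab])
  finally show ?thesis .
qed

text \<open>
  The bound for a fixed censoring time is uniform in that time.
\<close>

lemma residual_mean:
  assumes D: "\<And>s. s \<in> {a..b} \<Longrightarrow> \<bar>\<nu> s - c\<bar> \<le> D"
  shows "\<bar>expectation (\<lambda>\<omega>. occ a b \<omega> - c * expo a b \<omega>)\<bar> \<le> D * (b - a)"
proof -
  have "\<bar>expectation (\<lambda>\<omega>. (\<lambda>w. occ_functional j k a b w - c * exposure_functional j a b w) (path_of Z \<omega>, R \<omega>))\<bar> \<le> D * (b - a)"
  proof (rule abs_expectation_indep_le[OF indep])
    show "(\<lambda>w. occ_functional j k a b w - c * exposure_functional j a b w) \<in> borel_measurable (path_space \<Otimes>\<^sub>M borel)"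
      using a_nonneg occ_functional_measurable[of j k a b] exposure_functional_measurable[of a b j] by simp
    show "integrable M (\<lambda>\<omega>. occ_functional j k a b (path_of Z \<omega>, R \<omega>) - c * exposure_functional j a b (path_of Z \<omega>, R \<omega>))"
      using occ_integrable expo_integrable unfolding occ_def[abs_def] expo_def[abs_def] by simp
    show "\<bar>expectation (\<lambda>\<omega>. occ_functional j k a b (path_of Z \<omega>, r) - c * exposure_functional j a b (path_of Z \<omega>, r))\<bar> \<le> D * (b - a)" for r
      by (rule mean_bound_fixed_horizon[OF ab near_ab D])
  qed
  then show ?thesis by (simp add: occ_def expo_def)
qed

text \<open>
  The exposure is a limit of bounded Riemann sums whose expectations are Riemann sums of the censored
  occupation probability.
\<close>

lemma expo_mean:
  assumes p: "\<And>s. s \<in> {a..b} \<Longrightarrow> \<bar>censored_occupation M Z R j s - q\<bar> \<le> \<epsilon>"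
  shows "\<bar>expectation (expo a b) - q * (b - a)\<bar> \<le> \<epsilon> * (b - a)"
proof -
  define v where "v n p = a + real p * (b - a) / real n" for n p
  let ?G = "\<lambda>n \<omega>. grid_exposure j a b n (path_of Z \<omega>, R \<omega>)"
  have lim: "(\<lambda>n. ?G n \<omega>) \<longlonglongrightarrow> expo a b \<omega>" if w: "\<omega> \<in> space M" for \<omega>
    unfolding expo_def exposure_functional_eq[OF w a_nonneg(1) ab] grid_exposure_path_of[OF a_nonneg]
    by (rule grid_exposure_tendsto(2)[OF Z_path[OF w] a_nonneg(1) ab])
  have vin: "v n p \<in> {a..b}" if "p \<le> n" "n > 0" for n p
  proof -
    have "real p * (b - a) \<le> real n * (b - a)" using that ab by (intro mult_right_mono) auto
    then have "real p * (b - a) / real n \<le> b - a" using that by (simp add: pos_divide_le_eq mult.commute)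
    then show ?thesis using that ab by (simp add: v_def)
  qed
  have Gm: "?G n \<in> borel_measurable M" for n
    by (rule measurable_compose[OF data_measurable grid_exposure_measurable[OF a_nonneg]])
  have EG: "\<bar>expectation (?G n) - q * (b - a)\<bar> \<le> \<epsilon> * (b - a)" if n: "n > 0" for n
  proof -
    define I where "I p \<omega> = (of_bool (Z (v n (Suc p)) \<omega> = j \<and> v n (Suc p) \<le> R \<omega>) :: real)" for p \<omega>
    have v0: "0 \<le> v n p" for p using a_nonneg by (simp add: v_def)
    have [measurable]: "Z (v n p) \<in> measurable M (count_space UNIV)" for p
      by (rule Z_measurable[OF v0])
    have Im: "I p \<in> borel_measurable M" for p unfolding I_def by measurable
    have Ii: "integrable M (I p)" for p
      by (rule integrable_const_bound[of _ 1]) (use Im in \<open>auto simp: I_def\<close>)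
    have EI: "expectation (I p) = censored_occupation M Z R j (v n (Suc p))" for p
    proof -
      have "expectation (I p) = expectation (indicator {\<omega> \<in> space M. Z (v n (Suc p)) \<omega> = j \<and> v n (Suc p) \<le> R \<omega>})"
        by (intro Bochner_Integration.integral_cong) (auto simp: I_def indicator_def)
      then show ?thesis unfolding censored_occupation_def by simp
    qed
    have "?G n = (\<lambda>\<omega>. \<Sum>p<n. (b - a) / real n * I p \<omega>)"
      unfolding grid_exposure_path_of[OF a_nonneg] unfolding grid_exposure_def prod.case I_def v_def ..
    then have "expectation (?G n) = (\<Sum>p<n. (b - a) / real n * censored_occupation M Z R j (v n (Suc p)))"
      using Ii by (simp add: EI)
    moreover have "q * (b - a) = (\<Sum>p<n. (b - a) / real n * q)" using n by simp
    ultimately have "\<bar>expectation (?G n) - q * (b - a)\<bar>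
        = \<bar>\<Sum>p<n. (b - a) / real n * (censored_occupation M Z R j (v n (Suc p)) - q)\<bar>"
      by (simp add: sum_subtractf right_diff_distrib)
    also have "\<dots> \<le> (\<Sum>p<n. \<bar>(b - a) / real n * (censored_occupation M Z R j (v n (Suc p)) - q)\<bar>)"
      by (rule sum_abs)
    also have "\<dots> \<le> (\<Sum>p<n. (b - a) / real n * \<epsilon>)"
    proof (rule sum_mono)
      fix p assume "p \<in> {..<n}"
      then have "v n (Suc p) \<in> {a..b}" using n by (intro vin) auto
      then show "\<bar>(b - a) / real n * (censored_occupation M Z R j (v n (Suc p)) - q)\<bar> \<le> (b - a) / real n * \<epsilon>"
        unfolding abs_mult using p[of "v n (Suc p)"] ab by (intro mult_mono) auto
    qed
    also have "\<dots> = \<epsilon> * (b - a)" using n by simp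
    finally show ?thesis .
  qed
  have "(\<lambda>n. expectation (?G n)) \<longlonglongrightarrow> expectation (expo a b)"
  proof (rule integral_dominated_convergence[where w = "\<lambda>_. b - a"])
    show "expo a b \<in> borel_measurable M" using a_nonneg by simp
    show "?G n \<in> borel_measurable M" for n by (rule Gm)
    show "integrable M (\<lambda>_. b - a)" by simp
    show "AE \<omega> in M. (\<lambda>n. ?G n \<omega>) \<longlonglongrightarrow> expo a b \<omega>" using lim by (intro AE_I2) auto
    show "AE \<omega> in M. norm (?G n \<omega>) \<le> b - a" for n
    proof (rule AE_I2)
      fix \<omega>
      let ?c = "\<lambda>p. of_bool (path_of Z \<omega> (v n (Suc p)) = j \<and> v n (Suc p) \<le> R \<omega>) :: real"
      have "?G n \<omega> = (\<Sum>p<n. (b - a) / real n * ?c p)"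
        unfolding grid_exposure_def v_def by simp
      moreover have "0 \<le> (\<Sum>p<n. (b - a) / real n * ?c p)" using ab by (intro sum_nonneg) auto
      moreover have "(\<Sum>p<n. (b - a) / real n * ?c p) \<le> (\<Sum>p<n. (b - a) / real n * 1)"
        using ab by (intro sum_mono mult_left_mono) auto
      moreover have "(\<Sum>p<n. (b - a) / real n * 1) \<le> b - a" using ab by (cases "n = 0") auto
      ultimately show "norm (?G n \<omega>) \<le> b - a" by simp
    qed
  qed
  then have "(\<lambda>n. \<bar>expectation (?G n) - q * (b - a)\<bar>) \<longlonglongrightarrow> \<bar>expectation (expo a b) - q * (b - a)\<bar>"
    by (intro tendsto_intros)
  then show ?thesis
    by (rule LIMSEQ_le_const2) (use EG in \<open>auto intro!: exI[of _ 1]\<close>)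
qed

lemma residual_square_integrable: "integrable M (\<lambda>\<omega>. (occ a b \<omega> - c * expo a b \<omega>)\<^sup>2)"
proof (rule Bochner_Integration.integrable_bound)
  show "integrable M (\<lambda>\<omega>. 2 * (occ a b \<omega>)\<^sup>2 + 2 * (c * (b - a))\<^sup>2)" using occ_square_integrable by simp
  show "(\<lambda>\<omega>. (occ a b \<omega> - c * expo a b \<omega>)\<^sup>2) \<in> borel_measurable M" using a_nonneg by simp
  show "AE \<omega> in M. norm ((occ a b \<omega> - c * expo a b \<omega>)\<^sup>2) \<le> norm (2 * (occ a b \<omega>)\<^sup>2 + 2 * (c * (b - a))\<^sup>2)"
  proof (rule AE_I2)
    fix \<omega> assume w: "\<omega> \<in> space M"
    have "(c * expo a b \<omega>)\<^sup>2 \<le> (c * (b - a))\<^sup>2"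
      unfolding power_mult_distrib using expo_bounds[OF w] by (intro mult_left_mono power_mono) auto
    moreover have "(x - y)\<^sup>2 \<le> 2 * x\<^sup>2 + 2 * y\<^sup>2" for x y :: real
      using zero_le_power2[of "x + y"] by (simp add: power2_eq_square algebra_simps)
    ultimately show "norm ((occ a b \<omega> - c * expo a b \<omega>)\<^sup>2) \<le> norm (2 * (occ a b \<omega>)\<^sup>2 + 2 * (c * (b - a))\<^sup>2)"
      by (smt (verit) real_norm_def zero_le_power2)
  qed
qed

text \<open>
  Expand the square of the residual.  The square of the occurrence differs from the
  occurrence by a factorial moment, and the mixed and last terms are small because the exposure is
  at most \<open>b - a\<close>.  The mean occurrence is \<open>c\<close> times the mean exposure, up to the bias.
\<close>

lemma residual_variance:
  assumes c: "0 \<le> c"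
    and D: "\<And>s. s \<in> {a..b} \<Longrightarrow> \<bar>\<nu> s - c\<bar> \<le> D"
    and p: "\<And>s. s \<in> {a..b} \<Longrightarrow> \<bar>censored_occupation M Z R j s - q\<bar> \<le> \<epsilon>"
  shows "\<bar>expectation (\<lambda>\<omega>. (occ a b \<omega> - c * expo a b \<omega>)\<^sup>2) - c * q * (b - a)\<bar>
      \<le> (2 * C\<^sup>2 + 2 * c * C + c\<^sup>2) * (b - a)\<^sup>2 + (D + c * \<epsilon>) * (b - a)"
proof -
  let ?X = "\<lambda>\<omega>. occ a b \<omega> - c * expo a b \<omega>"
  let ?B = "\<lambda>\<omega>. ((occ a b \<omega>)\<^sup>2 - occ a b \<omega>) + 2 * c * (b - a) * occ a b \<omega> + (c * (b - a))\<^sup>2"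
  have Bi: "integrable M ?B"
    using occ_square_integrable occ_integrable by simp
  have Xi: "integrable M (\<lambda>\<omega>. (?X \<omega>)\<^sup>2 - occ a b \<omega>)"
    by (rule Bochner_Integration.integrable_diff[OF residual_square_integrable occ_integrable])
  have "\<bar>expectation (\<lambda>\<omega>. (?X \<omega>)\<^sup>2 - occ a b \<omega>)\<bar> \<le> expectation (\<lambda>\<omega>. \<bar>(?X \<omega>)\<^sup>2 - occ a b \<omega>\<bar>)"
    using integral_norm_bound[of M "\<lambda>\<omega>. (?X \<omega>)\<^sup>2 - occ a b \<omega>"] by simp
  also have "\<dots> \<le> expectation ?B"
  proof (rule integral_mono_AE[OF _ Bi])
    show "integrable M (\<lambda>\<omega>. \<bar>(?X \<omega>)\<^sup>2 - occ a b \<omega>\<bar>)" using Xi by (rule integrable_abs)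
    show "AE \<omega> in M. \<bar>(?X \<omega>)\<^sup>2 - occ a b \<omega>\<bar> \<le> ?B \<omega>"
      using occ_increment AE_space
    proof eventually_elim
      case (elim \<omega>)
      define x where "x = occ a b \<omega>"
      define y where "y = c * expo a b \<omega>"
      have y: "0 \<le> y" "y \<le> c * (b - a)"
        using expo_bounds[OF elim(2)] c by (auto simp: y_def intro: mult_left_mono)
      have x: "0 \<le> x" "0 \<le> x\<^sup>2 - x" using elim by (auto simp: x_def)
      have 1: "0 \<le> x * y" "x * y \<le> x * (c * (b - a))" using x y by (auto intro: mult_left_mono)
      have 2: "0 \<le> y\<^sup>2" "y\<^sup>2 \<le> (c * (b - a))\<^sup>2" using y by (auto intro: power_mono)
      have "(x - y)\<^sup>2 - x = (x\<^sup>2 - x) - 2 * (x * y) + y\<^sup>2" by (simp add: power2_eq_square algebra_simps)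
      then have "\<bar>(x - y)\<^sup>2 - x\<bar> \<le> (x\<^sup>2 - x) + 2 * (x * (c * (b - a))) + (c * (b - a))\<^sup>2"
        using 1 2 x by linarith
      also have "2 * (x * (c * (b - a))) = 2 * c * (b - a) * x" by simp
      finally show ?case unfolding x_def y_def .
    qed
  qed
  also have "expectation ?B = expectation (\<lambda>\<omega>. (occ a b \<omega>)\<^sup>2 - occ a b \<omega>)
      + 2 * c * (b - a) * expectation (occ a b) + (c * (b - a))\<^sup>2"
    using occ_square_integrable occ_integrable by (simp add: prob_space)
  also have "\<dots> \<le> 2 * C\<^sup>2 * (b - a)\<^sup>2 + 2 * c * (b - a) * (C * (b - a)) + (c * (b - a))\<^sup>2"
    using occ_factorial_moment expectation_occ_le c a_nonneg
    by (intro add_mono mult_left_mono) auto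
  also have "\<dots> = (2 * C\<^sup>2 + 2 * c * C + c\<^sup>2) * (b - a)\<^sup>2" by (simp add: power2_eq_square algebra_simps)
  finally have 1: "\<bar>expectation (\<lambda>\<omega>. (?X \<omega>)\<^sup>2) - expectation (occ a b)\<bar> \<le> (2 * C\<^sup>2 + 2 * c * C + c\<^sup>2) * (b - a)\<^sup>2"
    using residual_square_integrable occ_integrable by simp
  have 2: "\<bar>expectation (occ a b) - c * expectation (expo a b)\<bar> \<le> D * (b - a)"
    using residual_mean[OF D] occ_integrable expo_integrable by simp
  have "\<bar>c * expectation (expo a b) - c * (q * (b - a))\<bar> = c * \<bar>expectation (expo a b) - q * (b - a)\<bar>"
    using c by (simp add: abs_mult right_diff_distrib[symmetric])
  also have "\<dots> \<le> c * (\<epsilon> * (b - a))" using expo_mean[OF p] c by (intro mult_left_mono) auto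
  finally have 3: "\<bar>c * expectation (expo a b) - c * (q * (b - a))\<bar> \<le> c * (\<epsilon> * (b - a))" .
  show ?thesis using 1 2 3 by (simp add: algebra_simps)
qed

text \<open>
  With at most one occurrence the residual lies in \<open>[-1, 1]\<close>, and its third power is dominated
  by the second.  With \<open>x \<ge> 2\<close> occurrences it is at most \<open>x\<close>, and \<open>x\<^sup>2 \<le> 2 (x\<^sup>2 - x)\<close> brings in
  the factorial moment.
\<close>

lemma residual_lindeberg:
  assumes c: "0 \<le> c" "c * (b - a) \<le> 1"
  shows "expectation (\<lambda>\<omega>. min (6 * (occ a b \<omega> - c * expo a b \<omega>)\<^sup>2) (\<bar>\<theta>\<bar> * \<bar>occ a b \<omega> - c * expo a b \<omega>\<bar> ^ 3))
      \<le> \<bar>\<theta>\<bar> * expectation (\<lambda>\<omega>. (occ a b \<omega> - c * expo a b \<omega>)\<^sup>2) + 24 * C\<^sup>2 * (b - a)\<^sup>2"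
proof -
  let ?X = "\<lambda>\<omega>. occ a b \<omega> - c * expo a b \<omega>"
  let ?m = "\<lambda>\<omega>. min (6 * (?X \<omega>)\<^sup>2) (\<bar>\<theta>\<bar> * \<bar>?X \<omega>\<bar> ^ 3)"
  have Xm: "?X \<in> borel_measurable M" using a_nonneg by simp
  have Xi: "integrable M (\<lambda>\<omega>. (?X \<omega>)\<^sup>2)" by (rule residual_square_integrable)
  have Bi: "integrable M (\<lambda>\<omega>. \<bar>\<theta>\<bar> * (?X \<omega>)\<^sup>2 + 12 * ((occ a b \<omega>)\<^sup>2 - occ a b \<omega>))"
    using Xi occ_square_integrable occ_integrable by simp
  have "expectation ?m \<le> expectation (\<lambda>\<omega>. \<bar>\<theta>\<bar> * (?X \<omega>)\<^sup>2 + 12 * ((occ a b \<omega>)\<^sup>2 - occ a b \<omega>))"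
  proof (rule integral_mono_AE[OF _ Bi])
    show "integrable M ?m"
    proof (rule Bochner_Integration.integrable_bound)
      show "integrable M (\<lambda>\<omega>. 6 * (?X \<omega>)\<^sup>2)" using Xi by simp
      show "?m \<in> borel_measurable M" using Xm by simp
    qed simp
    show "AE \<omega> in M. ?m \<omega> \<le> \<bar>\<theta>\<bar> * (?X \<omega>)\<^sup>2 + 12 * ((occ a b \<omega>)\<^sup>2 - occ a b \<omega>)"
    proof (rule AE_I2)
      fix \<omega> assume w: "\<omega> \<in> space M"
      obtain n where n: "occ a b \<omega> = real n" using occ_Nats[OF w] by blast
      define x where "x = ?X \<omega>"
      have "0 \<le> c * expo a b \<omega>" using c expo_bounds[OF w] by simp
      moreover have "c * expo a b \<omega> \<le> c * (b - a)" using c expo_bounds[OF w] by (intro mult_left_mono) auto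
      ultimately have x: "-1 \<le> x" "x \<le> real n" using c(2) n by (auto simp: x_def)
      have th: "0 \<le> \<bar>\<theta>\<bar> * x\<^sup>2" by simp
      have "min (6 * x\<^sup>2) (\<bar>\<theta>\<bar> * \<bar>x\<bar> ^ 3) \<le> \<bar>\<theta>\<bar> * x\<^sup>2 + 12 * ((real n)\<^sup>2 - real n)"
      proof (cases "n \<le> 1")
        case True
        then have "\<bar>x\<bar> \<le> 1" using x by linarith
        then have "\<bar>x\<bar> ^ 3 \<le> x\<^sup>2" using power_decreasing[of 2 3 "\<bar>x\<bar>"] by simp
        then have "\<bar>\<theta>\<bar> * \<bar>x\<bar> ^ 3 \<le> \<bar>\<theta>\<bar> * x\<^sup>2" by (intro mult_left_mono) auto
        then have "\<bar>\<theta>\<bar> * \<bar>x\<bar> ^ 3 \<le> \<bar>\<theta>\<bar> * x\<^sup>2 + 12 * ((real n)\<^sup>2 - real n)"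
          using nat_factorial_nonneg[of n] by (intro add_increasing2) auto
        then show ?thesis by (rule min.coboundedI2)
      next
        case False
        then have n2: "2 \<le> real n" by simp
        then have "\<bar>x\<bar> \<le> real n" using x by linarith
        then have "x\<^sup>2 \<le> (real n)\<^sup>2" by (metis abs_ge_zero power2_abs power_mono)
        moreover have "2 * real n \<le> real n * real n" using n2 by (intro mult_right_mono) auto
        ultimately have "6 * x\<^sup>2 \<le> 12 * ((real n)\<^sup>2 - real n)" by (simp add: power2_eq_square)
        then have "6 * x\<^sup>2 \<le> \<bar>\<theta>\<bar> * x\<^sup>2 + 12 * ((real n)\<^sup>2 - real n)" using th by linarith
        then show ?thesis by (rule min.coboundedI1)
      qed
      then show "?m \<omega> \<le> \<bar>\<theta>\<bar> * (?X \<omega>)\<^sup>2 + 12 * ((occ a b \<omega>)\<^sup>2 - occ a b \<omega>)"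
        unfolding x_def n .
    qed
  qed
  also have "\<dots> = \<bar>\<theta>\<bar> * expectation (\<lambda>\<omega>. (?X \<omega>)\<^sup>2) + 12 * expectation (\<lambda>\<omega>. (occ a b \<omega>)\<^sup>2 - occ a b \<omega>)"
    using Xi occ_square_integrable occ_integrable by simp
  also have "\<dots> \<le> \<bar>\<theta>\<bar> * expectation (\<lambda>\<omega>. (?X \<omega>)\<^sup>2) + 12 * (2 * C\<^sup>2 * (b - a)\<^sup>2)"
    using occ_factorial_moment by (intro add_left_mono mult_left_mono) auto
  finally show ?thesis by simp
qed

end
end

section \<open>Characteristic functions of row sums\<close>

text \<open>
  Compare with the powers of \<open>exp (z / n)\<close>.  Both bases lie in the unit disc, where the \<open>n\<close>-th
  powers differ by at most \<open>n\<close> times the difference of the bases.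
\<close>

lemma power_tendsto_exp:
  fixes w :: "nat \<Rightarrow> complex"
  assumes lim: "(\<lambda>n. of_nat n * (w n - 1)) \<longlonglongrightarrow> z"
    and w: "\<And>n. norm (w n) \<le> 1" and z: "Re z \<le> 0"
  shows "(\<lambda>n. w n ^ n) \<longlonglongrightarrow> exp z"
proof -
  define e where "e n = exp (z / of_nat n)" for n
  have e1: "norm (e n) \<le> 1" for n
    using z by (simp add: e_def Re_divide_of_nat divide_nonpos_nonneg)
  have en: "e n ^ n = exp z" if "n > 0" for n
    using that by (simp add: e_def exp_of_nat_mult[symmetric])
  have elim: "(\<lambda>n. of_nat n * (e n - 1)) \<longlonglongrightarrow> z"
  proof (cases "z = 0")
    case True
    then show ?thesis by (simp add: e_def)
  next
    case False
    have "((\<lambda>h. (exp h - 1) / h) \<longlongrightarrow> 1) (at (0::complex))"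
      using DERIV_exp[of "0::complex"] by (simp add: DERIV_def)
    moreover have "filterlim (\<lambda>n. z / of_nat n) (at 0) sequentially"
    proof (rule filterlim_atI)
      show "(\<lambda>n. z / of_nat n) \<longlonglongrightarrow> 0" by (rule lim_const_over_n)
      show "\<forall>\<^sub>F n in sequentially. z / of_nat n \<noteq> 0"
        using eventually_gt_at_top[of 0] by eventually_elim (use False in simp)
    qed
    ultimately have "(\<lambda>n. (exp (z / of_nat n) - 1) / (z / of_nat n)) \<longlonglongrightarrow> 1"
      by (rule filterlim_compose)
    then have "(\<lambda>n. z * ((exp (z / of_nat n) - 1) / (z / of_nat n))) \<longlonglongrightarrow> z * 1"
      by (intro tendsto_intros)
    then show ?thesis using False by (simp add: e_def mult.commute)
  qed
  have "(\<lambda>n. of_nat n * (w n - 1) - of_nat n * (e n - 1)) \<longlonglongrightarrow> z - z"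
    using lim elim by (intro tendsto_intros)
  then have d: "(\<lambda>n. norm (of_nat n * (w n - e n))) \<longlonglongrightarrow> 0"
    by (simp add: algebra_simps tendsto_norm_zero_iff)
  have "(\<lambda>n. w n ^ n - e n ^ n) \<longlonglongrightarrow> 0"
  proof (rule Lim_null_comparison[OF _ d])
    show "\<forall>\<^sub>F n in sequentially. norm (w n ^ n - e n ^ n) \<le> norm (of_nat n * (w n - e n))"
      using norm_power_diff[OF w e1] by (intro always_eventually) (simp add: norm_mult)
  qed
  moreover have "(\<lambda>n. e n ^ n) \<longlonglongrightarrow> exp z"
    by (rule tendsto_eventually) (use eventually_gt_at_top[of 0] in \<open>eventually_elim, simp add: en\<close>)
  ultimately have "(\<lambda>n. (w n ^ n - e n ^ n) + e n ^ n) \<longlonglongrightarrow> 0 + exp z"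
    by (intro tendsto_intros)
  then show ?thesis by simp
qed

lemma (in prob_space) char_second_order:
  assumes X [measurable]: "X \<in> borel_measurable M" and X2: "integrable M (\<lambda>\<omega>. (X \<omega>)\<^sup>2)"
  shows "norm (char (distr M borel X) \<theta> - (1 + \<i> * \<theta> * expectation X - \<theta>\<^sup>2 / 2 * expectation (\<lambda>\<omega>. (X \<omega>)\<^sup>2)))
     \<le> \<theta>\<^sup>2 / 6 * expectation (\<lambda>\<omega>. min (6 * (X \<omega>)\<^sup>2) (\<bar>\<theta>\<bar> * \<bar>X \<omega>\<bar> ^ 3))"
proof -
  interpret D: real_distribution "distr M borel X" by (rule real_distribution_distr) simp
  have X1: "integrable M X" by (rule square_integrable_imp_integrable[OF X X2])
  have i: "integrable (distr M borel X) (\<lambda>x. x ^ k)" if "k \<le> 2" for k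
  proof -
    have "k = 0 \<or> k = 1 \<or> k = 2" using that by auto
    then show ?thesis using X1 X2 by (auto simp: integrable_distr_eq)
  qed
  have "(\<Sum>k\<le>2. ((\<i> * \<theta>)^k / fact k) * complex_of_real (D.expectation (\<lambda>x. x^k)))
      = 1 + \<i> * \<theta> * expectation X - \<theta>\<^sup>2 / 2 * expectation (\<lambda>\<omega>. (X \<omega>)\<^sup>2)"
    by (simp add: numeral_2_eq_2 integral_distr power2_eq_square prob_space)
      (simp add: complex_eq_iff)
  moreover have "D.expectation (\<lambda>x. min (2 * \<bar>x\<bar>^2 * Suc 2) (\<bar>\<theta>\<bar> * \<bar>x\<bar>^Suc 2))
      = expectation (\<lambda>\<omega>. min (6 * (X \<omega>)\<^sup>2) (\<bar>\<theta>\<bar> * \<bar>X \<omega>\<bar> ^ 3))"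
    by (simp add: integral_distr numeral_3_eq_3)
  moreover have "\<bar>\<theta>\<bar>^2 / fact (Suc 2) = \<theta>\<^sup>2 / 6" by (simp add: eval_nat_numeral)
  moreover have "fact 3 = (6 :: real)" by (simp add: eval_nat_numeral)
  ultimately show ?thesis using D.char_approx2[of 2 \<theta>, OF i] by simp
qed

text \<open>
  A central limit theorem for the sum of \<open>n\<close> independent copies of \<open>X n\<close>, divided by
  \<open>sqrt (n \<delta>)\<close>.  For the characteristic function \<open>\<phi>\<close> of \<open>X n\<close> at the rescaled point,
  \<open>n (\<phi> - 1)\<close> tends to \<open>- u\<^sup>2 s / 2\<close>: the first-order term vanishes by the assumption on the mean,
  and the remainder of the second-order expansion by the Lindeberg-type bound.
\<close>

lemma (in prob_space) row_char_tendsto: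
  fixes X :: "nat \<Rightarrow> 'a \<Rightarrow> real" and \<delta> :: "nat \<Rightarrow> real"
  assumes X: "\<And>n. X n \<in> borel_measurable M" and X2: "\<And>n. integrable M (\<lambda>\<omega>. (X n \<omega>)\<^sup>2)"
    and \<delta>: "\<And>n. 0 < \<delta> n" and n\<delta>: "filterlim (\<lambda>n. real n * \<delta> n) at_top sequentially"
    and mean: "(\<lambda>n. sqrt (real n / \<delta> n) * expectation (X n)) \<longlonglongrightarrow> 0"
    and var: "(\<lambda>n. expectation (\<lambda>\<omega>. (X n \<omega>)\<^sup>2) / \<delta> n) \<longlonglongrightarrow> s"
    and lindeberg: "\<And>\<theta>. \<forall>\<^sub>F n in sequentially. expectation (\<lambda>\<omega>. min (6 * (X n \<omega>)\<^sup>2) (\<bar>\<theta> n\<bar> * \<bar>X n \<omega>\<bar> ^ 3))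
        \<le> \<bar>\<theta> n\<bar> * expectation (\<lambda>\<omega>. (X n \<omega>)\<^sup>2) + \<kappa> n"
    and \<kappa>: "(\<lambda>n. \<kappa> n / \<delta> n) \<longlonglongrightarrow> 0"
    and s: "0 \<le> s"
  shows "(\<lambda>n. char (distr M borel (X n)) (u / sqrt (real n * \<delta> n)) ^ n) \<longlonglongrightarrow> exp (- (u\<^sup>2 * s / 2))"
proof -
  define \<theta> where "\<theta> n = u / sqrt (real n * \<delta> n)" for n
  define m1 where "m1 n = expectation (X n)" for n
  define m2 where "m2 n = expectation (\<lambda>\<omega>. (X n \<omega>)\<^sup>2)" for n
  define \<phi> where "\<phi> n = char (distr M borel (X n)) (\<theta> n)" for n
  have \<theta>2: "real n * (\<theta> n)\<^sup>2 = u\<^sup>2 / \<delta> n" if "n > 0" for n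
    using that \<delta>[of n] by (simp add: \<theta>_def power_divide)
  have \<theta>1: "real n * \<theta> n = u * sqrt (real n / \<delta> n)" if "n > 0" for n
    using that \<delta>[of n] by (simp add: \<theta>_def real_sqrt_mult real_sqrt_divide real_div_sqrt field_simps)
  have \<theta>0: "\<theta> \<longlonglongrightarrow> 0"
  proof -
    have "filterlim (\<lambda>n. sqrt (real n * \<delta> n)) at_top sequentially"
      by (rule filterlim_compose[OF sqrt_at_top n\<delta>])
    then show ?thesis unfolding \<theta>_def
      by (intro tendsto_divide_0[OF tendsto_const] filterlim_at_top_imp_at_infinity)
  qed
  define r where "r n = of_nat n * (\<phi> n - 1) - (\<i> * (u * (sqrt (real n / \<delta> n) * m1 n)) - u\<^sup>2 / 2 * (m2 n / \<delta> n))" for n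
  have "r \<longlonglongrightarrow> 0"
  proof (rule Lim_null_comparison)
    have "(\<lambda>n. u\<^sup>2 / 6 * (\<bar>\<theta> n\<bar> * (m2 n / \<delta> n) + \<kappa> n / \<delta> n)) \<longlonglongrightarrow> u\<^sup>2 / 6 * (\<bar>0\<bar> * s + 0)"
      by (intro tendsto_mult tendsto_add tendsto_const tendsto_rabs \<theta>0 var[folded m2_def] \<kappa>)
    then show "(\<lambda>n. u\<^sup>2 / 6 * (\<bar>\<theta> n\<bar> * (m2 n / \<delta> n) + \<kappa> n / \<delta> n)) \<longlonglongrightarrow> 0" by simp
    show "\<forall>\<^sub>F n in sequentially. norm (r n) \<le> u\<^sup>2 / 6 * (\<bar>\<theta> n\<bar> * (m2 n / \<delta> n) + \<kappa> n / \<delta> n)"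
      using lindeberg[of \<theta>] eventually_gt_at_top[of 0]
    proof eventually_elim
      case (elim n)
      define d where "d = \<phi> n - (1 + \<i> * \<theta> n * m1 n - (\<theta> n)\<^sup>2 / 2 * m2 n)"
      have "r n = of_nat n * d"
      proof -
        have "\<i> * (u * (sqrt (real n / \<delta> n) * m1 n)) = of_nat n * (\<i> * \<theta> n * m1 n)"
          using arg_cong[OF \<theta>1[OF elim(2)], of complex_of_real] by (simp add: algebra_simps)
        moreover have "u\<^sup>2 / 2 * (m2 n / \<delta> n) = real n * ((\<theta> n)\<^sup>2 / 2 * m2 n)"
          using \<theta>2[OF elim(2)] \<delta>[of n] by (simp add: field_simps)
        ultimately show ?thesis unfolding r_def d_def by (simp add: algebra_simps) metis
      qed
      moreover have "norm d \<le> (\<theta> n)\<^sup>2 / 6 * (\<bar>\<theta> n\<bar> * m2 n + \<kappa> n)"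
      proof -
        have "norm d \<le> (\<theta> n)\<^sup>2 / 6 * expectation (\<lambda>\<omega>. min (6 * (X n \<omega>)\<^sup>2) (\<bar>\<theta> n\<bar> * \<bar>X n \<omega>\<bar> ^ 3))"
          unfolding d_def \<phi>_def m1_def m2_def by (rule char_second_order[OF X X2])
        also have "\<dots> \<le> (\<theta> n)\<^sup>2 / 6 * (\<bar>\<theta> n\<bar> * m2 n + \<kappa> n)"
          using elim(1) unfolding m2_def by (intro mult_left_mono) auto
        finally show ?thesis .
      qed
      ultimately have "norm (r n) = real n * norm d" "norm d \<le> (\<theta> n)\<^sup>2 / 6 * (\<bar>\<theta> n\<bar> * m2 n + \<kappa> n)"
        by (simp_all only: norm_mult norm_of_nat)
      then have "norm (r n) \<le> real n * ((\<theta> n)\<^sup>2 / 6 * (\<bar>\<theta> n\<bar> * m2 n + \<kappa> n))"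
        by (simp only: mult_left_mono of_nat_0_le_iff)
      also have "\<dots> = (real n * (\<theta> n)\<^sup>2) / 6 * (\<bar>\<theta> n\<bar> * m2 n + \<kappa> n)" by simp
      also have "\<dots> = u\<^sup>2 / 6 * (\<bar>\<theta> n\<bar> * (m2 n / \<delta> n) + \<kappa> n / \<delta> n)"
        unfolding \<theta>2[OF elim(2)] using \<delta>[of n] by (simp add: field_simps)
      finally show ?case .
    qed
  qed
  moreover have "(\<lambda>n. \<i> * (u * (sqrt (real n / \<delta> n) * m1 n)) - u\<^sup>2 / 2 * (m2 n / \<delta> n))
      \<longlonglongrightarrow> \<i> * complex_of_real (u * 0) - complex_of_real (u\<^sup>2 / 2 * s)"
    using mean var unfolding m1_def m2_def by (intro tendsto_intros)
  ultimately have "(\<lambda>n. r n + (\<i> * (u * (sqrt (real n / \<delta> n) * m1 n)) - u\<^sup>2 / 2 * (m2 n / \<delta> n)))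
      \<longlonglongrightarrow> 0 + (\<i> * complex_of_real (u * 0) - complex_of_real (u\<^sup>2 / 2 * s))"
    by (rule tendsto_add)
  then have "(\<lambda>n. of_nat n * (\<phi> n - 1)) \<longlonglongrightarrow> complex_of_real (- (u\<^sup>2 * s / 2))"
    by (simp add: r_def)
  then have "(\<lambda>n. \<phi> n ^ n) \<longlonglongrightarrow> exp (complex_of_real (- (u\<^sup>2 * s / 2)))"
  proof (rule power_tendsto_exp)
    show "norm (\<phi> n) \<le> 1" for n
      unfolding \<phi>_def by (rule real_distribution.cmod_char_le_1[OF real_distribution_distr[OF X]])
  qed (use s in simp)
  then show ?thesis unfolding \<phi>_def \<theta>_def by (simp only: exp_of_real)
qed

text \<open>
  The mean of a product of two different variables is \<open>m\<^sup>2\<close>, and that of a square is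
  \<open>v \<le> v + m\<^sup>2\<close>.
\<close>

lemma (in prob_space) second_moment_sum_le:
  fixes Y :: "nat \<Rightarrow> 'a \<Rightarrow> real" and m v :: real
  assumes ind: "indep_vars (\<lambda>_. borel) Y I" and fin: "finite I"
    and Y2: "\<And>i. i \<in> I \<Longrightarrow> integrable M (\<lambda>\<omega>. (Y i \<omega>)\<^sup>2)"
    and m: "\<And>i. i \<in> I \<Longrightarrow> expectation (Y i) = m"
    and v: "\<And>i. i \<in> I \<Longrightarrow> expectation (\<lambda>\<omega>. (Y i \<omega>)\<^sup>2) = v"
  shows "integrable M (\<lambda>\<omega>. (\<Sum>i\<in>I. Y i \<omega>)\<^sup>2)"
    and "expectation (\<lambda>\<omega>. (\<Sum>i\<in>I. Y i \<omega>)\<^sup>2) \<le> card I * v + (card I * m)\<^sup>2"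
proof -
  have Ym: "Y i \<in> borel_measurable M" if "i \<in> I" for i using ind that by (auto simp: indep_vars_def)
  have Yi: "integrable M (Y i)" if "i \<in> I" for i
    by (rule square_integrable_imp_integrable[OF Ym[OF that] Y2[OF that]])
  have P: "integrable M (\<lambda>\<omega>. Y i \<omega> * Y l \<omega>) \<and> expectation (\<lambda>\<omega>. Y i \<omega> * Y l \<omega>) \<le> of_bool (i = l) * v + m\<^sup>2"
    if il: "i \<in> I" "l \<in> I" for i l
  proof (cases "i = l")
    case True
    then show ?thesis using Y2[OF il(1)] v[OF il(1)] by (simp add: power2_eq_square)
  next
    case False
    have "indep_vars (\<lambda>_. borel) Y {i, l}" by (rule indep_vars_subset[OF ind]) (use il in auto)
    moreover have "integrable M (Y x)" if "x \<in> {i, l}" for x using Yi il that by blast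
    moreover have "finite {i, l}" by simp
    ultimately have "expectation (\<lambda>\<omega>. \<Prod>x\<in>{i, l}. Y x \<omega>) = (\<Prod>x\<in>{i, l}. expectation (Y x))"
      "integrable M (\<lambda>\<omega>. \<Prod>x\<in>{i, l}. Y x \<omega>)"
      using indep_vars_lebesgue_integral[of "{i, l}" Y] indep_vars_integrable[of "{i, l}" Y] by blast+
    then
    show ?thesis using False m[OF il(1)] m[OF il(2)]
      by (auto simp: power2_eq_square)
  qed
  have e: "(\<lambda>\<omega>. (\<Sum>i\<in>I. Y i \<omega>)\<^sup>2) = (\<lambda>\<omega>. \<Sum>i\<in>I. \<Sum>l\<in>I. Y i \<omega> * Y l \<omega>)"
    by (simp add: power2_eq_square sum_product)
  show "integrable M (\<lambda>\<omega>. (\<Sum>i\<in>I. Y i \<omega>)\<^sup>2)" unfolding e using P by auto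
  have "expectation (\<lambda>\<omega>. (\<Sum>i\<in>I. Y i \<omega>)\<^sup>2) = (\<Sum>i\<in>I. \<Sum>l\<in>I. expectation (\<lambda>\<omega>. Y i \<omega> * Y l \<omega>))"
    unfolding e using P by (subst Bochner_Integration.integral_sum; simp)
  also have "\<dots> \<le> (\<Sum>i\<in>I. \<Sum>l\<in>I. of_bool (i = l) * v + m\<^sup>2)" using P by (intro sum_mono) auto
  also have "\<dots> = (\<Sum>i\<in>I. v + card I * m\<^sup>2)"
  proof (rule sum.cong[OF refl])
    fix i assume i: "i \<in> I"
    have "(\<Sum>l\<in>I. of_bool (i = l) * v) = (\<Sum>l\<in>I. if i = l then v else 0)" by (intro sum.cong) auto
    then show "(\<Sum>l\<in>I. of_bool (i = l) * v + m\<^sup>2) = v + card I * m\<^sup>2"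
      using i fin by (simp add: sum.distrib)
  qed
  also have "\<dots> = card I * v + (card I * m)\<^sup>2" by (simp add: power2_eq_square algebra_simps)
  finally show "expectation (\<lambda>\<omega>. (\<Sum>i\<in>I. Y i \<omega>)\<^sup>2) \<le> card I * v + (card I * m)\<^sup>2" .
qed

section \<open>Ratios and the normal limit\<close>

lemma norm_iexp_diff_le: "norm (iexp x - iexp y) \<le> \<bar>x - y\<bar>"
proof -
  have "iexp x - iexp y = iexp y * (iexp (x - y) - 1)"
    by (simp add: algebra_simps exp_add[symmetric])
  then have "norm (iexp x - iexp y) = norm (iexp (x - y) - 1)" by (simp add: norm_mult)
  also have "\<dots> \<le> \<bar>x - y\<bar>" using iexp_approx1[of "x - y" 0] by simp
  finally show ?thesis .
qed

lemma (in prob_space) char_distr: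
  "X \<in> borel_measurable M \<Longrightarrow> char (distr M borel X) u = (CLINT \<omega>|M. iexp (u * X \<omega>))"
  unfolding char_def by (simp add: integral_distr)

text \<open>
  The normal law with standard deviation \<open>\<sigma>\<close> is the image of the standard one under scaling.
\<close>

lemma char_normal:
  assumes \<sigma>: "0 < \<sigma>"
  shows "real_distribution (density lborel (normal_density 0 \<sigma>))"
    and "char (density lborel (normal_density 0 \<sigma>)) u = exp (- (\<sigma> * u)\<^sup>2 / 2)"
proof -
  interpret S: real_distribution std_normal_distribution by (rule real_dist_normal_dist)
  have "distributed std_normal_distribution lborel (\<lambda>x. x) (normal_density 0 1)"
    unfolding distributed_def by (simp add: distr_id2)
  from S.normal_density_affine[OF this, of \<sigma> 0] \<sigma>
  have "distributed std_normal_distribution lborel (\<lambda>x. \<sigma> * x) (normal_density 0 \<sigma>)" by simp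
  then have "distr std_normal_distribution lborel (\<lambda>x. \<sigma> * x) = density lborel (normal_density 0 \<sigma>)"
    by (simp add: distributed_def)
  moreover have "distr std_normal_distribution lborel (\<lambda>x. \<sigma> * x) = distr std_normal_distribution borel (\<lambda>x. \<sigma> * x)"
    by (rule distr_cong) auto
  ultimately have e: "density lborel (normal_density 0 \<sigma>) = distr std_normal_distribution borel (\<lambda>x. \<sigma> * x)" by simp
  show "real_distribution (density lborel (normal_density 0 \<sigma>))"
    unfolding e by (rule S.real_distribution_distr) simp
  have "char (distr std_normal_distribution borel (\<lambda>x. \<sigma> * x)) u = char std_normal_distribution (\<sigma> * u)"
    by (subst S.char_distr) (auto simp: char_def mult_ac)
  then show "char (density lborel (normal_density 0 \<sigma>)) u = exp (- (\<sigma> * u)\<^sup>2 / 2)"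
    unfolding e by (simp add: char_std_normal_distribution)
qed

text \<open>
  A form of Slutsky's theorem.  The exponentials of \<open>u T\<close> and \<open>u S / p\<close> differ by at most 2 where \<open>D\<close>
  is far from \<open>p\<close>, an event of small probability.  Elsewhere the difference of the
  exponents is bounded by a multiple of \<open>\<bar>S\<bar> \<bar>D - p\<bar>\<close>, which is small in mean because the second
  moments of \<open>S\<close> are bounded.
\<close>

lemma (in prob_space) ratio_char_tendsto:
  fixes S D T :: "nat \<Rightarrow> 'a \<Rightarrow> real"
  assumes m: "\<And>n. S n \<in> borel_measurable M" "\<And>n. D n \<in> borel_measurable M" "\<And>n. T n \<in> borel_measurable M"
    and S2: "\<forall>\<^sub>F n in sequentially. integrable M (\<lambda>\<omega>. (S n \<omega>)\<^sup>2) \<and> expectation (\<lambda>\<omega>. (S n \<omega>)\<^sup>2) \<le> K"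
    and D2: "\<forall>\<^sub>F n in sequentially. integrable M (\<lambda>\<omega>. (D n \<omega> - p)\<^sup>2)"
    and D0: "(\<lambda>n. expectation (\<lambda>\<omega>. (D n \<omega> - p)\<^sup>2)) \<longlonglongrightarrow> 0"
    and p: "0 < p"
    and T: "\<forall>\<^sub>F n in sequentially. \<forall>\<omega>\<in>space M. D n \<omega> \<noteq> 0 \<longrightarrow> T n \<omega> = S n \<omega> / D n \<omega>"
    and S_char: "(\<lambda>n. char (distr M borel (S n)) (u / p)) \<longlonglongrightarrow> z"
  shows "(\<lambda>n. char (distr M borel (T n)) u) \<longlonglongrightarrow> z"
proof -
  note [measurable] = m
  define d where "d n = expectation (\<lambda>\<omega>. (D n \<omega> - p)\<^sup>2)" for n
  have d0: "0 \<le> d n" for n unfolding d_def by (intro Bochner_Integration.integral_nonneg) auto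
  \<comment> \<open>The weight in \<open>2 x y \<le> \<eta> x\<^sup>2 + y\<^sup>2 / \<eta>\<close>: close to the root of \<open>d n\<close>, so that both terms
    vanish in the limit, and shifted by \<open>1 / Suc n\<close> to be positive also when \<open>d n = 0\<close>.\<close>
  define \<eta> where "\<eta> n = sqrt (d n) + 1 / real (Suc n)" for n
  have \<eta>: "0 < \<eta> n" for n unfolding \<eta>_def using d0[of n] by (intro add_nonneg_pos) auto
  have sq0: "(\<lambda>n. sqrt (d n)) \<longlonglongrightarrow> 0"
    using tendsto_real_sqrt[OF D0] unfolding d_def by simp
  have \<eta>0: "\<eta> \<longlonglongrightarrow> 0"
    using tendsto_add[OF sq0 LIMSEQ_inverse_real_of_nat] unfolding \<eta>_def by (simp add: inverse_eq_divide)
  have d\<eta>: "d n / \<eta> n \<le> sqrt (d n)" for n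
  proof -
    have "d n = sqrt (d n) * sqrt (d n)" using d0 by simp
    also have "\<dots> \<le> sqrt (d n) * \<eta> n" unfolding \<eta>_def using d0[of n] by (intro mult_left_mono) auto
    finally show ?thesis using \<eta>[of n] by (simp add: pos_divide_le_eq)
  qed
  have "(\<lambda>n. char (distr M borel (T n)) u - char (distr M borel (S n)) (u / p)) \<longlonglongrightarrow> 0"
  proof (rule Lim_null_comparison)
    have "(\<lambda>n. 8 / p\<^sup>2 * d n + \<bar>u\<bar> / p\<^sup>2 * (\<eta> n * K + sqrt (d n))) \<longlonglongrightarrow> 8 / p\<^sup>2 * 0 + \<bar>u\<bar> / p\<^sup>2 * (0 * K + 0)"
      by (intro tendsto_mult tendsto_add tendsto_const \<eta>0 sq0 D0[folded d_def])
    then show "(\<lambda>n. 8 / p\<^sup>2 * d n + \<bar>u\<bar> / p\<^sup>2 * (\<eta> n * K + sqrt (d n))) \<longlonglongrightarrow> 0" by simp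
    show "\<forall>\<^sub>F n in sequentially. norm (char (distr M borel (T n)) u - char (distr M borel (S n)) (u / p))
        \<le> 8 / p\<^sup>2 * d n + \<bar>u\<bar> / p\<^sup>2 * (\<eta> n * K + sqrt (d n))"
      using S2 D2 T
    proof eventually_elim
      case (elim n)
      have i: "complex_integrable M (\<lambda>\<omega>. iexp (u * T n \<omega>))" "complex_integrable M (\<lambda>\<omega>. iexp (u / p * S n \<omega>))"
        by (rule integrable_const_bound[of _ 1]; simp)+
      let ?g = "\<lambda>\<omega>. 8 / p\<^sup>2 * (D n \<omega> - p)\<^sup>2 + \<bar>u\<bar> / p\<^sup>2 * (\<eta> n * (S n \<omega>)\<^sup>2 + (D n \<omega> - p)\<^sup>2 / \<eta> n)"
      have gi: "integrable M ?g" using elim by simp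
      have pt: "norm (iexp (u * T n \<omega>) - iexp (u / p * S n \<omega>)) \<le> ?g \<omega>" if w: "\<omega> \<in> space M" for \<omega>
      proof (cases "p / 2 \<le> \<bar>D n \<omega> - p\<bar>")
        case True
        have "norm (iexp (u * T n \<omega>) - iexp (u / p * S n \<omega>)) \<le> 2"
          using norm_triangle_ineq4[of "iexp (u * T n \<omega>)" "iexp (u / p * S n \<omega>)"] by simp
        also have "2 = 8 / p\<^sup>2 * (p / 2)\<^sup>2" using p by (simp add: power2_eq_square)
        also have "\<dots> \<le> 8 / p\<^sup>2 * (D n \<omega> - p)\<^sup>2"
        proof (rule mult_left_mono)
          have "(p / 2)\<^sup>2 \<le> \<bar>D n \<omega> - p\<bar>\<^sup>2" using True p by (intro power_mono) auto
          then show "(p / 2)\<^sup>2 \<le> (D n \<omega> - p)\<^sup>2" by simp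
        qed simp
        also have "\<dots> \<le> ?g \<omega>" using \<eta>[of n] by simp
        finally show ?thesis .
      next
        case False
        then have D: "p / 2 < D n \<omega>" by linarith
        define x where "x = \<bar>S n \<omega>\<bar>"
        define y where "y = \<bar>D n \<omega> - p\<bar>"
        have xy: "0 \<le> x" "0 \<le> y" by (auto simp: x_def y_def)
        have "T n \<omega> - S n \<omega> / p = S n \<omega> * (p - D n \<omega>) / (D n \<omega> * p)"
          using elim(3) w D p by (simp add: diff_frac_eq field_simps)
        then have "\<bar>T n \<omega> - S n \<omega> / p\<bar> = x * y / (D n \<omega> * p)"
          using D p by (simp add: abs_mult x_def y_def abs_minus_commute)
        also have "\<dots> \<le> x * y / (p / 2 * p)"
          using D p xy by (intro divide_left_mono mult_right_mono) auto
        also have "\<dots> = (2 * x * y) / p\<^sup>2" by (simp add: power2_eq_square)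
        finally have 1: "\<bar>T n \<omega> - S n \<omega> / p\<bar> \<le> (2 * x * y) / p\<^sup>2" .
        have "2 * x * y \<le> \<eta> n * x\<^sup>2 + y\<^sup>2 / \<eta> n"
        proof -
          have "0 \<le> (\<eta> n * x - y)\<^sup>2 / \<eta> n" using \<eta>[of n] by simp
          also have "\<dots> = \<eta> n * x\<^sup>2 - 2 * x * y + y\<^sup>2 / \<eta> n"
            using \<eta>[of n] by (simp add: power2_eq_square field_simps)
          finally show ?thesis by simp
        qed
        then have 2: "(2 * x * y) / p\<^sup>2 \<le> (\<eta> n * (S n \<omega>)\<^sup>2 + (D n \<omega> - p)\<^sup>2 / \<eta> n) / p\<^sup>2"
          unfolding x_def y_def power2_abs by (intro divide_right_mono) auto
        have "norm (iexp (u * T n \<omega>) - iexp (u / p * S n \<omega>)) \<le> \<bar>u * T n \<omega> - u / p * S n \<omega>\<bar>"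
          by (rule norm_iexp_diff_le)
        also have "\<dots> = \<bar>u\<bar> * \<bar>T n \<omega> - S n \<omega> / p\<bar>"
          unfolding abs_mult[symmetric] by (simp add: right_diff_distrib)
        also have "\<dots> \<le> \<bar>u\<bar> * ((\<eta> n * (S n \<omega>)\<^sup>2 + (D n \<omega> - p)\<^sup>2 / \<eta> n) / p\<^sup>2)"
          using 1 2 by (intro mult_left_mono) auto
        also have "\<dots> = \<bar>u\<bar> / p\<^sup>2 * (\<eta> n * (S n \<omega>)\<^sup>2 + (D n \<omega> - p)\<^sup>2 / \<eta> n)" by simp
        also have "\<dots> \<le> ?g \<omega>" by simp
        finally show ?thesis .
      qed
      have "norm (char (distr M borel (T n)) u - char (distr M borel (S n)) (u / p))
          = norm (CLINT \<omega>|M. iexp (u * T n \<omega>) - iexp (u / p * S n \<omega>))"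
        using i by (simp add: char_distr)
      also have "\<dots> \<le> expectation (\<lambda>\<omega>. norm (iexp (u * T n \<omega>) - iexp (u / p * S n \<omega>)))"
        by (rule integral_norm_bound)
      also have "\<dots> \<le> expectation ?g"
        using i pt by (intro integral_mono gi) auto
      also have "\<dots> = 8 / p\<^sup>2 * d n + \<bar>u\<bar> / p\<^sup>2 * (\<eta> n * expectation (\<lambda>\<omega>. (S n \<omega>)\<^sup>2) + d n / \<eta> n)"
        using elim by (simp add: d_def)
      also have "\<dots> \<le> 8 / p\<^sup>2 * d n + \<bar>u\<bar> / p\<^sup>2 * (\<eta> n * K + sqrt (d n))"
        using elim d\<eta>[of n] \<eta>[of n] by (intro add_left_mono mult_left_mono add_mono) auto
      finally show ?case .
    qed
  qed
  from tendsto_add[OF this S_char] show ?thesis by simp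
qed

section \<open>Asymptotic normality of the occurrence/exposure rate\<close>

text \<open>
  Differentiability at \<open>t\<close> alone bounds the difference quotients at \<open>t\<close>, by any constant above
  the absolute value of the derivative.
\<close>

lemma Ck_near_locally_lipschitz:
  assumes f: "Ck_near (Suc r) f t" and t: "0 \<le> t"
  obtains e L where "0 < e" "0 \<le> L" "\<And>s. 0 \<le> s \<Longrightarrow> \<bar>s - t\<bar> < e \<Longrightarrow> \<bar>f s - f t\<bar> \<le> L * \<bar>s - t\<bar>"
proof -
  from f obtain e0 f' where e0: "e0 > 0"
    and d: "\<And>x. x \<in> {0..} \<inter> ball t e0 \<Longrightarrow> (f has_real_derivative f' x) (at x within ({0..} \<inter> ball t e0))"
    unfolding Ck_near_def Ck_on.simps by blast
  let ?U = "{0..} \<inter> ball t e0"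
  have "(f has_real_derivative f' t) (at t within ?U)" using d t e0 by simp
  then have "((\<lambda>y. (f y - f t) / (y - t)) \<longlongrightarrow> f' t) (at t within ?U)"
    by (simp add: has_field_derivative_iff)
  then have "\<forall>\<^sub>F y in at t within ?U. dist ((f y - f t) / (y - t)) (f' t) < 1"
    by (rule tendstoD) simp
  then obtain e1 where e1: "e1 > 0"
    "\<And>y. y \<in> ?U \<Longrightarrow> y \<noteq> t \<Longrightarrow> dist y t < e1 \<Longrightarrow> dist ((f y - f t) / (y - t)) (f' t) < 1"
    unfolding eventually_at by blast
  show thesis
  proof (rule that[of "min e0 e1" "\<bar>f' t\<bar> + 1"])
    fix s :: real assume s: "0 \<le> s" "\<bar>s - t\<bar> < min e0 e1"
    show "\<bar>f s - f t\<bar> \<le> (\<bar>f' t\<bar> + 1) * \<bar>s - t\<bar>"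
    proof (cases "s = t")
      case False
      have "dist ((f s - f t) / (s - t)) (f' t) < 1"
        using s False by (intro e1) (auto simp: dist_real_def abs_minus_commute)
      then have "\<bar>(f s - f t) / (s - t)\<bar> \<le> \<bar>f' t\<bar> + 1" unfolding dist_real_def by linarith
      then show ?thesis using False by (simp add: abs_divide pos_divide_le_eq)
    qed simp
  qed (use e0 e1 in auto)
qed

lemma (in prob_space) char_sum_identical:
  fixes Y :: "nat \<Rightarrow> 'a \<Rightarrow> real"
  assumes ind: "indep_vars (\<lambda>_. borel) Y I"
    and id: "\<And>i. i \<in> I \<Longrightarrow> distr M borel (Y i) = \<nu>"
  shows "char (distr M borel (\<lambda>\<omega>. (\<Sum>i\<in>I. Y i \<omega>) / h)) u = char \<nu> (u / h) ^ card I"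
proof -
  have Ym: "Y i \<in> borel_measurable M" if "i \<in> I" for i using ind that by (auto simp: indep_vars_def)
  have "indep_vars (\<lambda>_. borel) (\<lambda>i \<omega>. Y i \<omega> / h) I"
    by (rule indep_vars_compose2[OF ind]) simp
  then have "char (distr M borel (\<lambda>\<omega>. \<Sum>i\<in>I. Y i \<omega> / h)) u = (\<Prod>i\<in>I. char (distr M borel (\<lambda>\<omega>. Y i \<omega> / h)) u)"
    by (rule char_distr_sum)
  also have "\<dots> = (\<Prod>i\<in>I. char \<nu> (u / h))"
  proof (rule prod.cong[OF refl])
    fix i assume i: "i \<in> I"
    have "char (distr M borel (\<lambda>\<omega>. Y i \<omega> / h)) u = char (distr M borel (Y i)) (u / h)"
      using Ym[OF i] by (simp add: char_distr)
    then show "char (distr M borel (\<lambda>\<omega>. Y i \<omega> / h)) u = char \<nu> (u / h)" using id[OF i] by simp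
  qed
  finally show ?thesis by (simp add: sum_divide_distrib)
qed

theorem theorem2p1:
  fixes M :: "'w measure" and G :: "real \<Rightarrow> 'w measure"
    and Z :: "real \<Rightarrow> 'w \<Rightarrow> 'z::finite" and R :: "'w \<Rightarrow> real"
    and \<mu> :: "'z \<Rightarrow> 'z \<Rightarrow> real \<Rightarrow> real"
    and P :: "'v measure"
    and Zs :: "nat \<Rightarrow> real \<Rightarrow> 'v \<Rightarrow> 'z" and Rs :: "nat \<Rightarrow> 'v \<Rightarrow> real"
    and \<tau> :: "nat \<Rightarrow> nat \<Rightarrow> real" and m :: "nat \<Rightarrow> nat" and \<Delta> :: "nat \<Rightarrow> real"
    and j k :: 'z and t :: real
  assumes "usual_conditions M G"
    and "jump_process M G Z"
    and "\<And>j' k' r. j' \<noteq> k' \<Longrightarrow> 0 \<le> r \<Longrightarrow>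
           integrable M (\<lambda>\<omega>. real (jump_count j' k' (\<lambda>s. Z s \<omega>) r))"
    and "markov_process M Z"
    and "transition_intensities M Z \<mu>"
    and "R \<in> borel_measurable M" and "\<And>\<omega>. \<omega> \<in> space M \<Longrightarrow> 0 \<le> R \<omega>"
    and "indep_elements M path_space (path_of Z) borel R"
    and "prob_space P"
    and "iid_copies P Zs Rs M Z R"
    and "j \<noteq> k" and "0 \<le> t" and "0 < \<mu> j k t"
    and "\<And>r. 0 \<le> r \<Longrightarrow>
           integrable M (\<lambda>\<omega>. real (jump_count j k (\<lambda>s. Z s \<omega>) r) ^ 4)"
    and "\<And>n. time_partition (\<tau> n)"
    and "\<And>n. 1 \<le> m n \<and> t \<in> {\<tau> n (m n - 1)..<\<tau> n (m n)}"
    and "Ck_near 1 (censored_occupation M Z R j) t"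
    and "Ck_near 2 (\<mu> j k) t"
    and "0 < censored_occupation M Z R j t"
    and "\<And>n. \<Delta> n = \<tau> n (m n) - \<tau> n (m n - 1)"
    and "\<Delta> \<longlonglongrightarrow> 0"
    and "filterlim (\<lambda>n. real n * \<Delta> n) at_top sequentially"
    and "(\<lambda>n. real n * \<Delta> n ^ 3) \<longlonglongrightarrow> 0"
  shows "weak_conv_m
           (\<lambda>n. distr P borel (\<lambda>\<omega>. sqrt (real n * \<Delta> n) *
              (oe_rate Zs Rs j k n (\<tau> n (m n - 1)) (\<tau> n (m n)) \<omega> - \<mu> j k t)))
           (density lborel
              (normal_density 0 (sqrt (\<mu> j k t / censored_occupation M Z R j t))))"
proof -
  note usual = assms(1) and jp = assms(2) and intens = assms(5)
    and indep = assms(8) and probP = assms(9) and iid = assms(10) and jk = assms(11)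
    and t0 = assms(12) and mu_pos = assms(13) and fourth = assms(14) and part = assms(15)
    and tin = assms(16) and p_smooth = assms(17) and mu_smooth = assms(18) and p_pos = assms(19)
    and Delta = assms(20) and Delta0 = assms(21) and nDelta = assms(22) and nDelta3 = assms(23)
  define c where "c = \<mu> j k t"
  define p where "p = censored_occupation M Z R j t"
  have c: "0 < c" and p: "0 < p" using mu_pos p_pos by (auto simp: c_def p_def)
  obtain e1 L where e1: "0 < e1" and L: "0 \<le> L"
    and lip: "\<And>s. 0 \<le> s \<Longrightarrow> \<bar>s - t\<bar> < e1 \<Longrightarrow> \<bar>\<mu> j k s - c\<bar> \<le> L * \<bar>s - t\<bar>"
    using Ck_near_locally_lipschitz[of 1 "\<mu> j k" t] mu_smooth t0
    unfolding c_def by (auto simp: numeral_2_eq_2)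
  obtain e2 L' where e2: "0 < e2" and L': "0 \<le> L'"
    and lip': "\<And>s. 0 \<le> s \<Longrightarrow> \<bar>s - t\<bar> < e2 \<Longrightarrow> \<bar>censored_occupation M Z R j s - p\<bar> \<le> L' * \<bar>s - t\<bar>"
    using Ck_near_locally_lipschitz[of 0 "censored_occupation M Z R j" t] p_smooth t0
    unfolding p_def by auto
  define e where "e = min e1 e2"
  have e: "0 < e" using e1 e2 by (simp add: e_def)
  \<comment> \<open>By the Lipschitz bound, \<open>C\<close> dominates the intensity on the neighbourhood of radius \<open>e\<close>.\<close>
  define C where "C = c + L * e"
  have probM: "prob_space M" using usual by (simp add: usual_conditions_def)
  have sub: "\<And>s. 0 \<le> s \<Longrightarrow> subalgebra M (G s)" using usual by (simp add: usual_conditions_def)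
  have \<mu>: "\<mu> j k \<in> borel_measurable (restrict_space borel {0..})" "\<And>s. 0 \<le> s \<Longrightarrow> 0 \<le> \<mu> j k s"
    "\<And>r. 0 \<le> r \<Longrightarrow> AE \<omega> in M. set_integrable lborel {0..r} (\<lambda>s. of_bool (left_state (\<lambda>u. Z u \<omega>) s = j) * \<mu> j k s)"
    "martingale M (completed_natural_filtration M Z)
       (\<lambda>r \<omega>. real (jump_count j k (\<lambda>u. Z u \<omega>) r) - compensator j (\<mu> j k) Z r \<omega>)"
    "\<And>r. 0 \<le> r \<Longrightarrow> prob_space.expectation M (\<lambda>\<omega>. real (jump_count j k (\<lambda>u. Z u \<omega>) r) - compensator j (\<mu> j k) Z r \<omega>) = 0"
    using intens jk unfolding transition_intensities_def compensator_def Let_def by blast+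
  interpret M: censored_local_intensity M Z "\<mu> j k" j k t e C R
  proof (intro censored_local_intensity.intro local_intensity.intro local_intensity_axioms.intro
      censored_local_intensity_axioms.intro probM jk \<mu> indep)
    show "Z s \<in> measurable M (count_space UNIV)" if "0 \<le> s" for s
      using jp sub[OF that] that unfolding jump_process_def by (blast intro: measurable_from_subalg)
    show "jump_path (\<lambda>s. Z s \<omega>)" if "\<omega> \<in> space M" for \<omega>
      using jp that unfolding jump_process_def by blast
    show "\<mu> j k s \<le> C" if "0 \<le> s" "\<bar>s - t\<bar> < e" for s
    proof -
      have "\<bar>\<mu> j k s - c\<bar> \<le> L * \<bar>s - t\<bar>" using lip that by (simp add: e_def)
      also have "\<dots> \<le> L * e" using that L by (intro mult_left_mono) auto
      finally show ?thesis by (simp add: C_def)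
    qed
    show "integrable M (\<lambda>\<omega>. (real (jump_count j k (\<lambda>u. Z u \<omega>) r))\<^sup>2)" if "0 \<le> r" for r
    proof -
      interpret prob_space M by (rule probM)
      have m1: "(\<lambda>\<omega>. real (jump_count j k (\<lambda>u. Z u \<omega>) r)) \<in> borel_measurable M"
        using assms(3)[OF jk that] by (rule borel_measurable_integrable)
      have "integrable M (\<lambda>\<omega>. ((real (jump_count j k (\<lambda>u. Z u \<omega>) r))\<^sup>2)\<^sup>2)"
        using fourth[OF that] by (simp add: power_mult[symmetric])
      then show ?thesis
        by (rule square_integrable_imp_integrable[OF borel_measurable_power[OF m1]])
    qed
  qed
  define a where "a n = \<tau> n (m n - 1)" for n
  define b where "b n = \<tau> n (m n)" for n
  have ab: "a n \<le> t" "t < b n" "\<Delta> n = b n - a n" "0 \<le> a n" for n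
  proof -
    show "a n \<le> t" "t < b n" "\<Delta> n = b n - a n" using tin[of n] Delta[of n] by (auto simp: a_def b_def)
    have "strict_mono (\<tau> n)" using part[of n] by (simp add: time_partition_def)
    then have "\<tau> n 0 \<le> \<tau> n (m n - 1)" by (simp only: strict_mono_less_eq le0)
    then show "0 \<le> a n" using part[of n] by (simp add: a_def time_partition_def)
  qed
  have \<Delta>: "0 < \<Delta> n" "a n < b n" "a n \<le> b n" for n using ab[of n] by auto
  have p1: "p \<le> 1" unfolding p_def censored_occupation_def by (rule M.prob_le_1)
  have ev_small: "\<forall>\<^sub>F n in sequentially. \<Delta> n < e \<and> c * \<Delta> n \<le> 1"
  proof -
    have "\<forall>\<^sub>F n in sequentially. \<Delta> n < min e (1 / c)"
      using Delta0 by (rule order_tendstoD) (use e c in simp)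
    then show ?thesis by eventually_elim (use c in \<open>simp add: field_simps\<close>)
  qed
  have near: "\<bar>s - t\<bar> \<le> \<Delta> n" if "s \<in> {a n..b n}" for s n using that ab[of n] by auto
  have near_ab: "0 \<le> a n \<and> \<bar>a n - t\<bar> < e" "0 \<le> b n \<and> \<bar>b n - t\<bar> < e" if "\<Delta> n < e" for n
    using near[of "a n" n] near[of "b n" n] \<Delta>[of n] ab[of n] that by auto
  have lip_ab: "\<bar>\<mu> j k s - c\<bar> \<le> L * \<Delta> n" "\<bar>censored_occupation M Z R j s - p\<bar> \<le> L' * \<Delta> n"
    if "\<Delta> n < e" "s \<in> {a n..b n}" for n s
  proof -
    have s: "0 \<le> s" "\<bar>s - t\<bar> < e1" "\<bar>s - t\<bar> < e2" "\<bar>s - t\<bar> \<le> \<Delta> n"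
      using near[OF that(2)] that ab(4)[of n] by (auto simp: e_def)
    show "\<bar>\<mu> j k s - c\<bar> \<le> L * \<Delta> n" using lip[OF s(1,2)] mult_left_mono[OF s(4) L] by linarith
    show "\<bar>censored_occupation M Z R j s - p\<bar> \<le> L' * \<Delta> n" using lip'[OF s(1,3)] mult_left_mono[OF s(4) L'] by linarith
  qed
  define V where "V i \<omega> = (path_of (Zs i) \<omega>, Rs i \<omega>)" for i \<omega>
  let ?S = "path_space \<Otimes>\<^sub>M borel :: ((real \<Rightarrow> 'z) \<times> real) measure"
  let ?V0 = "\<lambda>\<omega>. (path_of Z \<omega>, R \<omega>)"
  interpret P: prob_space P by (rule probP)
  have Vind: "P.indep_vars (\<lambda>_. ?S) V {1..}"
    and Vid: "\<And>i. 1 \<le> i \<Longrightarrow> distr P ?S (V i) = distr M ?S ?V0"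
    and Vpath: "\<And>i \<omega>. 1 \<le> i \<Longrightarrow> \<omega> \<in> space P \<Longrightarrow> jump_path (\<lambda>s. Zs i s \<omega>)"
    using iid unfolding iid_copies_def V_def[abs_def] by auto
  have Vm: "V i \<in> measurable P ?S" if "1 \<le> i" for i
    using Vind that by (auto simp: P.indep_vars_def)
  have transfer: "distr P borel (\<lambda>\<omega>. f (V i \<omega>)) = distr M borel (\<lambda>\<omega>. f (?V0 \<omega>))"
    "integrable P (\<lambda>\<omega>. f (V i \<omega>)) \<longleftrightarrow> integrable M (\<lambda>\<omega>. f (?V0 \<omega>))"
    "P.expectation (\<lambda>\<omega>. f (V i \<omega>)) = M.expectation (\<lambda>\<omega>. f (?V0 \<omega>))"
    if f: "f \<in> borel_measurable ?S" and i: "1 \<le> i" for f :: "(real \<Rightarrow> 'z) \<times> real \<Rightarrow> real" and i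
  proof -
    show "distr P borel (\<lambda>\<omega>. f (V i \<omega>)) = distr M borel (\<lambda>\<omega>. f (?V0 \<omega>))"
      using distr_distr[OF f Vm[OF i]] distr_distr[OF f M.data_measurable] Vid[OF i] by (simp add: comp_def)
    show "integrable P (\<lambda>\<omega>. f (V i \<omega>)) \<longleftrightarrow> integrable M (\<lambda>\<omega>. f (?V0 \<omega>))"
      using integrable_distr_eq[OF Vm[OF i] f] integrable_distr_eq[OF M.data_measurable f] Vid[OF i] by simp
    show "P.expectation (\<lambda>\<omega>. f (V i \<omega>)) = M.expectation (\<lambda>\<omega>. f (?V0 \<omega>))"
      using integral_distr[OF Vm[OF i] f] integral_distr[OF M.data_measurable f] Vid[OF i] by simp
  qed
  have row_indep: "P.indep_vars (\<lambda>_. borel) (\<lambda>i \<omega>. f (V i \<omega>)) {1..n}"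
    if f: "f \<in> borel_measurable ?S" for f :: "(real \<Rightarrow> 'z) \<times> real \<Rightarrow> real" and n
    by (rule P.indep_vars_compose2[OF P.indep_vars_subset[OF Vind]]) (use f in auto)
  \<comment> \<open>Second moments of row sums, expressed through one observation on the original space.\<close>
  have row_second: "integrable P (\<lambda>\<omega>. (\<Sum>i=1..n. f (V i \<omega>))\<^sup>2)"
      "P.expectation (\<lambda>\<omega>. (\<Sum>i=1..n. f (V i \<omega>))\<^sup>2)
         \<le> real n * M.expectation (\<lambda>\<omega>. (f (?V0 \<omega>))\<^sup>2) + (real n * M.expectation (\<lambda>\<omega>. f (?V0 \<omega>)))\<^sup>2"
    if f: "f \<in> borel_measurable ?S" and f2: "integrable M (\<lambda>\<omega>. (f (?V0 \<omega>))\<^sup>2)"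
    for f :: "(real \<Rightarrow> 'z) \<times> real \<Rightarrow> real" and n
  proof -
    have fsq: "(\<lambda>w. (f w)\<^sup>2) \<in> borel_measurable ?S" using f by simp
    note s = P.second_moment_sum_le[OF row_indep[OF f, of n] finite_atLeastAtMost,
        where m = "M.expectation (\<lambda>\<omega>. f (?V0 \<omega>))" and v = "M.expectation (\<lambda>\<omega>. (f (?V0 \<omega>))\<^sup>2)"]
    show "integrable P (\<lambda>\<omega>. (\<Sum>i=1..n. f (V i \<omega>))\<^sup>2)"
      by (rule s(1)) (use transfer[OF f] transfer[OF fsq] f2 in auto)
    have "P.expectation (\<lambda>\<omega>. (\<Sum>i=1..n. f (V i \<omega>))\<^sup>2)
       \<le> real (card {1..n}) * M.expectation (\<lambda>\<omega>. (f (?V0 \<omega>))\<^sup>2) + (real (card {1..n}) * M.expectation (\<lambda>\<omega>. f (?V0 \<omega>)))\<^sup>2"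
      by (rule s(2)) (use transfer[OF f] transfer[OF fsq] f2 in auto)
    then show "P.expectation (\<lambda>\<omega>. (\<Sum>i=1..n. f (V i \<omega>))\<^sup>2)
         \<le> real n * M.expectation (\<lambda>\<omega>. (f (?V0 \<omega>))\<^sup>2) + (real n * M.expectation (\<lambda>\<omega>. f (?V0 \<omega>)))\<^sup>2"
      by simp
  qed
  let ?oc = "\<lambda>n. occ_functional j k (a n) (b n)" and ?ex = "\<lambda>n. exposure_functional j (a n) (b n)"
  have ocm: "?oc n \<in> borel_measurable ?S" and exm: "?ex n \<in> borel_measurable ?S" for n
    using \<Delta>(3)[of n] ab(4)[of n] by (auto intro: occ_functional_measurable exposure_functional_measurable)
  \<comment> \<open>Setting the residual to 0 for long intervals makes it square integrable for every \<open>n\<close>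
    and affects finitely many \<open>n\<close> only.\<close>
  define x where "x n w = (if \<Delta> n < e then ?oc n w - c * ?ex n w else 0)" for n w
  have xm: "x n \<in> borel_measurable ?S" for n
    using ocm[of n] exm[of n] unfolding x_def[abs_def] by (cases "\<Delta> n < e") auto
  define X where "X n \<omega> = x n (?V0 \<omega>)" for n \<omega>
  have X_eq: "X n = (\<lambda>\<omega>. M.occ (a n) (b n) \<omega> - c * M.expo (a n) (b n) \<omega>)" if "\<Delta> n < e" for n
    using that by (simp add: X_def x_def M.occ_def M.expo_def fun_eq_iff)
  have Xm: "X n \<in> borel_measurable M" for n
    unfolding X_def[abs_def] by (rule measurable_compose[OF M.data_measurable xm])
  have X2: "integrable M (\<lambda>\<omega>. (X n \<omega>)\<^sup>2)" for n
  proof (cases "\<Delta> n < e")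
    case True
    show ?thesis unfolding X_eq[OF True]
      by (rule M.residual_square_integrable[OF \<Delta>(2) near_ab[OF True]])
  qed (simp add: X_def x_def)
  have mean_bound: "\<bar>M.expectation (X n)\<bar> \<le> L * (\<Delta> n)\<^sup>2" if n: "\<Delta> n < e" for n
  proof -
    have "\<bar>M.expectation (X n)\<bar> \<le> L * \<Delta> n * (b n - a n)"
      unfolding X_eq[OF n] by (rule M.residual_mean[OF \<Delta>(2) near_ab[OF n]]) (rule lip_ab(1)[OF n])
    then show ?thesis by (simp add: ab(3)[symmetric] power2_eq_square)
  qed
  have mean: "(\<lambda>n. sqrt (real n / \<Delta> n) * M.expectation (X n)) \<longlonglongrightarrow> 0"
  proof (rule Lim_null_comparison)
    have "(\<lambda>n. L * sqrt (real n * \<Delta> n ^ 3)) \<longlonglongrightarrow> L * sqrt 0"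
      by (intro tendsto_mult tendsto_const tendsto_real_sqrt nDelta3)
    then show "(\<lambda>n. L * sqrt (real n * \<Delta> n ^ 3)) \<longlonglongrightarrow> 0" by simp
    show "\<forall>\<^sub>F n in sequentially. norm (sqrt (real n / \<Delta> n) * M.expectation (X n)) \<le> L * sqrt (real n * \<Delta> n ^ 3)"
      using ev_small
    proof eventually_elim
      case (elim n)
      have "norm (sqrt (real n / \<Delta> n) * M.expectation (X n)) = sqrt (real n / \<Delta> n) * \<bar>M.expectation (X n)\<bar>"
        using \<Delta>(1)[of n] by (simp add: abs_mult)
      also have "\<dots> \<le> sqrt (real n / \<Delta> n) * (L * (\<Delta> n)\<^sup>2)"
        using mean_bound[of n] elim \<Delta>(1)[of n] by (intro mult_left_mono) auto
      also have "\<dots> = L * (sqrt (real n / \<Delta> n) * sqrt ((\<Delta> n)\<^sup>2 * (\<Delta> n)\<^sup>2))"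
        unfolding real_sqrt_abs2 by (simp only: abs_power2 mult_ac)
      also have "\<dots> = L * sqrt (real n * \<Delta> n ^ 3)"
        unfolding real_sqrt_mult[symmetric] using \<Delta>(1)[of n] by (simp add: power2_eq_square power3_eq_cube)
      finally show ?case .
    qed
  qed
  define B where "B = 2 * C\<^sup>2 + 2 * c * C + c\<^sup>2"
  have var: "(\<lambda>n. M.expectation (\<lambda>\<omega>. (X n \<omega>)\<^sup>2) / \<Delta> n) \<longlonglongrightarrow> c * p"
  proof (rule LIM_zero_cancel, rule Lim_null_comparison)
    have "(\<lambda>n. (B + L + c * L') * \<Delta> n) \<longlonglongrightarrow> (B + L + c * L') * 0"
      by (intro tendsto_mult tendsto_const Delta0)
    then show "(\<lambda>n. (B + L + c * L') * \<Delta> n) \<longlonglongrightarrow> 0" by simp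
    show "\<forall>\<^sub>F n in sequentially. norm (M.expectation (\<lambda>\<omega>. (X n \<omega>)\<^sup>2) / \<Delta> n - c * p) \<le> (B + L + c * L') * \<Delta> n"
      using ev_small
    proof eventually_elim
      case (elim n)
      then have n: "\<Delta> n < e" by simp
      have "\<bar>M.expectation (\<lambda>\<omega>. (X n \<omega>)\<^sup>2) - c * p * \<Delta> n\<bar>
          \<le> (2 * C\<^sup>2 + 2 * c * C + c\<^sup>2) * (\<Delta> n)\<^sup>2 + (L * \<Delta> n + c * (L' * \<Delta> n)) * \<Delta> n"
        unfolding X_eq[OF n] ab(3)
        by (rule M.residual_variance[OF \<Delta>(2) near_ab[OF n]])
          (use c lip_ab[OF n, unfolded ab(3)] in auto)
      also have "\<dots> = (B + L + c * L') * \<Delta> n * \<Delta> n"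
        by (simp add: B_def power2_eq_square algebra_simps)
      finally have "\<bar>M.expectation (\<lambda>\<omega>. (X n \<omega>)\<^sup>2) - c * p * \<Delta> n\<bar> / \<Delta> n \<le> (B + L + c * L') * \<Delta> n"
        using \<Delta>(1)[of n] by (simp add: pos_divide_le_eq)
      moreover have "M.expectation (\<lambda>\<omega>. (X n \<omega>)\<^sup>2) / \<Delta> n - c * p = (M.expectation (\<lambda>\<omega>. (X n \<omega>)\<^sup>2) - c * p * \<Delta> n) / \<Delta> n"
        using \<Delta>(1)[of n] by (simp add: diff_divide_distrib)
      ultimately show ?case using \<Delta>(1)[of n] by (simp add: abs_divide)
    qed
  qed
  have lindeberg: "\<forall>\<^sub>F n in sequentially. M.expectation (\<lambda>\<omega>. min (6 * (X n \<omega>)\<^sup>2) (\<bar>\<theta> n\<bar> * \<bar>X n \<omega>\<bar> ^ 3))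
      \<le> \<bar>\<theta> n\<bar> * M.expectation (\<lambda>\<omega>. (X n \<omega>)\<^sup>2) + 24 * C\<^sup>2 * (\<Delta> n)\<^sup>2" for \<theta> :: "nat \<Rightarrow> real"
    using ev_small
  proof eventually_elim
    case (elim n)
    then have n: "\<Delta> n < e" by simp
    show ?case unfolding X_eq[OF n] ab(3)
      by (rule M.residual_lindeberg[OF \<Delta>(2) near_ab[OF n]]) (use c elim ab(3)[of n] in auto)
  qed
  have \<kappa>: "(\<lambda>n. 24 * C\<^sup>2 * (\<Delta> n)\<^sup>2 / \<Delta> n) \<longlonglongrightarrow> 0"
  proof -
    have "(\<lambda>n. 24 * C\<^sup>2 * \<Delta> n) \<longlonglongrightarrow> 24 * C\<^sup>2 * 0"
      by (intro tendsto_mult tendsto_const Delta0)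
    moreover have "24 * C\<^sup>2 * (\<Delta> n)\<^sup>2 / \<Delta> n = 24 * C\<^sup>2 * \<Delta> n" for n
      using \<Delta>(1)[of n] by (simp add: power2_eq_square)
    ultimately show ?thesis by simp
  qed
  have X_char: "(\<lambda>n. char (distr M borel (X n)) (u / sqrt (real n * \<Delta> n)) ^ n) \<longlonglongrightarrow> exp (- (u\<^sup>2 * (c * p) / 2))" for u
    by (rule M.row_char_tendsto[OF Xm X2 \<Delta>(1) nDelta mean var lindeberg \<kappa>]) (use c p in simp)

  define S where "S n \<omega> = (\<Sum>i=1..n. x n (V i \<omega>)) / sqrt (real n * \<Delta> n)" for n \<omega>
  define D where "D n \<omega> = (\<Sum>i=1..n. ?ex n (V i \<omega>)) / (real n * \<Delta> n)" for n \<omega>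
  define T where "T n \<omega> = sqrt (real n * \<Delta> n) * ((\<Sum>i=1..n. ?oc n (V i \<omega>)) / (\<Sum>i=1..n. ?ex n (V i \<omega>)) - c)" for n \<omega>
  have sum_m: "(\<lambda>\<omega>. \<Sum>i=1..n. f (V i \<omega>)) \<in> borel_measurable P" if "f \<in> borel_measurable ?S"
    for f :: "(real \<Rightarrow> 'z) \<times> real \<Rightarrow> real" and n
    using that by (intro borel_measurable_sum measurable_compose[OF Vm]) auto
  have STD_m: "S n \<in> borel_measurable P" "D n \<in> borel_measurable P" "T n \<in> borel_measurable P" for n
    using sum_m[OF xm] sum_m[OF exm] sum_m[OF ocm] unfolding S_def[abs_def] D_def[abs_def] T_def[abs_def] by auto
  have oe: "sqrt (real n * \<Delta> n) * (oe_rate Zs Rs j k n (a n) (b n) \<omega> - c) = T n \<omega>" if w: "\<omega> \<in> space P" for n \<omega>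
  proof -
    have "real (occurrence Zs Rs j k n (a n) (b n) \<omega>) = (\<Sum>i=1..n. ?oc n (V i \<omega>))"
      unfolding occurrence_def of_nat_sum V_def
    proof (rule sum.cong[OF refl])
      fix i assume "i \<in> {1..n}"
      then have "jump_path (\<lambda>s. Zs i s \<omega>)" using Vpath w by simp
      from occ_functional_path_of[where Z = "Zs i" and \<omega> = \<omega>, OF this ab(4)[of n] \<Delta>(3)[of n] jk]
      show "real (card (jump_times j k (\<lambda>s. Zs i s \<omega>) \<inter> {a n..<b n} \<inter> {..Rs i \<omega>})) = ?oc n (path_of (Zs i) \<omega>, Rs i \<omega>)"
        by simp
    qed
    moreover have "exposure Zs Rs j n (a n) (b n) \<omega> = (\<Sum>i=1..n. ?ex n (V i \<omega>))"
      unfolding exposure_def V_def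
    proof (rule sum.cong[OF refl])
      fix i assume "i \<in> {1..n}"
      then have "jump_path (\<lambda>s. Zs i s \<omega>)" using Vpath w by simp
      from exposure_functional_path_of[where Z = "Zs i" and \<omega> = \<omega>, OF this ab(4)[of n] \<Delta>(2)[of n]]
      show "(LINT s:{a n..b n}|lborel. of_bool (s < Rs i \<omega>) * of_bool (Zs i s \<omega> = j)) = ?ex n (path_of (Zs i) \<omega>, Rs i \<omega>)"
        by simp
    qed
    ultimately show ?thesis by (simp add: oe_rate_def T_def)
  qed
  \<comment> \<open>The characteristic function of the row sum is a power of that of a single residual.\<close>
  have S_char: "(\<lambda>n. char (distr P borel (S n)) u) \<longlonglongrightarrow> exp (- (u\<^sup>2 * (c * p) / 2))" for u
  proof -
    have "char (distr P borel (S n)) u = char (distr M borel (X n)) (u / sqrt (real n * \<Delta> n)) ^ n" for n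
    proof -
      have "char (distr P borel (\<lambda>\<omega>. (\<Sum>i=1..n. x n (V i \<omega>)) / sqrt (real n * \<Delta> n))) u
          = char (distr M borel (X n)) (u / sqrt (real n * \<Delta> n)) ^ card {1..n}"
        by (rule P.char_sum_identical[OF row_indep[OF xm]])
          (use transfer(1)[OF xm] in \<open>simp add: X_def[abs_def]\<close>)
      then show ?thesis by (simp add: S_def[abs_def])
    qed
    then show ?thesis using X_char by simp
  qed
  have S2: "\<forall>\<^sub>F n in sequentially. integrable P (\<lambda>\<omega>. (S n \<omega>)\<^sup>2) \<and> P.expectation (\<lambda>\<omega>. (S n \<omega>)\<^sup>2) \<le> c * p + 1"
  proof -
    have "(\<lambda>n. M.expectation (\<lambda>\<omega>. (X n \<omega>)\<^sup>2) / \<Delta> n + (sqrt (real n / \<Delta> n) * M.expectation (X n))\<^sup>2) \<longlonglongrightarrow> c * p + 0\<^sup>2"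
      by (intro tendsto_add tendsto_power var mean)
    then have "\<forall>\<^sub>F n in sequentially. M.expectation (\<lambda>\<omega>. (X n \<omega>)\<^sup>2) / \<Delta> n + (sqrt (real n / \<Delta> n) * M.expectation (X n))\<^sup>2 < c * p + 1"
      by (rule order_tendstoD) simp
    with eventually_gt_at_top[of 0] show ?thesis
    proof eventually_elim
      case (elim n)
      have nd: "0 < real n * \<Delta> n" using elim \<Delta>(1)[of n] by simp
      have x2: "integrable M (\<lambda>\<omega>. (x n (?V0 \<omega>))\<^sup>2)" using X2[of n] by (simp add: X_def)
      have Ssq: "(S n \<omega>)\<^sup>2 = (\<Sum>i=1..n. x n (V i \<omega>))\<^sup>2 / (real n * \<Delta> n)" for \<omega>
        using nd by (simp add: S_def power_divide)
      have "P.expectation (\<lambda>\<omega>. (S n \<omega>)\<^sup>2) = P.expectation (\<lambda>\<omega>. (\<Sum>i=1..n. x n (V i \<omega>))\<^sup>2) / (real n * \<Delta> n)"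
        unfolding Ssq by simp
      also have "\<dots> \<le> (real n * M.expectation (\<lambda>\<omega>. (X n \<omega>)\<^sup>2) + (real n * M.expectation (X n))\<^sup>2) / (real n * \<Delta> n)"
        using row_second(2)[OF xm x2] nd by (intro divide_right_mono) (auto simp: X_def[abs_def])
      also have "\<dots> = M.expectation (\<lambda>\<omega>. (X n \<omega>)\<^sup>2) / \<Delta> n + (sqrt (real n / \<Delta> n) * M.expectation (X n))\<^sup>2"
      proof -
        have "real n \<noteq> 0" "\<Delta> n \<noteq> 0" "0 \<le> real n / \<Delta> n" using elim(1) \<Delta>(1)[of n] by auto
        then show ?thesis by (simp add: power_mult_distrib power2_eq_square[of "real n"] field_simps)
      qed
      also have "\<dots> \<le> c * p + 1" using elim by simp
      finally show ?case unfolding Ssq using row_second(1)[OF xm x2, of n] by (simp add: Ssq)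
    qed
  qed
  \<comment> \<open>The centred exposure is bounded by the length of the interval, because \<open>0 \<le> p \<le> 1\<close>, and its
    mean is of second order; both facts enter the mean square of \<open>D n - p\<close>.\<close>
  define y where "y n w = ?ex n w - p * \<Delta> n" for n w
  have ym: "y n \<in> borel_measurable ?S" for n using exm unfolding y_def[abs_def] by simp
  have y_bound: "\<bar>y n (?V0 \<omega>)\<bar> \<le> \<Delta> n" if "\<omega> \<in> space M" for n \<omega>
  proof -
    have "0 \<le> ?ex n (?V0 \<omega>)" "?ex n (?V0 \<omega>) \<le> \<Delta> n"
      using M.exposure_functional_bounds[OF that ab(4)[of n] \<Delta>(2)[of n]] ab(3)[of n] by auto
    moreover have "0 \<le> p * \<Delta> n" "p * \<Delta> n \<le> \<Delta> n" using p p1 \<Delta>(1)[of n] by (auto intro: mult_left_le_one_le)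
    ultimately show ?thesis by (simp add: y_def)
  qed
  have y0m: "(\<lambda>\<omega>. y n (?V0 \<omega>)) \<in> borel_measurable M" for n
    by (rule measurable_compose[OF M.data_measurable ym])
  have y2_bound: "(y n (?V0 \<omega>))\<^sup>2 \<le> (\<Delta> n)\<^sup>2" if "\<omega> \<in> space M" for n \<omega>
    using power_mono[OF y_bound[OF that] abs_ge_zero, of n 2] by simp
  have y2: "integrable M (\<lambda>\<omega>. (y n (?V0 \<omega>))\<^sup>2)" for n
    by (rule M.integrable_const_bound[of _ "(\<Delta> n)\<^sup>2"]) (use y0m y2_bound in auto)
  have y2_le: "M.expectation (\<lambda>\<omega>. (y n (?V0 \<omega>))\<^sup>2) \<le> (\<Delta> n)\<^sup>2" for n
    using M.abs_expectation_le[of "\<lambda>\<omega>. (y n (?V0 \<omega>))\<^sup>2" "(\<Delta> n)\<^sup>2"] y2_bound by (auto simp: abs_le_iff)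
  have y_mean: "\<bar>M.expectation (\<lambda>\<omega>. y n (?V0 \<omega>))\<bar> \<le> L' * (\<Delta> n)\<^sup>2" if n: "\<Delta> n < e" for n
  proof -
    have "\<bar>M.expectation (M.expo (a n) (b n)) - p * (b n - a n)\<bar> \<le> L' * \<Delta> n * (b n - a n)"
      by (rule M.expo_mean[OF \<Delta>(2) near_ab[OF n]]) (rule lip_ab(2)[OF n])
    moreover have "M.expectation (\<lambda>\<omega>. y n (?V0 \<omega>)) = M.expectation (M.expo (a n) (b n)) - p * \<Delta> n"
      using M.expo_integrable[OF \<Delta>(2) near_ab[OF n]] unfolding y_def M.expo_def[abs_def] by (simp add: M.prob_space)
    ultimately show ?thesis by (simp add: ab(3)[symmetric] power2_eq_square)
  qed
  have D_eq: "(D n \<omega> - p)\<^sup>2 = (\<Sum>i=1..n. y n (V i \<omega>))\<^sup>2 / (real n * \<Delta> n)\<^sup>2" if "0 < n" for n \<omega>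
  proof -
    have "D n \<omega> - p = (\<Sum>i=1..n. y n (V i \<omega>)) / (real n * \<Delta> n)"
      using that \<Delta>(1)[of n] by (simp add: D_def y_def sum_subtractf field_simps)
    then show ?thesis by (simp add: power_divide)
  qed
  have D2: "\<forall>\<^sub>F n in sequentially. integrable P (\<lambda>\<omega>. (D n \<omega> - p)\<^sup>2)"
    using eventually_gt_at_top[of 0]
    by eventually_elim (use row_second(1)[OF ym y2] in \<open>simp add: D_eq\<close>)
  have D0: "(\<lambda>n. P.expectation (\<lambda>\<omega>. (D n \<omega> - p)\<^sup>2)) \<longlonglongrightarrow> 0"
  proof (rule Lim_null_comparison)
    have "(\<lambda>n. 1 / real n + (L' * \<Delta> n)\<^sup>2) \<longlonglongrightarrow> 0 + (L' * 0)\<^sup>2"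
      by (intro tendsto_add tendsto_power tendsto_mult tendsto_const Delta0 lim_const_over_n)
    then show "(\<lambda>n. 1 / real n + (L' * \<Delta> n)\<^sup>2) \<longlonglongrightarrow> 0" by simp
    show "\<forall>\<^sub>F n in sequentially. norm (P.expectation (\<lambda>\<omega>. (D n \<omega> - p)\<^sup>2)) \<le> 1 / real n + (L' * \<Delta> n)\<^sup>2"
      using ev_small eventually_gt_at_top[of 0]
    proof eventually_elim
      case (elim n)
      have nd: "0 < real n * \<Delta> n" using elim \<Delta>(1)[of n] by simp
      have "(real n * M.expectation (\<lambda>\<omega>. y n (?V0 \<omega>)))\<^sup>2 \<le> (real n * (L' * (\<Delta> n)\<^sup>2))\<^sup>2"
      proof -
        have "\<bar>real n * M.expectation (\<lambda>\<omega>. y n (?V0 \<omega>))\<bar> \<le> real n * (L' * (\<Delta> n)\<^sup>2)"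
          unfolding abs_mult using y_mean[of n] elim by (simp add: mult_left_mono)
        from power_mono[OF this abs_ge_zero, of 2] show ?thesis by simp
      qed
      moreover have "real n * M.expectation (\<lambda>\<omega>. (y n (?V0 \<omega>))\<^sup>2) \<le> real n * (\<Delta> n)\<^sup>2"
        using y2_le by (intro mult_left_mono) auto
      ultimately have "P.expectation (\<lambda>\<omega>. (\<Sum>i=1..n. y n (V i \<omega>))\<^sup>2) \<le> real n * (\<Delta> n)\<^sup>2 + (real n * (L' * (\<Delta> n)\<^sup>2))\<^sup>2"
        using row_second(2)[OF ym y2, of n n] by linarith
      then have "P.expectation (\<lambda>\<omega>. (D n \<omega> - p)\<^sup>2) \<le> (real n * (\<Delta> n)\<^sup>2 + (real n * (L' * (\<Delta> n)\<^sup>2))\<^sup>2) / (real n * \<Delta> n)\<^sup>2"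
        unfolding D_eq[OF elim(2)] using nd by (simp add: divide_right_mono)
      also have "\<dots> = 1 / real n + (L' * \<Delta> n)\<^sup>2"
        using elim \<Delta>(1)[of n] by (simp add: power2_eq_square field_simps)
      finally have "P.expectation (\<lambda>\<omega>. (D n \<omega> - p)\<^sup>2) \<le> 1 / real n + (L' * \<Delta> n)\<^sup>2" .
      moreover have "0 \<le> P.expectation (\<lambda>\<omega>. (D n \<omega> - p)\<^sup>2)"
        by (intro Bochner_Integration.integral_nonneg) auto
      ultimately show ?case by simp
    qed
  qed
  have T: "\<forall>\<^sub>F n in sequentially. \<forall>\<omega>\<in>space P. D n \<omega> \<noteq> 0 \<longrightarrow> T n \<omega> = S n \<omega> / D n \<omega>"
    using ev_small eventually_gt_at_top[of 0]
  proof eventually_elim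
    case (elim n)
    show ?case
    proof (intro ballI impI)
      fix \<omega> assume "D n \<omega> \<noteq> 0"
      define so where "so = (\<Sum>i=1..n. ?oc n (V i \<omega>))"
      define se where "se = (\<Sum>i=1..n. ?ex n (V i \<omega>))"
      define h where "h = sqrt (real n * \<Delta> n)"
      have h: "0 < h" "real n * \<Delta> n = h * h" using elim \<Delta>(1)[of n] by (auto simp: h_def)
      have se: "se \<noteq> 0" using \<open>D n \<omega> \<noteq> 0\<close> by (auto simp: D_def se_def)
      have Se: "S n \<omega> = (so - c * se) / h"
        using elim by (simp add: S_def x_def so_def se_def h_def sum_subtractf sum_distrib_left)
      have De: "D n \<omega> = se / (h * h)" unfolding h(2)[symmetric] by (simp add: D_def se_def)
      have Te: "T n \<omega> = h * (so / se - c)" by (simp add: T_def so_def se_def h_def)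
      show "T n \<omega> = S n \<omega> / D n \<omega>" unfolding Se De Te using h(1) se by (simp add: field_simps)
    qed
  qed
  define \<sigma> where "\<sigma> = sqrt (c / p)"
  have \<sigma>: "0 < \<sigma>" "\<sigma>\<^sup>2 = c / p" using c p by (auto simp: \<sigma>_def)
  have T_char: "(\<lambda>n. char (distr P borel (T n)) u) \<longlonglongrightarrow> char (density lborel (normal_density 0 \<sigma>)) u" for u
  proof -
    have "(\<lambda>n. char (distr P borel (T n)) u) \<longlonglongrightarrow> exp (- ((u / p)\<^sup>2 * (c * p) / 2))"
      by (rule P.ratio_char_tendsto[OF STD_m S2 D2 D0 p T S_char])
    moreover have "(u / p)\<^sup>2 * (c * p) = (\<sigma> * u)\<^sup>2"
      using p unfolding power_mult_distrib \<sigma>(2) by (simp add: power2_eq_square)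
    ultimately show ?thesis by (simp add: char_normal(2)[OF \<sigma>(1)])
  qed
  have "weak_conv_m (\<lambda>n. distr P borel (T n)) (density lborel (normal_density 0 \<sigma>))"
    by (rule levy_continuity[OF P.real_distribution_distr[OF STD_m(3)] char_normal(1)[OF \<sigma>(1)] T_char])
  moreover have "distr P borel (\<lambda>\<omega>. sqrt (real n * \<Delta> n) * (oe_rate Zs Rs j k n (a n) (b n) \<omega> - c)) = distr P borel (T n)" for n
    by (rule distr_cong) (auto simp: oe)
  ultimately show ?thesis by (simp add: a_def b_def c_def p_def \<sigma>_def)
qed

end
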